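(* Let $M$ be a compact connected manifold with a metric, let $K>0$, and let $p$ be a prime number. If for each $n\in\mathbb{N}$ there exists an effective $K$-Lipschitz action of the cyclic group $\mathbb{Z}/p^{n}\mathbb{Z}$ on $M$, then there exists an effective $K$-Lipschitz action of the $p$-Prüfer group $\mathbb{Z}[1/p]/\mathbb{Z}$ on $M$.
   Context: "Manifold with a metric" means a topological manifold equipped with a distance function $d_M$ that induces its topology. An action of a group $G$ on a metric space $(M,d_M)$ is called effective if for each $g\in G\setminus\{e_G\}$ there is some $x\in M$ with $d_M(x,gx)>0$. For $K>0$, an action is called $K$-Lipschitz if $d_M(gx,gy)\le K\,d_M(x,y)$ for all $g\in G$ and all $x,y\in M$. The constant $K$ is fixed and the same for all groups involved. *)

theory Defs
  imports
    "HOL-Analysis.Analysis"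
    "HOL-Algebra.Group_Action"
    "HOL-Algebra.Elementary_Groups"
    "HOL-Computational_Algebra.Primes"
begin

text \<open>
  Manifolds have no boundary. The dimension is a natural number rather than a type, so
  dimension 0 is included.
\<close>

definition topological_manifold :: "nat \<Rightarrow> 'a topology \<Rightarrow> bool" where
  "topological_manifold m X \<longleftrightarrow>
     Hausdorff_space X \<and> second_countable X \<and>
     (\<forall>x \<in> topspace X. \<exists>U V. openin X U \<and> x \<in> U \<and> openin (Euclidean_space m) V \<and>
        subtopology X U homeomorphic_space subtopology (Euclidean_space m) V)"

definition effective_on ::
  "('a \<Rightarrow> 'a \<Rightarrow> real) \<Rightarrow> ('g, 'h) monoid_scheme \<Rightarrow> 'a set \<Rightarrow> ('g \<Rightarrow> 'a \<Rightarrow> 'a) \<Rightarrow> bool" where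
  "effective_on d G M \<phi> \<longleftrightarrow> (\<forall>g \<in> carrier G - {\<one>\<^bsub>G\<^esub>}. \<exists>x \<in> M. d x (\<phi> g x) > 0)"

definition lipschitz_action_on ::
  "real \<Rightarrow> ('a \<Rightarrow> 'a \<Rightarrow> real) \<Rightarrow> ('g, 'h) monoid_scheme \<Rightarrow> 'a set \<Rightarrow> ('g \<Rightarrow> 'a \<Rightarrow> 'a) \<Rightarrow> bool" where
  "lipschitz_action_on K d G M \<phi> \<longleftrightarrow>
     (\<forall>g \<in> carrier G. \<forall>x \<in> M. \<forall>y \<in> M. d (\<phi> g x) (\<phi> g y) \<le> K * d x y)"

text \<open>The additive group $\mathbf{Z}[1/p]$, realised inside the rationals.\<close>

definition Z_inv_group :: "nat \<Rightarrow> rat monoid" where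
  "Z_inv_group p =
     \<lparr>carrier = {of_int a / of_nat p ^ k | (a::int) (k::nat). True}, monoid.mult = (+), one = 0\<rparr>"

definition pruefer_group :: "nat \<Rightarrow> rat set monoid" where
  "pruefer_group p = Z_inv_group p Mod \<int>"

lemma comm_group_Z_inv_group:
  assumes "p > 0"
  shows "comm_group (Z_inv_group p)"
proof (rule comm_groupI)
  fix x y assume "x \<in> carrier (Z_inv_group p)" "y \<in> carrier (Z_inv_group p)"
  then obtain a k b l where *: "x = of_int a / of_nat p ^ k" "y = of_int b / of_nat p ^ l"
    by (auto simp: Z_inv_group_def)
  have "x + y = of_int (a * int p ^ l + b * int p ^ k) / of_nat p ^ (k + l)"
    using assms by (simp add: * field_simps power_add)
  then show "x \<otimes>\<^bsub>Z_inv_group p\<^esub> y \<in> carrier (Z_inv_group p)"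
    unfolding Z_inv_group_def by (simp only: monoid.simps partial_object.simps) blast
next
  have "(0::rat) = of_int 0 / of_nat p ^ 0" by simp
  then show "\<one>\<^bsub>Z_inv_group p\<^esub> \<in> carrier (Z_inv_group p)"
    unfolding Z_inv_group_def by (simp only: monoid.simps partial_object.simps) blast
next
  fix x assume "x \<in> carrier (Z_inv_group p)"
  then obtain a k where *: "x = of_int a / of_nat p ^ k"
    by (auto simp: Z_inv_group_def)
  have "- x = of_int (- a) / of_nat p ^ k" by (simp add: *)
  then have "- x \<in> carrier (Z_inv_group p)"
    unfolding Z_inv_group_def by (simp only: monoid.simps partial_object.simps) blast
  then show "\<exists>y \<in> carrier (Z_inv_group p). y \<otimes>\<^bsub>Z_inv_group p\<^esub> x = \<one>\<^bsub>Z_inv_group p\<^esub>"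
    by (intro bexI[of _ "- x"]) (auto simp: Z_inv_group_def)
qed (auto simp: Z_inv_group_def)

lemma comm_group_pruefer_group:
  assumes "p > 0"
  shows "comm_group (pruefer_group p)"
proof -
  interpret comm_group "Z_inv_group p" by (rule comm_group_Z_inv_group[OF assms])
  have Z: "\<int> \<subseteq> carrier (Z_inv_group p)"
  proof
    fix x :: rat assume "x \<in> \<int>"
    then obtain a where "x = of_int a / of_nat p ^ 0" by (auto elim: Ints_cases)
    then show "x \<in> carrier (Z_inv_group p)"
      unfolding Z_inv_group_def by (simp only: partial_object.simps) blast
  qed
  have "subgroup \<int> (Z_inv_group p)"
  proof (rule subgroupI[OF Z])
    fix a assume a: "a \<in> (\<int> :: rat set)"
    then have "inv\<^bsub>Z_inv_group p\<^esub> a = - a"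
      using Z by (intro inv_equality) (auto simp: Z_inv_group_def subset_iff)
    with a show "inv\<^bsub>Z_inv_group p\<^esub> a \<in> \<int>" by simp
  qed (auto simp: Z_inv_group_def)
  then show ?thesis
    unfolding pruefer_group_def by (rule abelian_FactGroup)
qed

end

(*
  Taking limits of the given actions is easy by compactness; the point is that the limit of the
  subgroups of order p must not be trivial. This is Newman's theorem: on a compact manifold, a
  homeomorphism of prime period p all of whose orbits are small is the identity.

  Newman's theorem is local. In a chart let T have prime period p and small orbits, and suppose that
  T moves the origin. The average f of the iterates of T is T-invariant, close to the identity, and
  equal to the identity on the fixed points; so T acts freely near the zeros of f. A small invariant
  perturbation of f has all its zeros in a disjoint union of translates T^i V (i < p). As T is close to
  the identity, it preserves local orientation classes, so the p pieces of the zero set contribute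
  equally to the local degree of f at the origin, which is therefore divisible by p. But f is homotopic
  to the identity, so the degree is 1.
*)
theory Submission
  imports Defs "HOL-Homology.Homology"
begin

section \<open>The sup distance on Euclidean space\<close>


text \<open>The zero set of the averaged map is an arbitrary closed set, and it has to be caught in
  an open set with disjoint translates before anything can be counted. Zeros are therefore removed
  from the boundary spheres of finitely many balls, along which that open set can then be cut. A
  continuous image of a sphere can fill an open set, so the map is made Lipschitz beforehand; then
  comparing cells with grid points yields a missed value. The sup distance is used because its
  spheres consist of faces of cubes. No integer degree is defined: every class at the origin would
  have to be a p-th power in a group isomorphic to the integers. For the limit, all pairs of a
  rational number and a point are treated at once in a product of compact spaces. A cluster point
  there is controlled at finitely many pairs only; equicontinuity from the common \<open>K\<close>
  makes this sufficient. Newman's theorem is applied at a finite stage, to a generator of the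
  subgroup of order p, not to the limit action.\<close>

abbreviation Esp :: "nat \<Rightarrow> (nat \<Rightarrow> real) set" where
  "Esp m \<equiv> topspace (Euclidean_space m)"

lemma Euclidean_space_eq: "Euclidean_space m = top_of_set (Esp m)"
  unfolding Euclidean_space_def by (simp add: euclidean_product_topology)

lemma mem_Esp: "x \<in> Esp m \<longleftrightarrow> (\<forall>i\<ge>m. x i = 0)"
  by (simp add: topspace_Euclidean_space)

lemma zero_in_Esp [simp]: "(\<lambda>_. 0) \<in> Esp m"
  by (simp add: mem_Esp)

lemma continuous_on_coord:
  fixes f :: "'a::topological_space \<Rightarrow> nat \<Rightarrow> real"
  assumes "continuous_on S f" shows "continuous_on S (\<lambda>x. f x i)"
  using assms by (rule continuous_on_product_then_coordinatewise)

lemma continuous_map_sub_Euclidean_iff: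
  assumes "W \<subseteq> Esp m" "V \<subseteq> Esp n"
  shows "continuous_map (subtopology (Euclidean_space m) W) (subtopology (Euclidean_space n) V) f
     \<longleftrightarrow> continuous_on W f \<and> f \<in> W \<rightarrow> V"
  using assms by (auto simp: continuous_map_in_subtopology cm_Euclidean_space_iff_continuous_on Int_absorb1)

text \<open>A metric only on \<^term>\<open>Esp m\<close>: coordinates beyond \<^term>\<open>m\<close> are ignored.\<close>

primrec supd :: "nat \<Rightarrow> (nat \<Rightarrow> real) \<Rightarrow> (nat \<Rightarrow> real) \<Rightarrow> real" where
  "supd 0 x y = 0"
| "supd (Suc k) x y = max (supd k x y) \<bar>x k - y k\<bar>"

lemma supd_le_iff: "supd m x y \<le> r \<longleftrightarrow> 0 \<le> r \<and> (\<forall>i<m. \<bar>x i - y i\<bar> \<le> r)"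
  by (induction m) (auto simp: less_Suc_eq)

lemma supd_less_iff: "supd m x y < r \<longleftrightarrow> 0 < r \<and> (\<forall>i<m. \<bar>x i - y i\<bar> < r)"
  by (induction m) (auto simp: less_Suc_eq)

lemma supd_nonneg [simp]: "0 \<le> supd m x y"
  by (induction m) auto

lemma supd_coord: "i < m \<Longrightarrow> \<bar>x i - y i\<bar> \<le> supd m x y"
  using supd_le_iff by blast

lemma supd_commute: "supd m x y = supd m y x"
  by (induction m) (auto simp: abs_minus_commute)

lemma supd_self [simp]: "supd m x x = 0"
  by (induction m) auto

lemma supd_triangle: "supd m x z \<le> supd m x y + supd m y z"
proof (induction m)
  case (Suc m)
  then show ?case by (simp add: max_def) (smt (verit))
qed simp

lemma supd_eq_0: "x \<in> Esp m \<Longrightarrow> y \<in> Esp m \<Longrightarrow> supd m x y = 0 \<longleftrightarrow> x = y"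
proof -
  assume "x \<in> Esp m" "y \<in> Esp m"
  moreover have "supd m x y = 0 \<longleftrightarrow> (\<forall>i<m. x i = y i)"
    using supd_le_iff[of m x y 0] supd_nonneg[of m x y] by (smt (verit))
  moreover have "(\<forall>i<m. x i = y i) \<longleftrightarrow> x = y" if "\<forall>i\<ge>m. x i = 0" "\<forall>i\<ge>m. y i = 0"
    using that by (metis ext linorder_not_le)
  ultimately show ?thesis by (simp add: mem_Esp)
qed

text \<open>Puts a point of a sup-sphere on a face of the cube. The condition \<open>r > 0\<close>
  excludes dimension 0, where there is no coordinate to choose.\<close>

lemma supd_attained:
  assumes "supd m x y = r" "r > 0" obtains i where "i < m" "\<bar>x i - y i\<bar> = r"
proof -
  have "\<not> (\<forall>i<m. \<bar>x i - y i\<bar> < r)" using assms supd_less_iff[of m x y r] by auto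
  then obtain i where i: "i < m" "r \<le> \<bar>x i - y i\<bar>" by (auto simp: not_less)
  moreover have "\<bar>x i - y i\<bar> \<le> r" using supd_coord[OF i(1)] assms by metis
  ultimately show ?thesis using that by (meson order_antisym)
qed

lemma continuous_on_supd [continuous_intros]:
  fixes f g :: "'a::topological_space \<Rightarrow> nat \<Rightarrow> real"
  assumes "continuous_on S f" "continuous_on S g"
  shows "continuous_on S (\<lambda>x. supd m (f x) (g x))"
proof (induction m)
  case (Suc m)
  then show ?case
    using continuous_on_coord[OF assms(1), of m] continuous_on_coord[OF assms(2), of m]
    by (simp add: continuous_on_max continuous_on_rabs continuous_on_diff)
qed simp

text \<open>The ball is a product of compact intervals, with the single point 0 in the coordinates
  from \<open>m\<close> on, so Tychonoff's theorem applies.\<close>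

lemma compact_supd_ball: "compact {x \<in> Esp m. supd m x c \<le> r}"
proof (cases "r \<ge> 0")
  case True
  define J where "J = (\<lambda>i. if i < m then {c i - r..c i + r} else {0::real})"
  have "{x \<in> Esp m. supd m x c \<le> r} = (\<Pi>\<^sub>E i\<in>UNIV. J i)"
  proof (intro subset_antisym subsetI)
    fix x assume "x \<in> {x \<in> Esp m. supd m x c \<le> r}"
    then have "x i \<in> J i" for i
      by (cases "i < m") (auto simp: J_def mem_Esp supd_le_iff abs_le_iff algebra_simps)
    then show "x \<in> (\<Pi>\<^sub>E i\<in>UNIV. J i)" by (auto simp: PiE_UNIV_domain)
  next
    fix x assume "x \<in> (\<Pi>\<^sub>E i\<in>UNIV. J i)"
    then have "x i \<in> J i" for i by (auto simp: PiE_UNIV_domain)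
    then have *: "x i \<in> (if i < m then {c i - r..c i + r} else {0})" for i by (simp add: J_def)
    have "x i = 0" if "i \<ge> m" for i using *[of i] that by auto
    moreover have "\<bar>x i - c i\<bar> \<le> r" if "i < m" for i using *[of i] that by auto
    ultimately show "x \<in> {x \<in> Esp m. supd m x c \<le> r}"
      using True by (auto simp: mem_Esp supd_le_iff)
  qed
  moreover have "compactin (product_topology (\<lambda>i. euclideanreal) UNIV) (\<Pi>\<^sub>E i\<in>UNIV. J i)"
    by (subst compactin_PiE) (auto simp: J_def)
  ultimately show ?thesis
    by (simp add: euclidean_product_topology)
next
  case False
  then have "{x \<in> Esp m. supd m x c \<le> r} = {}" by (auto simp: supd_le_iff)
  then show ?thesis by (metis compact_empty)
qed

lemma openin_Esp_iff:
  "openin (top_of_set (Esp m)) U \<longleftrightarrow>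
     U \<subseteq> Esp m \<and> (\<forall>x\<in>U. \<exists>d>0. \<forall>y\<in>Esp m. supd m y x \<le> d \<longrightarrow> y \<in> U)" (is "_ \<longleftrightarrow> ?R")
proof
  assume L: "openin (top_of_set (Esp m)) U"
  then obtain O' where O': "open O'" "U = Esp m \<inter> O'" by (auto simp: openin_open)
  have "\<exists>d>0. \<forall>y\<in>Esp m. supd m y x \<le> d \<longrightarrow> y \<in> U" if "x \<in> U" for x
  proof -
    have "openin (product_topology (\<lambda>i::nat. euclideanreal) UNIV) O'"
      using O' by (simp add: euclidean_product_topology)
    moreover have "x \<in> O'" using that O' by auto
    ultimately obtain X where X: "x \<in> (\<Pi>\<^sub>E i\<in>UNIV. X i)" "\<And>i. open (X i)" "(\<Pi>\<^sub>E i\<in>UNIV. X i) \<subseteq> O'"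
      using product_topology_open_contains_basis[of "\<lambda>i::nat. euclideanreal" UNIV O' x] by auto
    have "\<forall>i. \<exists>d>0. cball (x i) d \<subseteq> X i"
      using X by (meson open_contains_cball PiE_mem UNIV_I)
    then obtain d where d: "\<And>i. d i > 0" "\<And>i. cball (x i) (d i) \<subseteq> X i" by metis
    \<comment> \<open>Points of \<open>Esp m\<close> agree in the coordinates from \<open>m\<close>
      on, so finitely many radii suffice. The 1 keeps the minimum defined for
      \<open>m = 0\<close>.\<close>
    define e where "e = Min (insert 1 (d ` {..<m}))"
    have e: "e > 0" "\<And>i. i < m \<Longrightarrow> e \<le> d i" using d by (auto simp: e_def)
    have "y \<in> U" if y: "y \<in> Esp m" "supd m y x \<le> e" for y
    proof -
      have "y i \<in> X i" for i
      proof (cases "i < m")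
        case True
        then have "\<bar>y i - x i\<bar> \<le> d i" using y e by (force simp: supd_le_iff)
        then show ?thesis using d by (auto simp: dist_real_def subset_iff abs_minus_commute)
      next
        case False
        then have "y i = x i" using y \<open>x \<in> U\<close> O' by (auto simp: mem_Esp)
        then show ?thesis using X by auto
      qed
      then show ?thesis using X y O' by (auto simp: PiE_UNIV_domain)
    qed
    then show ?thesis using e by blast
  qed
  then show ?R using O' by auto
next
  assume R: ?R
  show "openin (top_of_set (Esp m)) U"
  proof (subst openin_subopen, intro ballI)
    fix x assume "x \<in> U"
    then obtain d where d: "d > 0" "\<And>y. y \<in> Esp m \<Longrightarrow> supd m y x \<le> d \<Longrightarrow> y \<in> U" using R by blast
    have "openin (top_of_set (Esp m)) (Esp m \<inter> (\<lambda>y. supd m y x) -` {..<d})"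
      by (rule continuous_openin_preimage_gen) (auto intro!: continuous_intros)
    then show "\<exists>T. openin (top_of_set (Esp m)) T \<and> x \<in> T \<and> T \<subseteq> U"
      using d \<open>x \<in> U\<close> R by (intro exI[of _ "Esp m \<inter> (\<lambda>y. supd m y x) -` {..<d}"]) auto
  qed
qed

lemma continuous_on_supdE:
  assumes "openin (top_of_set (Esp m)) W" "continuous_on W f" "f \<in> W \<rightarrow> Esp n" "x \<in> W" "e > 0"
  obtains d where "d > 0" "\<And>y. y \<in> Esp m \<Longrightarrow> supd m y x \<le> d \<Longrightarrow> y \<in> W \<and> supd n (f y) (f x) < e"
proof -
  have "openin (top_of_set W) (W \<inter> (\<lambda>y. supd n (f y) (f x)) -` {..<e})"
    by (rule continuous_openin_preimage_gen) (auto intro!: continuous_intros assms)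
  then have "openin (top_of_set (Esp m)) (W \<inter> (\<lambda>y. supd n (f y) (f x)) -` {..<e})"
    using assms(1) openin_trans by blast
  moreover have "x \<in> W \<inter> (\<lambda>y. supd n (f y) (f x)) -` {..<e}" using assms by simp
  ultimately obtain d where "d > 0"
      "\<forall>y\<in>Esp m. supd m y x \<le> d \<longrightarrow> y \<in> W \<inter> (\<lambda>y. supd n (f y) (f x)) -` {..<e}"
    unfolding openin_Esp_iff by meson
  then show ?thesis by (intro that[of d]) auto
qed

section \<open>Relative homology near the pieces of a closed set\<close>


text \<open>Relative homology sees only the trace of a subspace on the carrier, so the composition
  law needs no inclusion of \<open>S\<close>, \<open>T\<close>, \<open>U\<close> in the spaces. This
  is what allows plain complements \<open>- A\<close> as subspaces throughout.\<close>

lemma hom_induced_compose_gen: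
  assumes "continuous_map X Y f" "continuous_map Y Z g"
    and "\<And>x. x \<in> topspace X \<Longrightarrow> x \<in> S \<Longrightarrow> f x \<in> T"
    and "\<And>y. y \<in> topspace Y \<Longrightarrow> y \<in> T \<Longrightarrow> g y \<in> U"
  shows "hom_induced p Y T Z U g (hom_induced p X S Y T f c) = hom_induced p X S Z U (g \<circ> f) c"
proof -
  have "hom_induced p Y (topspace Y \<inter> T) Z (topspace Z \<inter> U) g (hom_induced p X (topspace X \<inter> S) Y (topspace Y \<inter> T) f c)
     = hom_induced p X (topspace X \<inter> S) Z (topspace Z \<inter> U) (g \<circ> f) c"
    using assms by (intro hom_induced_compose') (auto simp: continuous_map_def Pi_iff)
  then show ?thesis by simp
qed

lemma group_hom_hom_induced:
  "group_hom (relative_homology_group p X S) (relative_homology_group p Y T) (hom_induced p X S Y T f)"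
  by (simp add: group_hom_def group_hom_axioms_def hom_induced_hom)

text \<open>The map factors through the pair \<open>(X, UNIV)\<close>, whose homology is
  trivial.\<close>

lemma hom_induced_trivial_image:
  assumes "continuous_map X Y f" and "\<And>x. x \<in> topspace X \<Longrightarrow> f x \<in> T"
  shows "hom_induced p X S Y T f c = \<one>\<^bsub>relative_homology_group p Y T\<^esub>"
proof (cases "c \<in> carrier (relative_homology_group p X S)")
  case True
  have "hom_induced p X S Y T f c = hom_induced p X UNIV Y T f (hom_induced p X S X UNIV id c)"
    using assms by (subst hom_induced_compose_gen) auto
  also have "hom_induced p X S X UNIV id c = \<one>\<^bsub>relative_homology_group p X UNIV\<^esub>"
  proof -
    have "trivial_group (relative_homology_group p X UNIV)"
      using trivial_relative_homology_group_topspace[of p X] relative_homology_group_restrict[of p X UNIV]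
      by simp
    then show ?thesis
      using hom_induced_carrier[of p X S X UNIV id c] by (auto simp: trivial_group_def)
  qed
  also have "hom_induced p X UNIV Y T f \<one>\<^bsub>relative_homology_group p X UNIV\<^esub> = \<one>\<^bsub>relative_homology_group p Y T\<^esub>"
    by (rule group_hom.hom_one[OF group_hom_hom_induced])
  finally show ?thesis .
next
  case False
  \<comment> \<open>Outside the carrier, \<open>hom_induced\<close> takes the neutral element as its
    default value.\<close>
  then show ?thesis by (intro hom_induced_default) auto
qed

text \<open>The complement of \<open>U\<close> is closed and lies in the open complement of
  \<open>A\<close>, so it may be excised: a class relative to \<open>- A\<close> is determined near
  \<open>A\<close>.\<close>

lemma excision_open_nbhd:
  assumes "openin X U" "closedin X A" "A \<subseteq> U"
  shows "hom_induced p (subtopology X U) (- A) X (- A) id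
    \<in> iso (relative_homology_group p (subtopology X U) (- A)) (relative_homology_group p X (- A))"
proof -
  have U: "U \<subseteq> topspace X" using assms(1) by (rule openin_subset)
  have "X closure_of (topspace X - U) \<subseteq> X interior_of (topspace X - A)"
    using assms by (simp add: closure_of_closedin interior_of_openin closedin_diff openin_diff) blast
  from homology_excision_axiom[OF this, of "topspace X" p]
  have "hom_induced p (subtopology X (topspace X - (topspace X - U))) (topspace X - A - (topspace X - U)) X (topspace X - A) id
    \<in> iso (relative_homology_group p (subtopology X (topspace X - (topspace X - U))) (topspace X - A - (topspace X - U)))
        (relative_homology_group p X (topspace X - A))"
    by simp
  moreover have "topspace X - (topspace X - U) = U" "topspace X - A - (topspace X - U) = U - A"
    using U by auto
  ultimately have *: "hom_induced p (subtopology X U) (U - A) X (topspace X - A) id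
    \<in> iso (relative_homology_group p (subtopology X U) (U - A)) (relative_homology_group p X (topspace X - A))"
    by simp
  have "hom_induced p (subtopology X U) (- A) X (- A) id = hom_induced p (subtopology X U) (U - A) X (topspace X - A) id"
    using hom_induced_restrict[of p "subtopology X U" "- A" X "- A"] U by (simp add: Int_absorb1 Diff_eq)
  moreover have "relative_homology_group p (subtopology X U) (- A) = relative_homology_group p (subtopology X U) (U - A)"
    using relative_homology_group_restrict[of p "subtopology X U" "- A"] U by (simp add: Int_absorb1 Diff_eq)
  moreover have "relative_homology_group p X (- A) = relative_homology_group p X (topspace X - A)"
    using relative_homology_group_restrict[of p X "- A"] by (simp add: Diff_eq)
  ultimately show ?thesis using * by simp
qed

text \<open>Exactness of the sequence of a triple at its middle term: a class that dies relative to
  \<open>T\<close> comes from inside \<open>T\<close>.\<close>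

lemma hom_induced_kernel_lifts:
  assumes "S \<subseteq> T" "\<alpha> \<in> carrier (relative_homology_group p X S)"
    and "hom_induced p X S X T id \<alpha> = \<one>\<^bsub>relative_homology_group p X T\<^esub>"
  obtains \<gamma> where "\<gamma> \<in> carrier (relative_homology_group p (subtopology X T) S)"
    "hom_induced p (subtopology X T) S X S id \<gamma> = \<alpha>"
proof -
  have "\<alpha> \<in> kernel (relative_homology_group p X S) (relative_homology_group p X T) (hom_induced p X S X T id)"
    using assms by (simp add: kernel_def)
  also have "\<dots> = hom_induced p (subtopology X T) S X S id ` carrier (relative_homology_group p (subtopology X T) S)"
    using homology_exactness_triple_3[OF assms(1), of p X] by simp
  finally show ?thesis using that by blast
qed

text \<open>The pieces \<^term>\<open>A \<inter> U i\<close> are split off one at a time, by excision and the exact sequence of a triple;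
  \<^term>\<open>x\<close> is the common contribution of each piece.\<close>

lemma hom_induced_power_of_pieces:
  fixes n :: nat and U :: "nat \<Rightarrow> 'a set" and X :: "'a topology" and Y :: "'b topology"
  assumes "closedin X A" "\<And>i. i < n \<Longrightarrow> openin X (U i)"
    and "\<And>i j. i < n \<Longrightarrow> j < n \<Longrightarrow> i \<noteq> j \<Longrightarrow> U i \<inter> U j = {}"
    and "A \<subseteq> (\<Union>i<n. U i)"
    and "\<alpha> \<in> carrier (relative_homology_group p X (- A))"
    and "continuous_map X Y f" "\<And>x. x \<in> topspace X \<Longrightarrow> x \<notin> A \<Longrightarrow> f x \<in> T"
    and "x \<in> carrier (relative_homology_group p Y T)"
    and "\<And>i \<beta>. i < n \<Longrightarrow> \<beta> \<in> carrier (relative_homology_group p (subtopology X (U i)) (- A)) \<Longrightarrow>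
        hom_induced p (subtopology X (U i)) (- A) X (- (A \<inter> U i)) id \<beta> =
        hom_induced p X (- A) X (- (A \<inter> U i)) id \<alpha> \<Longrightarrow>
        hom_induced p (subtopology X (U i)) (- A) Y T f \<beta> = x"
  shows "hom_induced p X (- A) Y T f \<alpha> = x [^]\<^bsub>relative_homology_group p Y T\<^esub> n"
  using assms
\<comment> \<open>\<open>X\<close> has to vary, because each step deletes a piece from the space
  itself.\<close>
proof (induction n arbitrary: X A \<alpha>)
  case 0
  then have "\<And>x. x \<in> topspace X \<Longrightarrow> f x \<in> T" by auto
  then show ?case using 0 by (simp add: hom_induced_trivial_image)
next
  case (Suc n)
  note A = Suc.prems(1) and U = Suc.prems(2) and dis = Suc.prems(3) and cov = Suc.prems(4)
    and \<alpha> = Suc.prems(5) and f = Suc.prems(6,7) and x = Suc.prems(8) and pieces = Suc.prems(9)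
  let ?H = "relative_homology_group p"
  let ?K = "\<lambda>X S. hom_induced p X S"
  interpret Y: comm_group "?H Y T" by simp
  interpret XA: comm_group "?H X (- A)" by simp
  interpret f: group_hom "?H X (- A)" "?H Y T" "hom_induced p X (- A) Y T f"
    by (rule group_hom_hom_induced)
  define B where "B = A \<inter> U n"
  have AX: "A \<subseteq> topspace X" using A by (rule closedin_subset)
  \<comment> \<open>Written as \<open>A\<close> minus the other open sets, the piece is visibly
    closed.\<close>
  have eqB: "B = A - (\<Union>i<n. U i)"
  proof (intro subset_antisym subsetI)
    fix y assume y: "y \<in> B"
    have "y \<notin> U i" if "i < n" for i using dis[of i n] that y by (auto simp: B_def)
    then show "y \<in> A - (\<Union>i<n. U i)" using y by (auto simp: B_def)
  next
    fix y assume y: "y \<in> A - (\<Union>i<n. U i)"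
    then have "y \<in> (\<Union>i<Suc n. U i)" using cov by blast
    then show "y \<in> B" using y by (auto simp: B_def less_Suc_eq)
  qed
  have B: "closedin X B" unfolding eqB using A U by (intro closedin_diff openin_Union) auto
  have eqA: "topspace (subtopology X (U n)) \<inter> - A = topspace (subtopology X (U n)) \<inter> - B"
    by (auto simp: B_def)
  have HUn: "?H (subtopology X (U n)) (- A) = ?H (subtopology X (U n)) (- B)"
    using eqA relative_homology_group_restrict by metis
  have "hom_induced p (subtopology X (U n)) (- B) X (- B) id
    \<in> iso (?H (subtopology X (U n)) (- B)) (?H X (- B))"
    using B U[of n] by (intro excision_open_nbhd) (auto simp: B_def)
  then have "hom_induced p (subtopology X (U n)) (- B) X (- B) id ` carrier (?H (subtopology X (U n)) (- B)) = carrier (?H X (- B))"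
    by (simp add: iso_iff)
  moreover have "hom_induced p X (- A) X (- B) id \<alpha> \<in> carrier (?H X (- B))" by (rule hom_induced_carrier)
  ultimately have "hom_induced p X (- A) X (- B) id \<alpha>
    \<in> hom_induced p (subtopology X (U n)) (- B) X (- B) id ` carrier (?H (subtopology X (U n)) (- B))"
    by simp
  \<comment> \<open>By excision, \<beta> represents \<alpha> near the piece
    \<open>B\<close>.\<close>
  then obtain \<beta> where \<beta>: "\<beta> \<in> carrier (?H (subtopology X (U n)) (- B))"
      "hom_induced p (subtopology X (U n)) (- B) X (- B) id \<beta> = hom_induced p X (- A) X (- B) id \<alpha>"
    by (elim imageE) simp
  \<comment> \<open>Needed for targets over \<open>'b\<close> (the map \<open>f\<close>) and again
    over \<open>'a\<close> (the inclusions), because types are fixed inside a proof.\<close>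
  have KUn: "hom_induced p (subtopology X (U n)) (- A) Z V g = hom_induced p (subtopology X (U n)) (- B) Z V g"
    for Z :: "'b topology" and V g
    using hom_induced_restrict[of p "subtopology X (U n)" "- A" Z V]
      hom_induced_restrict[of p "subtopology X (U n)" "- B" Z V] eqA by metis
  have KUn': "hom_induced p (subtopology X (U n)) (- A) Z V g = hom_induced p (subtopology X (U n)) (- B) Z V g"
    for Z :: "'a topology" and V g
    using hom_induced_restrict[of p "subtopology X (U n)" "- A" Z V]
      hom_induced_restrict[of p "subtopology X (U n)" "- B" Z V] eqA by metis
  let ?\<iota> = "hom_induced p (subtopology X (U n)) (- A) X (- A) id"
  have \<beta>A: "\<beta> \<in> carrier (?H (subtopology X (U n)) (- A))" using \<beta> HUn by simp
  have cU: "continuous_map (subtopology X V) X id" for V by simp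
  have fU: "continuous_map (subtopology X V) Y f" for V using f(1) by (rule continuous_map_from_subtopology)
  have f\<beta>: "hom_induced p X (- A) Y T f (?\<iota> \<beta>) = x"
  proof -
    have "hom_induced p X (- A) Y T f (?\<iota> \<beta>) = hom_induced p (subtopology X (U n)) (- A) Y T f \<beta>"
      using f by (subst hom_induced_compose_gen) auto
    also have "\<dots> = x" 
    proof (rule pieces[OF _ \<beta>A])
      show "hom_induced p (subtopology X (U n)) (- A) X (- (A \<inter> U n)) id \<beta> = hom_induced p X (- A) X (- (A \<inter> U n)) id \<alpha>"
        using \<beta>(2) KUn' B_def by metis
    qed simp
    finally show ?thesis .
  qed
  have \<iota>\<beta>: "?\<iota> \<beta> \<in> carrier (?H X (- A))" by (rule hom_induced_carrier)
  \<comment> \<open>\<delta> is \<alpha> with the contribution of \<open>B\<close> removed. It dies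
    relative to the complement of \<open>B\<close>, hence lifts to that complement, where only
    \<open>n\<close> pieces remain.\<close>
  define \<delta> where "\<delta> = \<alpha> \<otimes>\<^bsub>?H X (- A)\<^esub> inv\<^bsub>?H X (- A)\<^esub> (?\<iota> \<beta>)"
  have \<delta>: "\<delta> \<in> carrier (?H X (- A))" using \<alpha> \<iota>\<beta> by (simp add: \<delta>_def)
  have \<alpha>eq: "\<alpha> = \<delta> \<otimes>\<^bsub>?H X (- A)\<^esub> ?\<iota> \<beta>" using \<alpha> \<iota>\<beta> by (simp add: \<delta>_def XA.m_assoc)
  have \<delta>1: "hom_induced p X (- A) X (- B) id \<delta> = \<one>\<^bsub>?H X (- B)\<^esub>"
  proof -
    interpret XB: comm_group "?H X (- B)" by simp
    interpret j: group_hom "?H X (- A)" "?H X (- B)" "hom_induced p X (- A) X (- B) id"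
      by (rule group_hom_hom_induced)
    have "hom_induced p X (- A) X (- B) id (?\<iota> \<beta>) = hom_induced p (subtopology X (U n)) (- A) X (- B) id \<beta>"
      by (subst hom_induced_compose_gen) (auto simp: B_def)
    also have "\<dots> = hom_induced p X (- A) X (- B) id \<alpha>" using \<beta>(2) KUn' by metis
    finally show ?thesis
      using \<alpha> \<iota>\<beta> by (simp add: \<delta>_def)
  qed
  have "- A \<subseteq> - B" by (auto simp: B_def)
  from hom_induced_kernel_lifts[OF this \<delta> \<delta>1] obtain \<gamma>
    where \<gamma>: "\<gamma> \<in> carrier (?H (subtopology X (- B)) (- A))"
      "hom_induced p (subtopology X (- B)) (- A) X (- A) id \<gamma> = \<delta>" by blast
  let ?X = "subtopology X (- B)"
  let ?A = "A - B"
  have eqA': "topspace ?X \<inter> - A = topspace ?X \<inter> - ?A" by auto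
  have KX: "hom_induced p ?X (- A) Z V g = hom_induced p ?X (- ?A) Z V g" for Z :: "'b topology" and V g
    using hom_induced_restrict[of p ?X "- A" Z V] hom_induced_restrict[of p ?X "- ?A" Z V] eqA' by metis
  have KX': "hom_induced p ?X (- A) Z V g = hom_induced p ?X (- ?A) Z V g" for Z :: "'a topology" and V g
    using hom_induced_restrict[of p ?X "- A" Z V] hom_induced_restrict[of p ?X "- ?A" Z V] eqA' by metis
  have HX: "?H ?X (- A) = ?H ?X (- ?A)" using eqA' relative_homology_group_restrict by metis
  have "hom_induced p ?X (- ?A) Y T f \<gamma> = x [^]\<^bsub>?H Y T\<^esub> n"
  proof (rule Suc.IH)
    show "closedin ?X ?A" using A by (auto simp: closedin_subtopology)
    show "openin ?X (U i)" if "i < n" for i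
    proof -
      have "U i \<subseteq> - B" using that by (auto simp: eqB)
      then show ?thesis using U[of i] that by (auto simp: openin_subtopology)
    qed
    show "U i \<inter> U j = {}" if "i < n" "j < n" "i \<noteq> j" for i j using dis[of i j] that by simp
    show "?A \<subseteq> (\<Union>i<n. U i)" using eqB by auto
    show "\<gamma> \<in> carrier (?H ?X (- ?A))" using \<gamma> HX by simp
    show "continuous_map ?X Y f" by (rule fU)
    show "f x \<in> T" if "x \<in> topspace ?X" "x \<notin> ?A" for x using f that by auto
    show "x \<in> carrier (?H Y T)" by (rule x)
    fix i \<beta>' assume i: "i < n" and \<beta>': "\<beta>' \<in> carrier (?H (subtopology ?X (U i)) (- ?A))"
      and eq: "hom_induced p (subtopology ?X (U i)) (- ?A) ?X (- (?A \<inter> U i)) id \<beta>' =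
        hom_induced p ?X (- ?A) ?X (- (?A \<inter> U i)) id \<gamma>"
    have sub: "subtopology ?X (U i) = subtopology X (U i)"
    proof -
      have "- B \<inter> U i = U i" using i by (auto simp: eqB)
      then show ?thesis by (simp add: subtopology_subtopology)
    qed
    have eqAi: "topspace (subtopology X (U i)) \<inter> - ?A = topspace (subtopology X (U i)) \<inter> - A"
      using i by (auto simp: eqB)
    have Ai: "?A \<inter> U i = A \<inter> U i" using i by (auto simp: eqB)
    have KUi: "hom_induced p (subtopology X (U i)) (- ?A) Z V g = hom_induced p (subtopology X (U i)) (- A) Z V g"
      for Z :: "'b topology" and V g
      using hom_induced_restrict[of p "subtopology X (U i)" "- A" Z V]
        hom_induced_restrict[of p "subtopology X (U i)" "- ?A" Z V] eqAi by metis
    have KUi': "hom_induced p (subtopology X (U i)) (- ?A) Z V g = hom_induced p (subtopology X (U i)) (- A) Z V g"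
      for Z :: "'a topology" and V g
      using hom_induced_restrict[of p "subtopology X (U i)" "- A" Z V]
        hom_induced_restrict[of p "subtopology X (U i)" "- ?A" Z V] eqAi by metis
    have \<beta>'A: "\<beta>' \<in> carrier (?H (subtopology X (U i)) (- A))"
      using \<beta>' sub eqAi relative_homology_group_restrict by metis
    have UB: "U i \<subseteq> - B" using i by (auto simp: eqB)
    have "hom_induced p (subtopology X (U i)) (- A) Y T f \<beta>' = x"
    proof (rule pieces[OF _ \<beta>'A])
      show "i < Suc n" using i by simp
      let ?J = "hom_induced p X (- A) X (- (A \<inter> U i)) id"
      interpret XA': comm_group "?H X (- (A \<inter> U i))" by simp
      interpret j: group_hom "?H X (- A)" "?H X (- (A \<inter> U i))" ?J
        by (rule group_hom_hom_induced)
      \<comment> \<open>The removed class lives on \<open>U n\<close>, which misses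
        \<open>U i\<close>; hence \<delta> and \<alpha> have the same local class at piece
        \<open>i\<close>, and the hypothesis on pieces still applies.\<close>
      have 1: "?J (?\<iota> \<beta>) = \<one>\<^bsub>?H X (- (A \<inter> U i))\<^esub>"
      proof -
        have "?J (?\<iota> \<beta>) = hom_induced p (subtopology X (U n)) (- A) X (- (A \<inter> U i)) id \<beta>"
          by (subst hom_induced_compose_gen) auto
        also have "\<dots> = \<one>\<^bsub>?H X (- (A \<inter> U i))\<^esub>"
          using dis[of i n] i by (intro hom_induced_trivial_image) auto
        finally show ?thesis .
      qed
      have 2: "?J \<delta> = hom_induced p ?X (- A) X (- (A \<inter> U i)) id \<gamma>"
        unfolding \<gamma>(2)[symmetric] by (subst hom_induced_compose_gen) auto
      have 3: "\<dots> = hom_induced p ?X (- (A \<inter> U i)) X (- (A \<inter> U i)) id (hom_induced p ?X (- A) ?X (- (A \<inter> U i)) id \<gamma>)"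
        by (subst hom_induced_compose_gen) auto
      have 4: "hom_induced p ?X (- A) ?X (- (A \<inter> U i)) id \<gamma> = hom_induced p (subtopology X (U i)) (- A) ?X (- (A \<inter> U i)) id \<beta>'"
        using eq unfolding sub Ai KX' KUi' by simp
      have "?J \<alpha> = ?J \<delta> \<otimes>\<^bsub>?H X (- (A \<inter> U i))\<^esub> ?J (?\<iota> \<beta>)"
        by (subst \<alpha>eq) (rule j.hom_mult[OF \<delta> \<iota>\<beta>])
      also have "\<dots> = ?J \<delta>" unfolding 1 by (rule XA'.r_one[OF j.hom_closed[OF \<delta>]])
      also have "\<dots> = hom_induced p ?X (- (A \<inter> U i)) X (- (A \<inter> U i)) id (hom_induced p (subtopology X (U i)) (- A) ?X (- (A \<inter> U i)) id \<beta>')"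
        unfolding 2 3 4 ..
      also have "\<dots> = hom_induced p (subtopology X (U i)) (- A) X (- (A \<inter> U i)) id \<beta>'"
        using UB by (subst hom_induced_compose_gen) (auto simp: continuous_map_in_subtopology)
      finally show "hom_induced p (subtopology X (U i)) (- A) X (- (A \<inter> U i)) id \<beta>' = ?J \<alpha>" ..
    qed
    then show "hom_induced p (subtopology ?X (U i)) (- ?A) Y T f \<beta>' = x"
      unfolding sub KUi .
  qed
  then have f\<delta>: "hom_induced p X (- A) Y T f \<delta> = x [^]\<^bsub>?H Y T\<^esub> n"
    unfolding \<gamma>(2)[symmetric] KX[symmetric] using f by (subst hom_induced_compose_gen) auto
  show ?case
    using \<delta> \<iota>\<beta> f\<delta> f\<beta> by (subst \<alpha>eq) simp
qed

section \<open>Homology of punctured Euclidean space\<close>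


lemma continuous_map_Euclidean_iff:
  "continuous_map X (Euclidean_space m) f \<longleftrightarrow>
    (\<forall>i. continuous_map X euclideanreal (\<lambda>x. f x i)) \<and> f \<in> topspace X \<rightarrow> Esp m"
  unfolding Euclidean_space_def continuous_map_in_subtopology continuous_map_componentwise_UNIV
  by (simp add: Pi_iff image_subset_iff)

lemma homotopic_with_line:
  assumes f: "continuous_map X (Euclidean_space m) f" and g: "continuous_map X (Euclidean_space m) g"
    and V: "\<And>x t. x \<in> topspace X \<Longrightarrow> 0 \<le> t \<Longrightarrow> t \<le> 1 \<Longrightarrow> (\<lambda>i. (1 - t) * f x i + t * g x i) \<in> V"
    and P: "\<And>t. 0 \<le> t \<Longrightarrow> t \<le> 1 \<Longrightarrow> P (\<lambda>x i. (1 - t) * f x i + t * g x i)"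
  shows "homotopic_with P X (subtopology (Euclidean_space m) V) f g"
proof -
  define h where "h = (\<lambda>(t::real, x) i. (1 - t) * f x i + t * g x i)"
  have fi: "continuous_map X euclideanreal (\<lambda>x. f x i)" "continuous_map X euclideanreal (\<lambda>x. g x i)" for i
    using f g by (auto simp: continuous_map_Euclidean_iff)
  have fs: "continuous_map (prod_topology (top_of_set {0..1}) X) euclideanreal (\<lambda>z. fst z)"
    using continuous_map_fst[of "top_of_set {0..1::real}" X] continuous_map_into_fulltopology by blast
  have sn: "continuous_map (prod_topology (top_of_set {0..1::real}) X) euclideanreal (\<lambda>z. f (snd z) i)"
    "continuous_map (prod_topology (top_of_set {0..1::real}) X) euclideanreal (\<lambda>z. g (snd z) i)" for i
    using continuous_map_compose[OF continuous_map_snd fi(1)] continuous_map_compose[OF continuous_map_snd fi(2)]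
    by (auto simp: o_def)
  have im: "f \<in> topspace X \<rightarrow> Esp m" "g \<in> topspace X \<rightarrow> Esp m"
    using f g by (auto simp: continuous_map_Euclidean_iff)
  have "continuous_map (prod_topology (top_of_set {0..1}) X) (subtopology (Euclidean_space m) V) h"
    unfolding continuous_map_in_subtopology continuous_map_Euclidean_iff
  proof (intro conjI allI)
    show "continuous_map (prod_topology (top_of_set {0..1}) X) euclideanreal (\<lambda>x. h x i)" for i
      unfolding h_def case_prod_unfold by (intro continuous_intros fs sn)
    show "h \<in> topspace (prod_topology (top_of_set {0..1}) X) \<rightarrow> Esp m"
      using im by (auto simp: h_def mem_Esp Pi_iff)
    show "h \<in> topspace (prod_topology (top_of_set {0..1}) X) \<rightarrow> V"
      using V by (auto simp: h_def)
  qed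
  moreover have "P (\<lambda>x. h (t, x))" if "t \<in> {0..1}" for t
    using P[of t] that by (simp add: h_def)
  ultimately show ?thesis
    unfolding homotopic_with_def by (intro exI[of _ h]) (auto simp: h_def)
qed

text \<open>The ambient space is convex, so the straight-line homotopy is restricted only over
  \<open>S\<close>, where its segments must stay in \<open>T\<close>.\<close>

lemma hom_induced_line:
  assumes f: "continuous_map X (Euclidean_space m) f" and g: "continuous_map X (Euclidean_space m) g"
    and S: "\<And>x t. x \<in> topspace X \<Longrightarrow> x \<in> S \<Longrightarrow> 0 \<le> t \<Longrightarrow> t \<le> 1 \<Longrightarrow> (\<lambda>i. (1 - t) * f x i + t * g x i) \<in> T"
  shows "hom_induced p X S (Euclidean_space m) T f = hom_induced p X S (Euclidean_space m) T g"
proof -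
  have "homotopic_with (\<lambda>h. h \<in> topspace X \<inter> S \<rightarrow> T) X (subtopology (Euclidean_space m) UNIV) f g"
    using S by (intro homotopic_with_line f g) auto
  from homology_homotopy_axiom[OF this, of p]
  have "hom_induced p X (topspace X \<inter> S) (Euclidean_space m) T f = hom_induced p X (topspace X \<inter> S) (Euclidean_space m) T g"
    by simp
  moreover have "hom_induced p X (topspace X \<inter> S) (Euclidean_space m) T = hom_induced p X S (Euclidean_space m) T"
    using hom_induced_restrict[of p X S "Euclidean_space m" T]
      hom_induced_restrict[of p X "topspace X \<inter> S" "Euclidean_space m" T] by (simp add: Int_assoc[symmetric])
  ultimately show ?thesis by simp
qed

text \<open>Both claims use the boundary isomorphisms of a contractible space: the punctured space
  is equivalent to a sphere, and that sphere can be scaled out of \<open>D\<close>. By surjectivity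
  every class at the origin comes from one relative to the complement of a whole ball, which leaves
  room for homotopies that move points a little.\<close>

lemma homology_Euclidean_punctured:
  fixes n :: nat and r :: real
  defines "E \<equiv> Euclidean_space (Suc n)" and "D \<equiv> {x. supd (Suc n) x (\<lambda>_. 0) \<le> r}"
  assumes r: "0 \<le> r"
  shows "relative_homology_group (int (Suc n)) E (- {\<lambda>_. 0}) \<cong> integer_group"
    and "hom_induced (int (Suc n)) E (- D) E (- {\<lambda>_. 0}) id ` carrier (relative_homology_group (int (Suc n)) E (- D))
      = carrier (relative_homology_group (int (Suc n)) E (- {\<lambda>_. 0}))"
proof -
  let ?o = "\<lambda>_::nat. 0::real"
  let ?S = "subtopology E (- {?o})" and ?SD = "subtopology E (- D)"
  define nm where "nm = (\<lambda>x::nat\<Rightarrow>real. sqrt (\<Sum>i\<le>n. (x i)\<^sup>2))"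
  \<comment> \<open>A point of the Euclidean unit sphere has a coordinate of size at least
    \<open>1 / sqrt (Suc n)\<close>, so scaling by \<open>R\<close> takes it out of the cube of
    half-side \<open>r\<close>. The \<open>+ 1\<close> makes this strict, also for
    \<open>r = 0\<close>.\<close>
  define R where "R = (r + 1) * real (Suc n)"
  have R: "R > 0" using r by (simp add: R_def)
  define s where "s = (\<lambda>x::nat\<Rightarrow>real. \<lambda>i. R * x i)"
  define \<rho> where "\<rho> = (\<lambda>x::nat\<Rightarrow>real. \<lambda>i. x i / nm x)"
  have oD: "?o \<in> D" using r by (simp add: D_def)
  have nm0: "nm x > 0" if "x \<in> Esp (Suc n)" "x \<noteq> ?o" for x
  proof -
    have "\<exists>i\<le>n. x i \<noteq> 0" using that by (auto simp: mem_Esp fun_eq_iff) (metis not_less_eq_eq)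
    then have "(\<Sum>i\<le>n. (x i)\<^sup>2) \<noteq> 0" by (auto simp: sum_nonneg_eq_0_iff)
    then show ?thesis unfolding nm_def by (simp add: sum_nonneg less_le)
  qed
  have nmS: "nm x = 1" if "x \<in> topspace (nsphere n)" for x
    using that by (simp add: nm_def nsphere)
  have projE: "continuous_map (subtopology E V) euclideanreal (\<lambda>x. x i)" for V i
    using continuous_map_Euclidean_iff[of "subtopology E V" "Suc n" id] by (simp add: E_def)
  have sD: "s x \<in> - D" if "x \<in> topspace (nsphere n)" for x
  proof
    assume "s x \<in> D"
    then have "\<bar>R * x i\<bar> \<le> r" if "i \<le> n" for i
      using that supd_coord[of i "Suc n" "s x" ?o] by (auto simp: D_def s_def simp del: supd.simps)
    then have le: "(R * x i)\<^sup>2 \<le> r\<^sup>2" if "i \<le> n" for i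
      using that by (metis abs_ge_zero power2_abs power_mono)
    have "R\<^sup>2 = R\<^sup>2 * (\<Sum>i\<le>n. (x i)\<^sup>2)" using that by (simp add: nsphere)
    also have "\<dots> = (\<Sum>i\<le>n. (R * x i)\<^sup>2)" by (simp add: sum_distrib_left power_mult_distrib)
    also have "\<dots> \<le> (\<Sum>i\<le>n. r\<^sup>2)" by (intro sum_mono le) auto
    also have "\<dots> \<le> (r * real (Suc n))\<^sup>2"
      using r by (simp add: power_mult_distrib power2_eq_square mult_mono algebra_simps)
    finally have "R \<le> r * real (Suc n)" using r R by (simp add: power2_le_iff_abs_le)
    then show False by (simp add: R_def algebra_simps)
  qed
  have sE: "continuous_map (nsphere n) E s"
    unfolding E_def continuous_map_Euclidean_iff s_def
    by (intro conjI allI continuous_intros continuous_map_nsphere_projection)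
      (auto simp: nsphere mem_Esp)
  have s1: "continuous_map (nsphere n) ?SD s" using sE sD by (auto simp: continuous_map_in_subtopology)
  have "s x \<noteq> ?o" if "x \<in> topspace (nsphere n)" for x using sD[OF that] oD by (metis ComplD)
  then have s2: "continuous_map (nsphere n) ?S s" using sE by (simp add: continuous_map_in_subtopology)
  have nmc: "continuous_map ?S euclideanreal nm"
    unfolding nm_def by (intro continuous_intros projE) auto
  have nmpos: "nm x \<noteq> 0" if "x \<in> topspace ?S" for x using nm0[of x] that by (simp add: E_def)
  have \<rho>c: "continuous_map ?S (nsphere n) \<rho>"
    unfolding nsphere continuous_map_in_subtopology continuous_map_componentwise_UNIV
  proof (intro conjI allI)
    show "continuous_map ?S euclideanreal (\<lambda>x. \<rho> x k)" for k
      unfolding \<rho>_def using nmpos by (intro continuous_intros projE nmc) auto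
    have "(\<Sum>i\<le>n. (\<rho> x i)\<^sup>2) = 1" if "x \<in> topspace ?S" for x
    proof -
      have "(\<Sum>i\<le>n. (\<rho> x i)\<^sup>2) = (\<Sum>i\<le>n. (x i)\<^sup>2) / (nm x)\<^sup>2"
        by (simp add: \<rho>_def power_divide sum_divide_distrib)
      also have "(\<Sum>i\<le>n. (x i)\<^sup>2) = (nm x)\<^sup>2" by (simp add: nm_def sum_nonneg)
      finally show ?thesis using nmpos[OF that] by simp
    qed
    then show "\<rho> \<in> topspace ?S \<rightarrow> {x. (\<Sum>i\<le>n. (x i)\<^sup>2) = 1 \<and> (\<forall>i>n. x i = 0)}"
      by (auto simp: \<rho>_def E_def mem_Esp)
  qed
  have i: "continuous_map ?SD ?S id" using oD by (auto simp: continuous_map_in_subtopology)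
  have h1: "homotopic_with (\<lambda>_. True) ?S ?S (s \<circ> \<rho>) id"
    unfolding E_def
  proof (rule homotopic_with_line)
    show "continuous_map (subtopology (Euclidean_space (Suc n)) (- {?o})) (Euclidean_space (Suc n)) (s \<circ> \<rho>)"
      using continuous_map_compose[OF \<rho>c sE] by (simp add: E_def)
    fix x and t :: real assume x: "x \<in> topspace (subtopology (Euclidean_space (Suc n)) (- {?o}))" and t: "0 \<le> t" "t \<le> 1"
    then have nx: "nm x > 0" using nm0 by simp
    \<comment> \<open>The segment from \<open>s (\<rho> x)\<close> to \<open>x\<close> consists of
      positive multiples of \<open>x\<close> and so misses the origin.\<close>
    have eq: "(1 - t) * (s \<circ> \<rho>) x i + t * id x i = ((1 - t) * R / nm x + t) * x i" for i
      by (simp add: s_def \<rho>_def algebra_simps)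
    have "(1 - t) * R / nm x + t > 0"
    proof (cases "t = 1")
      case False
      then have "(1 - t) * R / nm x > 0" using t R nx by simp
      then show ?thesis using t by simp
    qed simp
    moreover obtain i where "x i \<noteq> 0" using x by (auto simp: fun_eq_iff)
    ultimately have "(1 - t) * (s \<circ> \<rho>) x i + t * id x i \<noteq> 0" unfolding eq by simp
    then show "(\<lambda>i. (1 - t) * (s \<circ> \<rho>) x i + t * id x i) \<in> - {?o}" by (auto simp: fun_eq_iff)
  qed simp_all
  have h2: "homotopic_with (\<lambda>_. True) (nsphere n) (nsphere n) (\<rho> \<circ> s) id"
  proof (rule homotopic_with_equal)
    show "continuous_map (nsphere n) (nsphere n) (\<rho> \<circ> s)"
      using s2 \<rho>c by (rule continuous_map_compose)
    fix x assume x: "x \<in> topspace (nsphere n)"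
    have "nm (s x) = R"
    proof -
      have "(\<Sum>i\<le>n. (R * x i)\<^sup>2) = R\<^sup>2 * (\<Sum>i\<le>n. (x i)\<^sup>2)" by (simp add: sum_distrib_left power_mult_distrib)
      then show ?thesis using x R by (simp add: nm_def s_def nsphere)
    qed
    then show "(\<rho> \<circ> s) x = id x" using R by (simp add: \<rho>_def s_def fun_eq_iff)
  qed auto
  define q where "q = int n"
  have q: "int (Suc n) - 1 = q" "int (Suc n) = q + 1" by (simp_all add: q_def)
  let ?H = "relative_homology_group (q + 1) E" and ?r = "reduced_homology_group q"
  have pt: "s (\<lambda>i. if i = 0 then 1 else 0) \<in> topspace ?SD"
    using continuous_map_image_subset_topspace[OF s1] in_topspace_nsphere[of n] by blast
  have bD: "hom_boundary (q + 1) E (- D) \<in> iso (?H (- D)) (?r ?SD)"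
    using iso_relative_homology_of_contractible[of E "- D" "q + 1"] pt by (auto simp: E_def)
  have bS: "hom_boundary (q + 1) E (- {?o}) \<in> iso (?H (- {?o})) (?r ?S)"
  proof -
    have "s (\<lambda>i. if i = 0 then 1 else 0) \<in> topspace E \<inter> - {?o}" using pt oD by auto
    then have "topspace E \<inter> - {?o} \<noteq> {}" by blast
    then show ?thesis using iso_relative_homology_of_contractible[of E "- {?o}" "q + 1"] by (simp add: E_def)
  qed
  have rS: "?r ?S \<cong> ?r (nsphere n)"
    using homotopy_equivalence_reduced_homology_group_isomorphism[OF \<rho>c s2 h1 h2] by (rule is_isoI)
  have "?H (- {?o}) \<cong> ?r ?S" using bS by (rule is_isoI)
  also note rS
  also have "?r (nsphere n) \<cong> integer_group" unfolding q_def by (rule reduced_homology_group_nsphere)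
  finally show "relative_homology_group (int (Suc n)) E (- {?o}) \<cong> integer_group" unfolding q(2) .
  let ?j = "hom_induced (q + 1) E (- D) E (- {?o}) id"
  have "z \<in> ?j ` carrier (?H (- D))" if z: "z \<in> carrier (?H (- {?o}))" for z
  proof -
    \<comment> \<open>The boundary of \<open>z\<close> is pushed onto the large sphere by
      \<open>s \<circ> \<rho>\<close>, which is homotopic to the identity, and then lifted through
      the boundary isomorphism for \<open>D\<close>.\<close>
    define w where "w = hom_boundary (q + 1) E (- {?o}) z"
    have w: "w \<in> carrier (?r ?S)" using bS z by (auto simp: w_def iso_iff)
    define v where "v = hom_induced q (nsphere n) {} ?SD {} s (hom_induced q ?S {} (nsphere n) {} \<rho> w)"
    have v: "v \<in> carrier (?r ?SD)" using w by (simp add: v_def hom_induced_reduced)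
    then obtain \<mu> where \<mu>: "\<mu> \<in> carrier (?H (- D))" "hom_boundary (q + 1) E (- D) \<mu> = v"
      using bD by (auto simp: iso_iff image_iff) (metis imageE)
    have iv: "hom_induced q ?SD {} ?S {} id v = w"
    proof -
      have "hom_induced q ?SD {} ?S {} id v = hom_induced q (nsphere n) {} ?S {} s (hom_induced q ?S {} (nsphere n) {} \<rho> w)"
        unfolding v_def using s1 i by (subst hom_induced_compose_gen) auto
      also have "\<dots> = hom_induced q ?S {} ?S {} (s \<circ> \<rho>) w"
        using \<rho>c s2 by (subst hom_induced_compose_gen) auto
      also have "\<dots> = hom_induced q ?S {} ?S {} id w"
        using homology_homotopy_empty[OF h1] by metis
      also have "\<dots> = w"
        by (rule hom_induced_id) (use w carrier_reduced_homology_group_subset in blast)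
      finally show ?thesis .
    qed
    have "hom_boundary (q + 1) E (- {?o}) (?j \<mu>) = hom_induced q ?SD {} ?S {} id (hom_boundary (q + 1) E (- D) \<mu>)"
    proof -
      have "id \<in> - D \<rightarrow> - {?o}" using oD by auto
      from naturality_hom_induced[OF continuous_map_id[of E] this, of "q + 1"] show ?thesis
        by (simp add: o_def fun_eq_iff[where f = "\<lambda>x. hom_boundary (q + 1) E (- {?o}) (?j x)"])
    qed
    also have "\<dots> = hom_boundary (q + 1) E (- {?o}) z" using \<mu> iv w_def by simp
    finally have eq: "hom_boundary (q + 1) E (- {?o}) (?j \<mu>) = hom_boundary (q + 1) E (- {?o}) z" .
    have "?j \<mu> \<in> carrier (?H (- {?o}))" by (rule hom_induced_carrier)
    moreover have "inj_on (hom_boundary (q + 1) E (- {?o})) (carrier (?H (- {?o})))"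
      using bS by (simp add: iso_iff)
    ultimately have "?j \<mu> = z" using eq z by (meson inj_onD)
    then show ?thesis using \<mu> by blast
  qed
  moreover have "?j ` carrier (?H (- D)) \<subseteq> carrier (?H (- {?o}))"
    using hom_induced_carrier by blast
  ultimately show "hom_induced (int (Suc n)) E (- D) E (- {?o}) id ` carrier (relative_homology_group (int (Suc n)) E (- D))
      = carrier (relative_homology_group (int (Suc n)) E (- {?o}))" unfolding q(2) by blast
qed

text \<open>The preimage of 1 under an isomorphism is not a \<open>p\<close>-th power, because
  \<open>p\<close> does not divide 1.\<close>

lemma not_divisible_integer_group:
  assumes "group G" "G \<cong> integer_group" and "p \<ge> (2::nat)"
  shows "\<exists>z\<in>carrier G. \<forall>x\<in>carrier G. x [^]\<^bsub>G\<^esub> p \<noteq> z"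
proof -
  obtain \<phi> where \<phi>: "\<phi> \<in> iso G integer_group" using assms(2) by (auto simp: is_iso_def)
  then interpret \<phi>: group_hom G integer_group \<phi>
    using assms(1) by (simp add: group_hom_def group_hom_axioms_def iso_def)
  obtain z where z: "z \<in> carrier G" "\<phi> z = 1" using \<phi> by (auto simp: iso_iff) (metis UNIV_I imageE)
  have "x [^]\<^bsub>G\<^esub> p \<noteq> z" if x: "x \<in> carrier G" for x
  proof
    assume "x [^]\<^bsub>G\<^esub> p = z"
    then have "int p * \<phi> x = 1" using \<phi>.hom_nat_pow[OF x, of p] z by simp
    then have "int p dvd 1" by (metis dvd_triv_left)
    then show False using assms(3) by simp
  qed
  then show ?thesis using z by blast
qed

section \<open>Degree of invariant maps\<close>


text \<open>An action of the cyclic group of order \<open>p\<close> on an open set, given by its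
  generator alone: inverses are iterates. The identity is allowed.\<close>

locale cyclic_transformation =
  fixes m :: nat and W :: "(nat \<Rightarrow> real) set" and T :: "(nat \<Rightarrow> real) \<Rightarrow> nat \<Rightarrow> real" and p :: nat
  assumes open_W: "openin (Euclidean_space m) W"
    and cont_T: "continuous_on W T" and T_in: "T \<in> W \<rightarrow> W"
    and T_p: "\<And>x. x \<in> W \<Longrightarrow> (T ^^ p) x = x" and prime_p: "prime p"
begin

section \<open>Iterates and translates\<close>

lemma W_sub: "W \<subseteq> Esp m" using open_W by (rule openin_subset)

lemma open_W': "openin (top_of_set (Esp m)) W" using open_W Euclidean_space_eq by metis

lemma p_ge2: "2 \<le> p" using prime_p by (rule prime_ge_2_nat)

lemma iter_in: "x \<in> W \<Longrightarrow> (T ^^ i) x \<in> W"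
  using T_in by (induction i) auto

lemma iter_cont: "continuous_on W (T ^^ i)"
proof (induction i)
  case (Suc i)
  have "continuous_on W (T \<circ> (T ^^ i))"
    using Suc cont_T iter_in by (intro continuous_on_compose) (auto elim!: continuous_on_subset)
  then show ?case by simp
qed simp

lemma iter_mod: "x \<in> W \<Longrightarrow> (T ^^ i) x = (T ^^ (i mod p)) x"
proof (induction i rule: less_induct)
  case (less i)
  show ?case
  proof (cases "i < p")
    case False
    then have "(T ^^ i) x = (T ^^ (i - p + p)) x" by simp
    also have "\<dots> = (T ^^ (i - p)) x" unfolding funpow_add using less.prems T_p by simp
    also have "\<dots> = (T ^^ ((i - p) mod p)) x" using less False p_ge2 by simp
    finally show ?thesis using False by (simp add: le_mod_geq)
  qed simp
qed

text \<open>For \<open>i = 0\<close> the inverse exponent is \<open>p\<close> instead of 0, which is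
  harmless on \<open>W\<close>.\<close>

lemma iter_inverse:
  assumes "x \<in> W" "i < p" shows "(T ^^ (p - i)) ((T ^^ i) x) = x" "(T ^^ i) ((T ^^ (p - i)) x) = x"
proof -
  have "(T ^^ (p - i)) ((T ^^ i) x) = (T ^^ (p - i + i)) x" by (simp add: funpow_add)
  then show "(T ^^ (p - i)) ((T ^^ i) x) = x" using assms T_p by simp
  have "(T ^^ i) ((T ^^ (p - i)) x) = (T ^^ (i + (p - i))) x" by (simp add: funpow_add)
  then show "(T ^^ i) ((T ^^ (p - i)) x) = x" using assms T_p by simp
qed

text \<open>Turns translates into preimages under an iterate, so that their openness follows from
  continuity.\<close>

lemma iter_image_eq:
  assumes "V \<subseteq> W" "i < p" shows "(T ^^ i) ` V = {y \<in> W. (T ^^ (p - i)) y \<in> V}"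
proof (intro subset_antisym subsetI)
  fix y assume "y \<in> (T ^^ i) ` V"
  then show "y \<in> {y \<in> W. (T ^^ (p - i)) y \<in> V}" using assms iter_in iter_inverse by auto
next
  fix y assume y: "y \<in> {y \<in> W. (T ^^ (p - i)) y \<in> V}"
  then have "y = (T ^^ i) ((T ^^ (p - i)) y)" using assms iter_inverse by simp
  then show "y \<in> (T ^^ i) ` V" using y by blast
qed

lemma iter_image_open:
  assumes "openin (Euclidean_space m) V" "V \<subseteq> W" "i < p"
  shows "openin (Euclidean_space m) ((T ^^ i) ` V)"
proof -
  have "openin (top_of_set W) V" using assms by (metis Euclidean_space_eq openin_subset_trans W_sub)
  then have "openin (top_of_set W) (W \<inter> (T ^^ (p - i)) -` V)"
    using iter_cont iter_in by (intro continuous_openin_preimage[of W _ W]) auto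
  moreover have "(T ^^ i) ` V = W \<inter> (T ^^ (p - i)) -` V"
    using iter_image_eq[OF assms(2,3)] by blast
  ultimately show ?thesis using open_W' openin_trans by (metis Euclidean_space_eq)
qed

lemma iter_image_compact:
  assumes "compact V" "V \<subseteq> W" shows "compact ((T ^^ i) ` V)"
  using assms iter_cont by (metis compact_continuous_image continuous_on_subset)

text \<open>A condition on single points that is easy to check for small balls and for sets glued
  from several parts; it amounts to the \<open>p\<close> translates being pairwise disjoint and
  excludes fixed points from \<open>V\<close>.\<close>

definition disjoint_translates :: "(nat \<Rightarrow> real) set \<Rightarrow> bool" where
  "disjoint_translates V \<longleftrightarrow> V \<subseteq> W \<and> (\<forall>x\<in>V. \<forall>i. 0 < i \<and> i < p \<longrightarrow> (T ^^ i) x \<notin> V)"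

text \<open>For \<open>i < j\<close>, undoing \<open>T ^^ i\<close> turns a common point of the two
  translates into a point of \<open>V\<close> that \<open>T ^^ (j - i)\<close> carries from another
  point of \<open>V\<close>.\<close>

lemma disjoint_translatesD:
  assumes V: "disjoint_translates V" and ij: "i < p" "j < p" "i \<noteq> j"
  shows "(T ^^ i) ` V \<inter> (T ^^ j) ` V = {}"
proof -
  have *: "(T ^^ i) ` V \<inter> (T ^^ j) ` V = {}" if ij: "i < j" "j < p" for i j
  proof -
    have False if "x \<in> V" "y \<in> V" "(T ^^ i) x = (T ^^ j) y" for x y
    proof -
      have W: "x \<in> W" "y \<in> W" using V that by (auto simp: disjoint_translates_def)
      have "(T ^^ j) y = (T ^^ i) ((T ^^ (j - i)) y)"
        using ij by (metis add_diff_inverse_nat comp_apply funpow_add less_imp_le not_le)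
      then have "(T ^^ (p - i)) ((T ^^ i) x) = (T ^^ (p - i)) ((T ^^ i) ((T ^^ (j - i)) y))"
        using that by simp
      then have "x = (T ^^ (j - i)) y" using iter_inverse W iter_in ij by simp
      moreover have "(T ^^ (j - i)) y \<notin> V"
        using V that ij by (auto simp: disjoint_translates_def)
      ultimately show False using that by simp
    qed
    then show ?thesis by blast
  qed
  show ?thesis using *[of i j] *[of j i] ij by (cases "i < j") auto
qed

text \<open>Every class relative to \<open>- D\<close> goes to a \<open>p\<close>-th power at the
  origin, although these images exhaust a group isomorphic to the integers. Zeros of
  \<open>f\<close> lie within \<rho> of the origin, so \<open>\<rho> + e < r\<close> guarantees that
  a point outside \<open>D\<close> cannot be moved onto a zero by a displacement of at most
  \<open>e\<close>; the same bound keeps segments towards \<open>f x\<close> away from the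
  origin.\<close>

lemma invariant_near_id_contradiction:
  assumes m: "m > 0"
    and ball: "{x \<in> Esp m. supd m x (\<lambda>_. 0) \<le> r} \<subseteq> W"
    and disp: "\<And>i x. x \<in> W \<Longrightarrow> supd m ((T ^^ i) x) x \<le> e"
    and f: "continuous_on W f" "f \<in> W \<rightarrow> Esp m" "\<And>x. x \<in> W \<Longrightarrow> f (T x) = f x"
    and near: "\<And>x. x \<in> W \<Longrightarrow> supd m (f x) x \<le> \<rho>" and r: "\<rho> + e < r" and e: "0 \<le> e" "0 \<le> \<rho>"
    and U: "openin (Euclidean_space m) U" "disjoint_translates U"
    and zeros: "\<And>x. x \<in> W \<Longrightarrow> f x = (\<lambda>_. 0) \<Longrightarrow> x \<in> (\<Union>i<p. (T ^^ i) ` U)"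
  shows False
proof -
  let ?o = "\<lambda>_::nat. 0::real"
  define E where "E = Euclidean_space m"
  define XW where "XW = subtopology E W"
  define D where "D = {x \<in> Esp m. supd m x ?o \<le> r}"
  define Z where "Z = {x \<in> W. f x = ?o}"
  define q where "q = int m"
  let ?H = "relative_homology_group q"
  have UW: "U \<subseteq> W" using U by (simp add: disjoint_translates_def)
  define V where "V i = (T ^^ i) ` U" for i
  have V_open: "openin E (V i)" if "i < p" for i using iter_image_open[OF U(1) UW that] by (simp add: V_def E_def)
  have V_W: "V i \<subseteq> W" for i using UW iter_in by (auto simp: V_def)
  have V_disj: "V i \<inter> V j = {}" if "i < p" "j < p" "i \<noteq> j" for i j
    using disjoint_translatesD[OF U(2) that] by (simp add: V_def)
  have DW: "D \<subseteq> W" using ball by (simp add: D_def)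
  have topXW: "topspace XW = W" using W_sub by (auto simp: XW_def E_def)
  have XV: "subtopology XW (V i) = subtopology E (V i)" for i
    using V_W by (simp add: XW_def subtopology_subtopology Int_absorb1)
  have topXV: "topspace (subtopology E (V i)) = V i" for i
    using V_W W_sub by (auto simp: E_def)
  have f_iter: "f ((T ^^ i) x) = f x" if "x \<in> W" for i x
    using that f(3) iter_in by (induction i) auto
  have ZD: "supd m x ?o \<le> \<rho>" if "x \<in> Z" for x
    using near[of x] that by (auto simp: Z_def supd_commute)
  have Zeq: "Z = {x \<in> D. f x = ?o}"
  proof (intro subset_antisym subsetI)
    fix x assume x: "x \<in> Z"
    then show "x \<in> {x \<in> D. f x = ?o}" using ZD[OF x] r e W_sub by (auto simp: Z_def D_def)
  qed (use DW in \<open>auto simp: Z_def\<close>)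
  have "closed (D \<inter> f -` {?o})"
  proof (rule continuous_closed_preimage)
    show "continuous_on D f" using f(1) DW continuous_on_subset by blast
    show "closed D" unfolding D_def by (rule compact_imp_closed[OF compact_supd_ball])
  qed auto
  moreover have "D \<inter> f -` {?o} = Z" using Zeq by auto
  ultimately have Z_closed: "closed Z" by simp
  have ZE: "Z \<subseteq> Esp m" using W_sub by (auto simp: Z_def)
  have Z_V: "Z \<subseteq> (\<Union>i<p. V i)" using zeros by (auto simp: Z_def V_def)
  have clE: "closedin E A" if "closed A" "A \<subseteq> Esp m" for A
    using that by (simp add: E_def closedin_Euclidean_space_iff)
  have clW: "closedin XW A" if "closed A" "A \<subseteq> W" for A
    using that clE[of A] W_sub by (auto simp: XW_def closedin_subtopology)
  \<comment> \<open>As before, a piece is \<open>Z\<close> minus the other open translates.\<close>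
  have Zi_closed: "closedin E (Z \<inter> V i)" if i: "i < p" for i
  proof -
    have "Z \<inter> V i = Z - (\<Union>j\<in>{..<p} - {i}. V j)"
    proof (intro subset_antisym subsetI)
      fix x assume "x \<in> Z \<inter> V i"
      then show "x \<in> Z - (\<Union>j\<in>{..<p} - {i}. V j)" using V_disj[OF i] by blast
    next
      fix x assume "x \<in> Z - (\<Union>j\<in>{..<p} - {i}. V j)"
      then show "x \<in> Z \<inter> V i" using Z_V by blast
    qed
    moreover have "closedin E (Z - (\<Union>j\<in>{..<p} - {i}. V j))"
      using V_open by (intro closedin_diff clE Z_closed ZE openin_Union) auto
    ultimately show ?thesis by simp
  qed
  have oZ: "?o \<in> D" using r e by (simp add: D_def)
  have cid: "continuous_map (subtopology E A) E id" for A by simp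
  have cf: "continuous_map XW E f"
    using f(1,2) W_sub continuous_map_sub_Euclidean_iff[of W m "Esp m" m f] by (simp add: XW_def E_def)
  have cT: "continuous_map XW XW (T ^^ i)" for i
    using iter_cont iter_in W_sub continuous_map_sub_Euclidean_iff[of W m W m "T ^^ i"] by (auto simp: XW_def E_def)
  have cT': "continuous_map XW E (T ^^ i)" for i
    using cT by (auto simp: XW_def continuous_map_in_subtopology)
  have cI: "continuous_map XW E id" by (simp add: XW_def)
  \<comment> \<open>A displacement of at most \<open>d\<close> cannot bring a point from outside
    \<open>D\<close> to within \<open>c\<close> of the origin, so the straight line from
    \<open>g\<close> to the inclusion is a homotopy of pairs.\<close>
  have near_id: "hom_induced q XW (- D) E (- A) g = hom_induced q XW (- D) E (- A) id"
    if g: "continuous_map XW E g" and d: "\<And>x. x \<in> W \<Longrightarrow> supd m (g x) x \<le> d"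
      and A: "\<And>x. x \<in> A \<Longrightarrow> supd m x ?o \<le> c" and cd: "c + d < r" for g d c A
    unfolding E_def
  proof (rule hom_induced_line)
    show "continuous_map XW (Euclidean_space m) g" "continuous_map XW (Euclidean_space m) id"
      using g cI by (simp_all add: E_def)
    fix x and t :: real assume x: "x \<in> topspace XW" "x \<in> - D" and t: "0 \<le> t" "t \<le> 1"
    let ?y = "\<lambda>i. (1 - t) * g x i + t * id x i"
    show "?y \<in> - A"
    proof
      assume y: "?y \<in> A"
      have "supd m ?y x \<le> supd m (g x) x"
      proof -
        have "\<bar>?y i - x i\<bar> \<le> supd m (g x) x" if "i < m" for i
        proof -
          have "?y i - x i = (1 - t) * (g x i - x i)" by (simp add: algebra_simps)
          then have "\<bar>?y i - x i\<bar> = (1 - t) * \<bar>g x i - x i\<bar>" using t by (simp add: abs_mult)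
          also have "\<dots> \<le> 1 * \<bar>g x i - x i\<bar>" using t by (intro mult_right_mono) auto
          also have "\<dots> \<le> supd m (g x) x" using supd_coord[OF that] by simp
          finally show ?thesis .
        qed
        then show ?thesis by (simp add: supd_le_iff)
      qed
      also have "\<dots> \<le> d" using d x topXW by simp
      finally have "supd m x ?y \<le> d" by (simp add: supd_commute)
      then have "supd m x ?o \<le> c + d" using supd_triangle[of m x ?o ?y] A[OF y] by simp
      then have "x \<in> D" using cd x topXW W_sub by (auto simp: D_def)
      then show False using x by simp
    qed
  qed
  have subZ: "x \<notin> Z" if "x \<notin> D" for x using that Zeq by auto
  have key: "\<exists>x\<in>carrier (?H E (- {?o})). hom_induced q E (- D) E (- {?o}) id \<mu> = x [^]\<^bsub>?H E (- {?o})\<^esub> p"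
    if \<mu>: "\<mu> \<in> carrier (?H E (- D))" for \<mu>
  proof -
    have "hom_induced q XW (- D) E (- D) id \<in> iso (?H XW (- D)) (?H E (- D))"
      unfolding XW_def using open_W clE[of D] DW W_sub compact_imp_closed[OF compact_supd_ball[of m ?o r]]
      by (intro excision_open_nbhd) (auto simp: E_def D_def)
    then have "hom_induced q XW (- D) E (- D) id ` carrier (?H XW (- D)) = carrier (?H E (- D))"
      by (simp add: iso_iff)
    \<comment> \<open>The class is moved into \<open>W\<close> by excision, since \<open>f\<close>
      and \<open>T\<close> are defined only there.\<close>
    then obtain \<nu> where \<nu>: "\<nu> \<in> carrier (?H XW (- D))" "hom_induced q XW (- D) E (- D) id \<nu> = \<mu>"
      using \<mu> by (metis imageE)
    define \<alpha> where "\<alpha> = hom_induced q XW (- D) XW (- Z) id \<nu>"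
    have \<alpha>: "\<alpha> \<in> carrier (?H XW (- Z))" unfolding \<alpha>_def by (rule hom_induced_carrier)
    \<comment> \<open>A good class is the part of \<nu> near the \<open>i\<close>-th piece of the
      zero set; by excision there is exactly one for each \<open>i < p\<close>.\<close>
    let ?good = "\<lambda>i \<beta>. \<beta> \<in> carrier (?H (subtopology E (V i)) (- Z)) \<and>
      hom_induced q (subtopology E (V i)) (- Z) E (- (Z \<inter> V i)) id \<beta> = hom_induced q XW (- D) E (- (Z \<inter> V i)) id \<nu>"
    have iso: "hom_induced q (subtopology E (V i)) (- Z) E (- (Z \<inter> V i)) id
        \<in> iso (?H (subtopology E (V i)) (- Z)) (?H E (- (Z \<inter> V i)))" if "i < p" for i
    proof -
      have eq: "topspace (subtopology E (V i)) \<inter> - Z = topspace (subtopology E (V i)) \<inter> - (Z \<inter> V i)" by auto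
      have "hom_induced q (subtopology E (V i)) (- Z) E (- (Z \<inter> V i)) id = hom_induced q (subtopology E (V i)) (- (Z \<inter> V i)) E (- (Z \<inter> V i)) id"
        using eq hom_induced_restrict[of q "subtopology E (V i)" "- Z" E "- (Z \<inter> V i)"]
          hom_induced_restrict[of q "subtopology E (V i)" "- (Z \<inter> V i)" E "- (Z \<inter> V i)"] by metis
      moreover have "?H (subtopology E (V i)) (- Z) = ?H (subtopology E (V i)) (- (Z \<inter> V i))"
        using eq relative_homology_group_restrict by metis
      ultimately show ?thesis
        using excision_open_nbhd[OF V_open[OF that] Zi_closed[OF that], of q] by simp
    qed
    have p0: "0 < p" using p_ge2 by simp
    have "hom_induced q (subtopology E (V 0)) (- Z) E (- (Z \<inter> V 0)) id ` carrier (?H (subtopology E (V 0)) (- Z)) = carrier (?H E (- (Z \<inter> V 0)))"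
      using iso[OF p0] by (simp add: iso_iff)
    moreover have "hom_induced q XW (- D) E (- (Z \<inter> V 0)) id \<nu> \<in> carrier (?H E (- (Z \<inter> V 0)))"
      by (rule hom_induced_carrier)
    ultimately obtain \<beta>0 where \<beta>0: "?good 0 \<beta>0" by (metis (no_types, lifting) imageE)
    define x where "x = hom_induced q (subtopology E (V 0)) (- Z) E (- {?o}) f \<beta>0"
    have x: "x \<in> carrier (?H E (- {?o}))" unfolding x_def by (rule hom_induced_carrier)
    have fV: "continuous_map (subtopology E (V i)) E f" for i
      using continuous_map_from_subtopology[OF cf, of "V i"] by (simp add: XV)
    have fZ: "f x \<in> - {?o}" if "x \<in> W" "x \<notin> Z" for x using that by (auto simp: Z_def)
    have all_x: "hom_induced q (subtopology E (V i)) (- Z) E (- {?o}) f \<beta> = x"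
      if i: "i < p" and \<beta>: "?good i \<beta>" for i \<beta>
    proof -
      have V0: "V 0 = U" by (simp add: V_def)
      have TV: "continuous_map (subtopology E (V 0)) (subtopology E (V i)) (T ^^ i)"
      proof -
        have "continuous_map (subtopology XW (V 0)) E (T ^^ i)"
          using cT' by (rule continuous_map_from_subtopology)
        then have "continuous_map (subtopology E (V 0)) E (T ^^ i)" unfolding XV .
        then show ?thesis unfolding continuous_map_in_subtopology topXV V0 by (auto simp: V_def)
      qed
      have TZ: "(T ^^ i) y \<notin> Z" if "y \<in> W" "y \<notin> Z" for y
        using that f_iter iter_in by (auto simp: Z_def)
      \<comment> \<open>The candidate for piece \<open>i\<close> is the image of the class at piece
        0 under \<open>T ^^ i\<close>. It is shown to be good, and then uniqueness identifies it
        with \<beta>.\<close>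
      define \<beta>' where "\<beta>' = hom_induced q (subtopology E (V 0)) (- Z) (subtopology E (V i)) (- Z) (T ^^ i) \<beta>0"
      have \<beta>': "\<beta>' \<in> carrier (?H (subtopology E (V i)) (- Z))" unfolding \<beta>'_def by (rule hom_induced_carrier)
      have TA: "y \<in> Z \<inter> V 0" if yy: "y \<in> W" "(T ^^ i) y \<in> Z \<inter> V i" for y
      proof -
        obtain u where u: "u \<in> U" "(T ^^ i) y = (T ^^ i) u" using yy by (auto simp: V_def)
        then have "(T ^^ (p - i)) ((T ^^ i) y) = (T ^^ (p - i)) ((T ^^ i) u)" by simp
        then have "y = u" using iter_inverse(1)[OF yy(1) i] iter_inverse(1)[OF _ i, of u] u UW by auto
        then show ?thesis using u yy TZ by (auto simp: V0)
      qed
      have "hom_induced q (subtopology E (V i)) (- Z) E (- (Z \<inter> V i)) id \<beta>'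
        = hom_induced q (subtopology E (V 0)) (- Z) E (- (Z \<inter> V i)) (T ^^ i) \<beta>0"
        unfolding \<beta>'_def using TV TZ V_W[of 0] by (subst hom_induced_compose_gen) (auto simp: topXV)
      also have "\<dots> = hom_induced q XW (- (Z \<inter> V 0)) E (- (Z \<inter> V i)) (T ^^ i)
          (hom_induced q (subtopology E (V 0)) (- Z) XW (- (Z \<inter> V 0)) id \<beta>0)"
        using TA V_W[of 0] cT' by (subst hom_induced_compose_gen) (auto simp: topXV topXW XW_def continuous_map_in_subtopology)
      also have "hom_induced q (subtopology E (V 0)) (- Z) XW (- (Z \<inter> V 0)) id \<beta>0 = hom_induced q XW (- D) XW (- (Z \<inter> V 0)) id \<nu>"
      proof -
        \<comment> \<open>The equality is tested after inclusion into \<open>E\<close>, which is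
          injective by excision.\<close>
        have "hom_induced q XW (- (Z \<inter> V 0)) E (- (Z \<inter> V 0)) id \<in> iso (?H XW (- (Z \<inter> V 0))) (?H E (- (Z \<inter> V 0)))"
          unfolding XW_def using open_W Zi_closed[OF p0] V_W[of 0]
          by (intro excision_open_nbhd) (auto simp: E_def)
        then have inj: "inj_on (hom_induced q XW (- (Z \<inter> V 0)) E (- (Z \<inter> V 0)) id) (carrier (?H XW (- (Z \<inter> V 0))))"
          by (simp add: iso_iff)
        have c0: "continuous_map (subtopology E (V 0)) XW id"
          using V_W[of 0] by (auto simp: XW_def continuous_map_in_subtopology)
        have "hom_induced q XW (- (Z \<inter> V 0)) E (- (Z \<inter> V 0)) id (hom_induced q (subtopology E (V 0)) (- Z) XW (- (Z \<inter> V 0)) id \<beta>0)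
          = hom_induced q (subtopology E (V 0)) (- Z) E (- (Z \<inter> V 0)) id \<beta>0"
          using c0 cI by (subst hom_induced_compose_gen) auto
        also have "\<dots> = hom_induced q XW (- D) E (- (Z \<inter> V 0)) id \<nu>" using \<beta>0 by simp
        also have "\<dots> = hom_induced q XW (- (Z \<inter> V 0)) E (- (Z \<inter> V 0)) id (hom_induced q XW (- D) XW (- (Z \<inter> V 0)) id \<nu>)"
          using cI subZ by (subst hom_induced_compose_gen) auto
        finally show ?thesis using inj by (meson inj_onD hom_induced_carrier)
      qed
      also have "hom_induced q XW (- (Z \<inter> V 0)) E (- (Z \<inter> V i)) (T ^^ i) (hom_induced q XW (- D) XW (- (Z \<inter> V 0)) id \<nu>)
        = hom_induced q XW (- D) E (- (Z \<inter> V i)) (T ^^ i) \<nu>"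
        using TA cT' subZ by (subst hom_induced_compose_gen) (auto simp: topXW)
      \<comment> \<open>This is where the small displacement of the iterates enters:
        \<open>T ^^ i\<close> has the same effect on \<nu> as the inclusion, so no sign can
        appear.\<close>
      also have "\<dots> = hom_induced q XW (- D) E (- (Z \<inter> V i)) id \<nu>"
        using near_id[OF cT' disp[of _ i], of "Z \<inter> V i" \<rho>] ZD r by simp
      also have "\<dots> = hom_induced q (subtopology E (V i)) (- Z) E (- (Z \<inter> V i)) id \<beta>" using \<beta> by simp
      finally have eq: "hom_induced q (subtopology E (V i)) (- Z) E (- (Z \<inter> V i)) id \<beta>' =
        hom_induced q (subtopology E (V i)) (- Z) E (- (Z \<inter> V i)) id \<beta>" .
      have "inj_on (hom_induced q (subtopology E (V i)) (- Z) E (- (Z \<inter> V i)) id) (carrier (?H (subtopology E (V i)) (- Z)))"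
        using iso[OF i] unfolding iso_iff by (rule conjunct2[OF conjunct2])
      then have "\<beta>' = \<beta>" using eq \<beta>' conjunct1[OF \<beta>] by (rule inj_onD)
      then have "hom_induced q (subtopology E (V i)) (- Z) E (- {?o}) f \<beta>
        = hom_induced q (subtopology E (V i)) (- Z) E (- {?o}) f \<beta>'" by simp
      also have "\<dots> = hom_induced q (subtopology E (V 0)) (- Z) E (- {?o}) (f \<circ> (T ^^ i)) \<beta>0"
        unfolding \<beta>'_def using TV fV TZ fZ V_W[of 0] V_W[of i] by (subst hom_induced_compose_gen) (auto simp: topXV subset_iff)
      \<comment> \<open>Invariance of \<open>f\<close> makes the contribution of piece
        \<open>i\<close> equal to that of piece 0.\<close>
      also have "hom_induced q (subtopology E (V 0)) (- Z) E (- {?o}) (f \<circ> (T ^^ i)) = hom_induced q (subtopology E (V 0)) (- Z) E (- {?o}) f"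
        using f_iter V_W[of 0] by (intro hom_induced_eq) (auto simp: topXV)
      finally show ?thesis by (simp add: x_def)
    qed
    have "hom_induced q XW (- Z) E (- {?o}) f \<alpha> = x [^]\<^bsub>?H E (- {?o})\<^esub> p"
    proof (rule hom_induced_power_of_pieces[where U = V])
      show "closedin XW Z" using clW Z_closed by (auto simp: Z_def)
      show "openin XW (V i)" if "i < p" for i
        using V_open[OF that] V_W by (auto simp: XW_def openin_subtopology)
      fix i \<beta> assume i: "i < p" and \<beta>: "\<beta> \<in> carrier (?H (subtopology XW (V i)) (- Z))"
        and eq: "hom_induced q (subtopology XW (V i)) (- Z) XW (- (Z \<inter> V i)) id \<beta> = hom_induced q XW (- Z) XW (- (Z \<inter> V i)) id \<alpha>"
      have 1: "hom_induced q XW (- (Z \<inter> V i)) E (- (Z \<inter> V i)) id (hom_induced q (subtopology XW (V i)) (- Z) XW (- (Z \<inter> V i)) id \<beta>)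
        = hom_induced q (subtopology XW (V i)) (- Z) E (- (Z \<inter> V i)) id \<beta>"
        using cI by (subst hom_induced_compose_gen) auto
      have 2: "hom_induced q XW (- Z) XW (- (Z \<inter> V i)) id \<alpha> = hom_induced q XW (- D) XW (- (Z \<inter> V i)) id \<nu>"
        unfolding \<alpha>_def using subZ by (subst hom_induced_compose_gen) auto
      have 3: "hom_induced q XW (- (Z \<inter> V i)) E (- (Z \<inter> V i)) id (hom_induced q XW (- D) XW (- (Z \<inter> V i)) id \<nu>) = hom_induced q XW (- D) E (- (Z \<inter> V i)) id \<nu>"
        using subZ cI by (subst hom_induced_compose_gen) auto
      have "?good i \<beta>" using \<beta> 1 eq 2 3 unfolding XV by simp
      then show "hom_induced q (subtopology XW (V i)) (- Z) E (- {?o}) f \<beta> = x"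
        using all_x[OF i] unfolding XV by simp
    qed (use V_disj Z_V \<alpha> cf x fZ in \<open>auto simp: topXW\<close>)
    moreover have "hom_induced q XW (- Z) E (- {?o}) f \<alpha> = hom_induced q E (- D) E (- {?o}) id \<mu>"
    proof -
      have "hom_induced q XW (- Z) E (- {?o}) f \<alpha> = hom_induced q XW (- D) E (- {?o}) f \<nu>"
        unfolding \<alpha>_def using subZ cf fZ by (subst hom_induced_compose_gen) (auto simp: topXW)
      also have "\<dots> = hom_induced q XW (- D) E (- {?o}) id \<nu>"
        using near_id[OF cf near, of "{?o}" 0] r e by simp
      also have "\<dots> = hom_induced q E (- D) E (- {?o}) id \<mu>"
        unfolding \<nu>(2)[symmetric] using oZ cI by (subst hom_induced_compose_gen) auto
      finally show ?thesis .
    qed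
    ultimately show ?thesis using x by auto
  qed
  obtain n where n: "m = Suc n" using m by (metis not0_implies_Suc not_less0)
  have r0: "0 \<le> r" using oZ by (simp add: D_def)
  let ?D = "{x. supd (Suc n) x ?o \<le> r}"
  have H: "?H E (- {?o}) \<cong> integer_group"
    using homology_Euclidean_punctured(1)[of r n] r0 by (simp add: E_def q_def n del: of_nat_Suc)
  have surj: "hom_induced q E (- ?D) E (- {?o}) id ` carrier (?H E (- ?D)) = carrier (?H E (- {?o}))"
    using homology_Euclidean_punctured(2)[of r n] r0 by (simp add: E_def q_def n del: of_nat_Suc)
  have eqD: "topspace E \<inter> - ?D = topspace E \<inter> - D" by (auto simp: E_def D_def n)
  have "?H E (- ?D) = ?H E (- D)" using eqD relative_homology_group_restrict by metis
  moreover have "hom_induced q E (- ?D) E (- {?o}) id = hom_induced q E (- D) E (- {?o}) id"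
    using eqD hom_induced_restrict[of q E "- ?D" E "- {?o}"] hom_induced_restrict[of q E "- D" E "- {?o}"] by metis
  ultimately have surj': "hom_induced q E (- D) E (- {?o}) id ` carrier (?H E (- D)) = carrier (?H E (- {?o}))"
    using surj by simp
  obtain z where z: "z \<in> carrier (?H E (- {?o}))" "\<And>x. x \<in> carrier (?H E (- {?o})) \<Longrightarrow> x [^]\<^bsub>?H E (- {?o})\<^esub> p \<noteq> z"
    using not_divisible_integer_group[OF group_relative_homology_group H p_ge2] by blast
  have "z \<in> hom_induced q E (- D) E (- {?o}) id ` carrier (?H E (- D))" unfolding surj' by (rule z(1))
  then obtain \<mu> where "\<mu> \<in> carrier (?H E (- D))" "hom_induced q E (- D) E (- {?o}) id \<mu> = z"
    by (elim imageE) simp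
  moreover from key[OF this(1)] obtain x where "x \<in> carrier (?H E (- {?o}))"
    "hom_induced q E (- D) E (- {?o}) id \<mu> = x [^]\<^bsub>?H E (- {?o})\<^esub> p" by blast
  ultimately show False using z(2)[of x] by simp
qed

end

section \<open>Approximation by maps avoiding zero on a sphere\<close>


text \<open>Pigeonhole: the sphere is covered by about \<open>K ^ (m - 1)\<close> cells whose images are so small that each
  contains at most one point of a grid with \<open>K ^ m\<close> points.\<close>

lemma lipschitz_sphere_image_misses:
  fixes g :: "(nat \<Rightarrow> real) \<Rightarrow> nat \<Rightarrow> real" and m :: nat and c :: "nat \<Rightarrow> real" and s :: real
  defines "S \<equiv> {x \<in> Esp m. supd m x c = s}"
  assumes s: "s > 0" and \<delta>: "\<delta> > 0" and L: "L \<ge> 0"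
    and lip: "\<And>x y. x \<in> S \<Longrightarrow> y \<in> S \<Longrightarrow> supd m (g x) (g y) \<le> L * supd m x y"
  shows "\<exists>v\<in>Esp m. supd m v (\<lambda>_. 0) \<le> \<delta> \<and> v \<notin> g ` S"
proof (cases "m = 0")
  case True
  then have "S = {}" using s by (auto simp: S_def)
  then show ?thesis using \<delta> True by (intro bexI[of _ "\<lambda>_. 0"]) auto
next
  case False
  \<comment> \<open>The image of a cell has size at most \<open>L * (2 * s / N)\<close>. With
    \<open>N = K * C\<close> this choice pushes it below the grid spacing
    \<open>\<delta> / K\<close>.\<close>
  obtain C :: nat where C: "2 * s * L / \<delta> < real C" using reals_Archimedean2 by blast
  have C0: "C > 0" using C s L \<delta> by (cases C) (auto simp: divide_less_0_iff mult_less_0_iff not_less)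
  \<comment> \<open>There are at most \<open>2 * m * (N + 1) ^ (m - 1)\<close> cells, and
    \<open>N + 1 \<le> K * (C + 1)\<close>. Since \<open>K\<close> exceeds
    \<open>2 * m * (C + 1) ^ (m - 1)\<close>, the \<open>K ^ m\<close> grid points outnumber
    them.\<close>
  define K where "K = 2 * m * (C + 1) ^ (m - 1) + 1"
  define N where "N = K * C"
  have K: "K > 0" by (simp add: K_def)
  have N: "N > 0" using K C0 by (simp add: N_def)
  define J where "J = (\<Pi>\<^sub>E i\<in>{..<m}. {..<K})"
  define grid where "grid j = (\<lambda>i. if i < m then \<delta> * real (j i) / real K else 0)" for j :: "nat \<Rightarrow> nat"
  have grid_small: "supd m (grid j) (\<lambda>_. 0) \<le> \<delta>" if "j \<in> J" for j
  proof -
    have "\<bar>grid j i\<bar> \<le> \<delta>" if "i < m" for i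
    proof -
      have "j i < K" using \<open>j \<in> J\<close> that by (auto simp: J_def PiE_iff)
      then have "\<delta> * real (j i) \<le> \<delta> * real K" using \<delta> by simp
      then show ?thesis using that \<delta> K by (simp add: grid_def pos_divide_le_eq)
    qed
    then show ?thesis using \<delta> by (simp add: supd_le_iff)
  qed
  have gridE: "grid j \<in> Esp m" for j by (simp add: grid_def mem_Esp)
  show ?thesis
  proof (rule ccontr)
    assume "\<not> ?thesis"
    then have "\<forall>j\<in>J. \<exists>x\<in>S. g x = grid j" using grid_small gridE by (metis imageE)
    then obtain X where X: "\<And>j. j \<in> J \<Longrightarrow> X j \<in> S" "\<And>j. j \<in> J \<Longrightarrow> g (X j) = grid j" by metis
    have "\<exists>k<m. \<bar>x k - c k\<bar> = s" if "x \<in> S" for x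
      using that s supd_attained[of m x c s] by (auto simp: S_def)
    then obtain k where k: "\<And>x. x \<in> S \<Longrightarrow> k x < m" "\<And>x. x \<in> S \<Longrightarrow> \<bar>x (k x) - c (k x)\<bar> = s" by metis
    define a where "a x i = (x i - c i + s) * real N / (2 * s)" for x i
    \<comment> \<open>A cell is a face of the cube, given by a coordinate and a side, with rounded
      positions along that face. Rounding can give \<open>N\<close> at the far end, hence
      \<open>N + 1\<close> values per coordinate.\<close>
    define cell where "cell x = (k x, x (k x) \<ge> c (k x), \<lambda>i\<in>{..<m} - {k x}. nat \<lfloor>a x i\<rfloor>)" for x
    define Cells where "Cells = (SIGMA k:{..<m}. (UNIV :: bool set) \<times> (\<Pi>\<^sub>E i\<in>{..<m} - {k}. {..N}))"
    have a_bd: "0 \<le> a x i" "a x i \<le> real N" if "x \<in> S" "i < m" for x i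
    proof -
      have "\<bar>x i - c i\<bar> \<le> s" using that supd_coord[of i m x c] by (simp add: S_def)
      then have b: "0 \<le> x i - c i + s" "x i - c i + s \<le> 2 * s" by auto
      then show "0 \<le> a x i" using s by (simp add: a_def)
      have "(x i - c i + s) * real N \<le> 2 * s * real N" using b by (intro mult_right_mono) auto
      then show "a x i \<le> real N" using s by (simp add: a_def pos_divide_le_eq mult.commute)
    qed
    have cell_in: "cell x \<in> Cells" if "x \<in> S" for x
    proof -
      have "nat \<lfloor>a x i\<rfloor> \<le> N" if "i < m" for i
        using a_bd[OF \<open>x \<in> S\<close> that] by (simp add: nat_le_iff floor_le_iff)
      then show ?thesis using k(1)[OF that] by (auto simp: cell_def Cells_def)
    qed
    have close: "supd m x y \<le> 2 * s / real N" if xy: "x \<in> S" "y \<in> S" "cell x = cell y" for x y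
    proof -
      have kk: "k x = k y" "x (k x) \<ge> c (k x) \<longleftrightarrow> y (k y) \<ge> c (k y)"
        and fl: "(\<lambda>i\<in>{..<m} - {k x}. nat \<lfloor>a x i\<rfloor>) = (\<lambda>i\<in>{..<m} - {k y}. nat \<lfloor>a y i\<rfloor>)"
        using xy by (auto simp: cell_def)
      have "\<bar>x i - y i\<bar> \<le> 2 * s / real N" if i: "i < m" for i
      proof (cases "i = k x")
        case True
        \<comment> \<open>On a common face this coordinate is constant, so it needs no rounding;
          that saves one factor \<open>N + 1\<close> in the count.\<close>
        then have "x i = y i" using kk k(2)[OF xy(1)] k(2)[OF xy(2)] by (auto simp: abs_if split: if_splits)
        then show ?thesis using s by simp
      next
        case False
        then have "nat \<lfloor>a x i\<rfloor> = nat \<lfloor>a y i\<rfloor>" using fun_cong[OF fl, of i] i kk(1) by simp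
        moreover have "0 \<le> \<lfloor>a x i\<rfloor>" "0 \<le> \<lfloor>a y i\<rfloor>" using a_bd(1)[OF xy(1) i] a_bd(1)[OF xy(2) i] by simp_all
        ultimately have "\<lfloor>a x i\<rfloor> = \<lfloor>a y i\<rfloor>" by (simp only: eq_nat_nat_iff)
        then have "\<bar>a x i - a y i\<bar> < 1" by linarith
        moreover have "a x i - a y i = (x i - y i) * (real N / (2 * s))"
          using s by (simp add: a_def field_simps)
        ultimately have "\<bar>x i - y i\<bar> * (real N / (2 * s)) < 1" using s by (simp add: abs_mult)
        then show ?thesis using s N by (simp add: field_simps)
      qed
      then show ?thesis using s by (simp add: supd_le_iff)
    qed
    have "inj_on (cell \<circ> X) J"
    proof (rule inj_onI)
      fix j j' assume j: "j \<in> J" "j' \<in> J" and eq: "(cell \<circ> X) j = (cell \<circ> X) j'"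
      show "j = j'"
      proof (rule ccontr)
        assume "j \<noteq> j'"
        then obtain i where i: "i < m" "j i \<noteq> j' i"
          using j by (auto simp: J_def) (metis PiE_ext lessThan_iff)
        have "supd m (grid j) (grid j') \<le> L * supd m (X j) (X j')" using lip X j by metis
        also have "\<dots> \<le> L * (2 * s / real N)" using close X j eq L by (intro mult_left_mono) auto
        also have "\<dots> = (2 * s * L / real C) / real K" by (simp add: N_def mult_ac)
        also have "\<dots> < \<delta> / real K"
          using C C0 \<delta> K by (intro divide_strict_right_mono) (auto simp: field_simps)
        finally have "\<bar>grid j i - grid j' i\<bar> < \<delta> / real K" using supd_coord[OF i(1), of "grid j" "grid j'"] by simp
        moreover have "grid j i - grid j' i = \<delta> / real K * (real (j i) - real (j' i))"
          using i by (simp add: grid_def algebra_simps diff_divide_distrib)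
        ultimately have "\<delta> / real K * \<bar>real (j i) - real (j' i)\<bar> < \<delta> / real K * 1"
          using \<delta> by (simp add: abs_mult)
        then have "\<bar>real (j i) - real (j' i)\<bar> < 1" using \<delta> K by (subst (asm) mult_less_cancel_left_pos) auto
        then show False using i(2) by linarith
      qed
    qed
    moreover have "(cell \<circ> X) ` J \<subseteq> Cells" using cell_in X by auto
    moreover have fin: "finite Cells" unfolding Cells_def by (intro finite_SigmaI finite_cartesian_product finite_PiE) auto
    ultimately have "card J \<le> card Cells" by (rule card_inj_on_le)
    also have "card Cells = (\<Sum>k<m. card ((UNIV :: bool set) \<times> (\<Pi>\<^sub>E i\<in>{..<m} - {k}. {..N})))"
      unfolding Cells_def by (subst card_SigmaI) (auto intro!: finite_PiE)
    also have "\<dots> = (\<Sum>k<m. 2 * (N + 1) ^ (m - 1))"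
    proof (rule sum.cong)
      fix k assume "k \<in> {..<m}"
      then have "card ({..<m} - {k}) = m - 1" by simp
      then show "card ((UNIV :: bool set) \<times> (\<Pi>\<^sub>E i\<in>{..<m} - {k}. {..N})) = 2 * (N + 1) ^ (m - 1)"
        by (simp add: card_cartesian_product card_PiE)
    qed simp
    also have "\<dots> = 2 * m * (N + 1) ^ (m - 1)" by simp
    also have "\<dots> \<le> 2 * m * (K * (C + 1)) ^ (m - 1)"
      using K by (intro mult_left_mono power_mono) (auto simp: N_def)
    also have "\<dots> = (2 * m * (C + 1) ^ (m - 1)) * K ^ (m - 1)" by (simp only: power_mult_distrib mult_ac)
    also have "\<dots> < K * K ^ (m - 1)" using K by (intro mult_strict_right_mono) (auto simp: K_def)
    also have "\<dots> = K ^ m" using False by (metis power_eq_if)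
    also have "\<dots> = card J" by (simp add: J_def card_PiE)
    finally show False by simp
  qed
qed

text \<open>Stone-Weierstrass for the ring of Lipschitz functions on \<open>B\<close>: coordinates
  separate points, and products stay Lipschitz because continuous functions are bounded on a compact
  set.\<close>

lemma lipschitz_approximation:
  fixes f :: "(nat \<Rightarrow> real) \<Rightarrow> real"
  assumes B: "compact B" "B \<subseteq> Esp m" and f: "continuous_on B f" and \<epsilon>: "\<epsilon> > 0"
  obtains h L where "continuous_on B h" "L \<ge> 0" "\<And>x y. x \<in> B \<Longrightarrow> y \<in> B \<Longrightarrow> \<bar>h x - h y\<bar> \<le> L * supd m x y"
    "\<And>x. x \<in> B \<Longrightarrow> \<bar>f x - h x\<bar> < \<epsilon>"
proof -
  define R where "R = {h. continuous_on B h \<and> (\<exists>L\<ge>0. \<forall>x\<in>B. \<forall>y\<in>B. \<bar>h x - h y\<bar> \<le> L * supd m x y)}"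
  interpret function_ring_on R B
  proof
    show "compact B" by (rule B)
    show "continuous_on B h" if "h \<in> R" for h using that by (simp add: R_def)
    show "(\<lambda>_. c) \<in> R" for c using exI[of "\<lambda>L::real. L \<ge> 0 \<and> (\<forall>x\<in>B. \<forall>y\<in>B. 0 \<le> L * supd m x y)" 0] by (simp add: R_def)
    show "\<exists>f\<in>R. f x \<noteq> f y" if xy: "x \<in> B" "y \<in> B" "x \<noteq> y" for x y
    proof -
      obtain i where i: "x i \<noteq> y i" using xy by (auto simp: fun_eq_iff)
      moreover have "x i = y i" if "i \<ge> m"
      proof -
        have "x \<in> Esp m" "y \<in> Esp m" using xy B(2) by blast+
        then show ?thesis using that by (simp add: mem_Esp)
      qed
      ultimately have "i < m" by (meson linorder_not_le)
      have "continuous_on B (\<lambda>x. x i)" by (rule continuous_on_coord[OF continuous_on_id])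
      moreover have "\<forall>x\<in>B. \<forall>y\<in>B. \<bar>x i - y i\<bar> \<le> 1 * supd m x y"
        using supd_coord[OF \<open>i < m\<close>] by simp
      ultimately have "(\<lambda>x. x i) \<in> R"
        unfolding R_def mem_Collect_eq by (intro conjI exI[of _ "1::real"] zero_le_one)
      then show ?thesis by (rule bexI[rotated]) (rule i)
    qed
    fix g h assume "g \<in> R" "h \<in> R"
    then obtain L L' where g: "continuous_on B g" "L \<ge> 0" "\<And>x y. x \<in> B \<Longrightarrow> y \<in> B \<Longrightarrow> \<bar>g x - g y\<bar> \<le> L * supd m x y"
      and h: "continuous_on B h" "L' \<ge> 0" "\<And>x y. x \<in> B \<Longrightarrow> y \<in> B \<Longrightarrow> \<bar>h x - h y\<bar> \<le> L' * supd m x y"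
      by (auto simp: R_def)
    have "\<bar>g x + h x - (g y + h y)\<bar> \<le> (L + L') * supd m x y" if "x \<in> B" "y \<in> B" for x y
    proof -
      have "\<bar>g x + h x - (g y + h y)\<bar> \<le> \<bar>g x - g y\<bar> + \<bar>h x - h y\<bar>" by linarith
      also have "\<dots> \<le> (L + L') * supd m x y" using g(3)[OF that] h(3)[OF that] by (simp add: algebra_simps)
      finally show ?thesis .
    qed
    then show "(\<lambda>x. g x + h x) \<in> R"
      unfolding R_def using g h by (auto intro!: exI[of _ "L + L'"] continuous_on_add)
    have "bounded (g ` B)" "bounded (h ` B)"
      using B g h by (auto intro!: compact_imp_bounded compact_continuous_image)
    then obtain M M' where M: "M > 0" "\<And>x. x \<in> B \<Longrightarrow> \<bar>g x\<bar> \<le> M" "M' > 0" "\<And>x. x \<in> B \<Longrightarrow> \<bar>h x\<bar> \<le> M'"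
      unfolding bounded_pos by (auto simp: real_norm_def)
    have "\<bar>g x * h x - g y * h y\<bar> \<le> (M * L' + M' * L) * supd m x y" if "x \<in> B" "y \<in> B" for x y
    proof -
      have "g x * h x - g y * h y = g x * (h x - h y) + h y * (g x - g y)" by (simp add: algebra_simps)
      then have "\<bar>g x * h x - g y * h y\<bar> \<le> \<bar>g x\<bar> * \<bar>h x - h y\<bar> + \<bar>h y\<bar> * \<bar>g x - g y\<bar>"
        by (metis abs_mult abs_triangle_ineq)
      also have "\<dots> \<le> M * (L' * supd m x y) + M' * (L * supd m x y)"
        using M that g h by (intro add_mono mult_mono) auto
      finally show ?thesis by (simp add: algebra_simps)
    qed
    then show "(\<lambda>x. g x * h x) \<in> R"
      unfolding R_def using g h M by (auto intro!: exI[of _ "M * L' + M' * L"] continuous_on_mult)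
  qed
  obtain h where "h \<in> R" "\<forall>x\<in>B. \<bar>f x - h x\<bar> < \<epsilon>" using Stone_Weierstrass_basic[OF f \<epsilon>] by blast
  then show ?thesis using that by (auto simp: R_def)
qed

text \<open>Half of \<delta> pays for a Lipschitz approximation in each coordinate. The other half
  pays for subtracting a small value \<open>v\<close> missed on the sphere, after which the missed
  value is 0.\<close>

lemma approximation_avoiding_zero_on_sphere:
  fixes f :: "(nat \<Rightarrow> real) \<Rightarrow> nat \<Rightarrow> real" and m :: nat and c :: "nat \<Rightarrow> real" and t :: real
  defines "B \<equiv> {x \<in> Esp m. supd m x c \<le> t}"
  assumes f: "continuous_on B f" "f \<in> B \<rightarrow> Esp m" and \<delta>: "\<delta> > 0" and s: "0 < s" "s \<le> t"
  obtains q where "continuous_on B q" "q \<in> B \<rightarrow> Esp m" "\<And>x. x \<in> B \<Longrightarrow> supd m (q x) (f x) \<le> \<delta>"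
    "\<And>x. x \<in> B \<Longrightarrow> supd m x c = s \<Longrightarrow> q x \<noteq> (\<lambda>_. 0)"
proof -
  have B: "compact B" "B \<subseteq> Esp m" unfolding B_def by (auto intro: compact_supd_ball)
  have "\<exists>h L. continuous_on B h \<and> L \<ge> 0 \<and> (\<forall>x\<in>B. \<forall>y\<in>B. \<bar>h x - h y\<bar> \<le> L * supd m x y) \<and>
    (\<forall>x\<in>B. \<bar>f x i - h x\<bar> < \<delta> / 2)" for i
    using lipschitz_approximation[OF B continuous_on_coord[OF f(1), of i], of "\<delta> / 2"] \<delta>
    by (metis half_gt_zero)
  then obtain h L where h: "\<And>i. continuous_on B (h i)" "\<And>i. L i \<ge> 0"
    "\<And>i x y. x \<in> B \<Longrightarrow> y \<in> B \<Longrightarrow> \<bar>h i x - h i y\<bar> \<le> L i * supd m x y"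
    "\<And>i x. x \<in> B \<Longrightarrow> \<bar>f x i - h i x\<bar> < \<delta> / 2" by metis
  define g where "g x = (\<lambda>i. if i < m then h i x else 0)" for x
  define L' where "L' = (\<Sum>i<m. L i)"
  have L': "L' \<ge> 0" using h(2) by (auto simp: L'_def intro: sum_nonneg)
  have lip: "supd m (g x) (g y) \<le> L' * supd m x y" if "x \<in> B" "y \<in> B" for x y
  proof -
    have "\<bar>g x i - g y i\<bar> \<le> L' * supd m x y" if "i < m" for i
    proof -
      have "\<bar>g x i - g y i\<bar> \<le> L i * supd m x y" using h(3)[OF \<open>x \<in> B\<close> \<open>y \<in> B\<close>] that by (simp add: g_def)
      also have "L i \<le> L'" unfolding L'_def using that h(2) by (intro member_le_sum) auto
      then have "L i * supd m x y \<le> L' * supd m x y" by (intro mult_right_mono) auto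
      finally show ?thesis .
    qed
    then show ?thesis using L' by (simp add: supd_le_iff)
  qed
  have "\<exists>v\<in>Esp m. supd m v (\<lambda>_. 0) \<le> \<delta> / 2 \<and> v \<notin> g ` {x \<in> Esp m. supd m x c = s}"
    using \<delta> s L' lip by (intro lipschitz_sphere_image_misses[where L = L']) (auto simp: B_def)
  then obtain v where v: "v \<in> Esp m" "supd m v (\<lambda>_. 0) \<le> \<delta> / 2" "\<And>x. x \<in> Esp m \<Longrightarrow> supd m x c = s \<Longrightarrow> v \<noteq> g x"
    by blast
  define q where "q x = (\<lambda>i. g x i - v i)" for x
  show ?thesis
  proof
    have "continuous_on B (\<lambda>x. g x i)" for i using h(1) by (cases "i < m") (auto simp: g_def)
    then show "continuous_on B q"
      unfolding q_def by (intro continuous_on_coordinatewise_then_product continuous_on_diff continuous_on_const)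
    show "q \<in> B \<rightarrow> Esp m" using v(1) by (auto simp: q_def g_def mem_Esp)
    show "supd m (q x) (f x) \<le> \<delta>" if "x \<in> B" for x
    proof -
      have "\<bar>q x i - f x i\<bar> \<le> \<delta>" if "i < m" for i
      proof -
        have "\<bar>f x i - h i x\<bar> < \<delta> / 2" by (rule h(4)[OF \<open>x \<in> B\<close>])
        moreover have "\<bar>v i\<bar> \<le> \<delta> / 2" using supd_coord[OF that, of v "\<lambda>_. 0"] v(2) by simp
        moreover have "q x i - f x i = - (f x i - h i x) - v i" using that by (simp add: q_def g_def)
        ultimately show ?thesis by linarith
      qed
      then show ?thesis using \<delta> by (simp add: supd_le_iff)
    qed
    show "q x \<noteq> (\<lambda>_. 0)" if "x \<in> B" "supd m x c = s" for x
    proof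
      assume "q x = (\<lambda>_. 0)"
      then have "v = g x" by (auto simp: q_def fun_eq_iff)
      then show False using v(3) that by (auto simp: B_def)
    qed
  qed
qed

section \<open>Equivariant perturbation and Newman's theorem in Euclidean space\<close>


context cyclic_transformation begin

definition invariant_map :: "((nat \<Rightarrow> real) \<Rightarrow> nat \<Rightarrow> real) \<Rightarrow> bool" where
  "invariant_map f \<longleftrightarrow> continuous_on W f \<and> f \<in> W \<rightarrow> Esp m \<and> (\<forall>x\<in>W. f (T x) = f x)"

lemma invariant_map_iter: "invariant_map f \<Longrightarrow> x \<in> W \<Longrightarrow> f ((T ^^ i) x) = f x"
  using iter_in by (induction i) (auto simp: invariant_map_def)

lemma sum_iter_shift:
  fixes u :: "(nat \<Rightarrow> real) \<Rightarrow> real"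
  assumes "x \<in> W" shows "(\<Sum>j<p. u ((T ^^ j) (T x))) = (\<Sum>j<p. u ((T ^^ j) x))"
proof -
  have "(\<Sum>j<p. u ((T ^^ j) (T x))) = (\<Sum>j<p. u ((T ^^ Suc j) x))"
    by (simp only: funpow_Suc_right comp_apply)
  \<comment> \<open>Adding \<open>u x\<close> completes the shifted sum to \<open>Suc p\<close>
    terms, whose last term is again \<open>u x\<close> by periodicity.\<close>
  also have "\<dots> + u x = (\<Sum>j<Suc p. u ((T ^^ j) x))"
    by (subst sum.lessThan_Suc_shift) simp
  also have "\<dots> = (\<Sum>j<p. u ((T ^^ j) x)) + u x" using T_p[OF assms] by simp
  finally show ?thesis by simp
qed

lemma disjoint_translates_unique:
  assumes V: "disjoint_translates V" and x: "x \<in> W"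
    and ij: "i < p" "j < p" "(T ^^ i) x \<in> V" "(T ^^ j) x \<in> V"
  shows "i = j"
proof (rule ccontr)
  have *: False if "i < j" "j < p" "(T ^^ i) x \<in> V" "(T ^^ j) x \<in> V" for i j
  proof -
    have "(T ^^ j) x = (T ^^ (j - i + i)) x" using that by simp
    also have "\<dots> = (T ^^ (j - i)) ((T ^^ i) x)" by (simp only: funpow_add comp_apply)
    finally show False using V that by (auto simp: disjoint_translates_def)
  qed
  assume "i \<noteq> j"
  then show False using *[of i j] *[of j i] ij by (cases "i < j") auto
qed

text \<open>The correction towards \<open>q\<close> is cut off inside the ball and summed over the
  orbit to restore invariance. Since the translates of the ball are disjoint, the summands never
  overlap: the error stays below \<delta>, and on the sphere \<open>f'\<close> is exactly
  \<open>q\<close>.\<close>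

lemma perturb_on_ball:
  fixes c :: "nat \<Rightarrow> real" and s :: real
  defines "B \<equiv> {x \<in> Esp m. supd m x c \<le> 2 * s}"
  assumes f: "invariant_map f" and s: "s > 0" and \<delta>: "\<delta> > 0" and B: "disjoint_translates B"
  obtains f' where "invariant_map f'" "\<And>x. x \<in> W \<Longrightarrow> supd m (f' x) (f x) \<le> \<delta>"
    "\<And>x. x \<in> W \<Longrightarrow> supd m x c = s \<Longrightarrow> f' x \<noteq> (\<lambda>_. 0)"
proof -
  have BW: "B \<subseteq> W" using B by (simp add: disjoint_translates_def)
  have fB: "continuous_on B f" "f \<in> B \<rightarrow> Esp m" using f BW continuous_on_subset by (auto simp: invariant_map_def)
  obtain q where q: "continuous_on B q" "q \<in> B \<rightarrow> Esp m" "\<And>x. x \<in> B \<Longrightarrow> supd m (q x) (f x) \<le> \<delta>"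
    "\<And>x. x \<in> B \<Longrightarrow> supd m x c = s \<Longrightarrow> q x \<noteq> (\<lambda>_. 0)"
    using approximation_avoiding_zero_on_sphere[of m c "2 * s" f \<delta> s] fB \<delta> s unfolding B_def by auto
  \<comment> \<open>Equal to 1 up to distance \<open>s\<close> from \<open>c\<close>, and decreasing
    to 0 at distance \<open>2 * s\<close>.\<close>
  define \<psi> where "\<psi> x = max 0 (min 1 (2 - supd m x c / s))" for x
  \<comment> \<open>The correction vanishes on the boundary of \<open>B\<close>, so its extension by
    0 is continuous.\<close>
  define u where "u i x = (if x \<in> B then \<psi> x * (q x i - f x i) else 0)" for i x
  define f' where "f' x = (\<lambda>i. f x i + (\<Sum>j<p. u i ((T ^^ j) x)))" for x
  define F where "F = {x \<in> W. 2 * s \<le> supd m x c}"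
  have \<psi>: "0 \<le> \<psi> x" "\<psi> x \<le> 1" for x by (auto simp: \<psi>_def)
  have closedB: "closed B" unfolding B_def by (rule compact_imp_closed[OF compact_supd_ball])
  have WBF: "B \<union> F = W" using W_sub BW by (auto simp: B_def F_def)
  have u_cont: "continuous_on W (u i)" for i
    unfolding WBF[symmetric] u_def
  proof (rule continuous_on_cases_local)
    show "closedin (top_of_set (B \<union> F)) B" using closedB by (intro closed_subset) auto
    have "closedin (top_of_set W) (W \<inter> (\<lambda>x. supd m x c) -` {2 * s..})"
      by (intro continuous_closedin_preimage continuous_on_supd continuous_on_id continuous_on_const closed_atLeast)
    moreover have "W \<inter> (\<lambda>x. supd m x c) -` {2 * s..} = F" by (auto simp: F_def)
    ultimately show "closedin (top_of_set (B \<union> F)) F" using WBF by simp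
    have "continuous_on B (\<lambda>x. supd m x c)" by (intro continuous_on_supd continuous_on_id continuous_on_const)
    then have "continuous_on B \<psi>"
      unfolding \<psi>_def using s by (intro continuous_on_max continuous_on_min continuous_on_const continuous_on_diff continuous_on_divide) auto
    then show "continuous_on B (\<lambda>x. \<psi> x * (q x i - f x i))"
      by (intro continuous_on_mult continuous_on_diff continuous_on_coord[OF q(1)] continuous_on_coord[OF fB(1)])
    show "continuous_on F (\<lambda>x. 0::real)" by (rule continuous_on_const)
    fix x assume "x \<in> B \<and> x \<notin> B \<or> x \<in> F \<and> x \<in> B"
    then have "supd m x c = 2 * s" by (auto simp: F_def B_def)
    then show "\<psi> x * (q x i - f x i) = 0" using s by (simp add: \<psi>_def)
  qed
  have u_iter: "continuous_on W (\<lambda>x. u i ((T ^^ j) x))" for i j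
    using continuous_on_compose[OF iter_cont[of j], of "u i"] continuous_on_subset[OF u_cont] iter_in
    by (auto simp: o_def image_subset_iff)
  have bound: "\<bar>u i y\<bar> \<le> \<delta>" if "i < m" for i y
  proof (cases "y \<in> B")
    case True
    have "\<bar>\<psi> y * (q y i - f y i)\<bar> \<le> 1 * \<bar>q y i - f y i\<bar>"
      using \<psi>[of y] by (simp add: abs_mult mult_left_le_one_le)
    also have "\<dots> \<le> \<delta>" using q(3)[OF True] supd_coord[OF that, of "q y" "f y"] by simp
    finally show ?thesis using True by (simp add: u_def)
  qed (use \<delta> in \<open>simp add: u_def\<close>)
  show ?thesis
  proof
    have fW: "continuous_on W f" using f by (simp add: invariant_map_def)
    have "continuous_on W (\<lambda>x. f x i + (\<Sum>j<p. u i ((T ^^ j) x)))" for i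
      by (rule continuous_on_add[OF continuous_on_coord[OF fW] continuous_on_sum]) (rule u_iter)
    then have "continuous_on W f'"
      unfolding f'_def by (rule continuous_on_coordinatewise_then_product)
    moreover have "f' x \<in> Esp m" if x: "x \<in> W" for x
    proof -
      have fx: "f x \<in> Esp m" using f x by (auto simp: invariant_map_def)
      have "u i y = 0" if "i \<ge> m" for i y
      proof (cases "y \<in> B")
        case True
        then have "q y \<in> Esp m" "f y \<in> Esp m" using q(2) fB(2) by auto
        then show ?thesis using that by (simp add: mem_Esp u_def)
      qed (simp add: u_def)
      then show ?thesis using fx by (simp add: f'_def mem_Esp)
    qed
    moreover have "f' (T x) = f' x" if "x \<in> W" for x
      using f that sum_iter_shift[OF that] by (simp add: f'_def invariant_map_def)
    ultimately show "invariant_map f'" by (auto simp: invariant_map_def)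
    show "supd m (f' x) (f x) \<le> \<delta>" if x: "x \<in> W" for x
    proof -
      have "\<bar>f' x i - f x i\<bar> \<le> \<delta>" if i: "i < m" for i
      \<comment> \<open>At most one of the first \<open>p\<close> iterates lies in \<open>B\<close>,
        so the sum is at most one correction.\<close>
      proof (cases "\<exists>j<p. (T ^^ j) x \<in> B")
        case True
        then obtain j where j: "j < p" "(T ^^ j) x \<in> B" by blast
        have "u i ((T ^^ k) x) = 0" if "k < p" "k \<noteq> j" for k
          using disjoint_translates_unique[OF B x that(1) j(1) _ j(2)] that by (auto simp: u_def)
        then have "(\<Sum>k<p. u i ((T ^^ k) x)) = (\<Sum>k\<in>{j}. u i ((T ^^ k) x))"
          using j by (intro sum.mono_neutral_right) auto
        then show ?thesis using bound[OF i] by (simp add: f'_def)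
      next
        case False
        then have "(\<Sum>k<p. u i ((T ^^ k) x)) = 0" by (intro sum.neutral) (auto simp: u_def)
        then show ?thesis using \<delta> by (simp add: f'_def)
      qed
      then show ?thesis using \<delta> by (simp add: supd_le_iff)
    qed
    show "f' x \<noteq> (\<lambda>_. 0)" if x: "x \<in> W" "supd m x c = s" for x
    proof -
      have xB: "x \<in> B" using x W_sub s by (auto simp: B_def)
      have "f' x = q x"
      proof
        fix i
        have "u i ((T ^^ k) x) = 0" if "k < p" "k \<noteq> 0" for k
          using disjoint_translates_unique[OF B x(1) that(1), of 0] xB p_ge2 that by (auto simp: u_def)
        then have "(\<Sum>k<p. u i ((T ^^ k) x)) = (\<Sum>k\<in>{0}. u i ((T ^^ k) x))"
          using p_ge2 by (intro sum.mono_neutral_right) auto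
        then show "f' x i = q x i" using xB x s by (simp add: f'_def u_def \<psi>_def)
      qed
      then show ?thesis using q(4)[OF xB x(2)] by simp
    qed
  qed
qed

text \<open>The balls are handled one at a time. Perturbing near a new ball clears its bounding
  sphere of zeros, and a bound below keeps the new map nonzero where the earlier stage had already
  excluded zeros. The radius \<open>2 * s\<close> in the hypothesis is the room for the
  cut-off.\<close>

lemma perturb_zeros:
  assumes "finite C" "invariant_map f" "\<delta> > 0"
    and "\<And>c s. (c, s) \<in> C \<Longrightarrow> s > 0 \<and> disjoint_translates {x \<in> Esp m. supd m x c \<le> 2 * s}"
  shows "\<exists>f' V. invariant_map f' \<and> (\<forall>x\<in>W. supd m (f' x) (f x) \<le> \<delta>) \<and>
    openin (Euclidean_space m) V \<and> disjoint_translates V \<and>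
    (\<forall>x\<in>W. \<forall>(c, s)\<in>C. supd m x c \<le> s \<longrightarrow> f' x = (\<lambda>_. 0) \<longrightarrow> x \<in> (\<Union>i<p. (T ^^ i) ` V))"
  using assms(1,3,4)
proof (induction C arbitrary: \<delta> rule: finite_induct)
  case empty
  then show ?case using assms(2) by (intro exI[of _ f] exI[of _ "{}"]) (auto simp: disjoint_translates_def)
next
  case (insert cs C)
  obtain c s where cs: "cs = (c, s)" by (cases cs)
  have s: "s > 0" and B2: "disjoint_translates {x \<in> Esp m. supd m x c \<le> 2 * s}"
    using insert.prems(2)[of c s] cs by auto
  let ?o = "\<lambda>_::nat. 0::real"
  obtain f1 V1 where f1: "invariant_map f1" "\<And>x. x \<in> W \<Longrightarrow> supd m (f1 x) (f x) \<le> \<delta> / 2"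
    and V1: "openin (Euclidean_space m) V1" "disjoint_translates V1"
    and z1: "\<And>x c s. x \<in> W \<Longrightarrow> (c, s) \<in> C \<Longrightarrow> supd m x c \<le> s \<Longrightarrow> f1 x = ?o \<Longrightarrow> x \<in> (\<Union>i<p. (T ^^ i) ` V1)"
  proof -
    have "\<exists>f' V. invariant_map f' \<and> (\<forall>x\<in>W. supd m (f' x) (f x) \<le> \<delta> / 2) \<and>
      openin (Euclidean_space m) V \<and> disjoint_translates V \<and>
      (\<forall>x\<in>W. \<forall>(c, s)\<in>C. supd m x c \<le> s \<longrightarrow> f' x = ?o \<longrightarrow> x \<in> (\<Union>i<p. (T ^^ i) ` V))"
      by (rule insert.IH) (use insert.prems in auto)
    then show ?thesis using that by fast
  qed
  define B where "B = {x \<in> Esp m. supd m x c \<le> s}"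
  define OB where "OB = (\<Union>i<p. (T ^^ i) ` B)"
  have BW: "B \<subseteq> W"
    using B2 s by (auto simp: disjoint_translates_def B_def)
  have cB: "compact B" unfolding B_def by (rule compact_supd_ball)
  have cOB: "compact OB" unfolding OB_def using cB BW iter_image_compact by (intro compact_UN) auto
  have OBW: "OB \<subseteq> W" using BW iter_in by (auto simp: OB_def)
  have OBE: "OB \<subseteq> Esp m" using OBW W_sub by blast
  have V1W: "V1 \<subseteq> W" using V1 by (simp add: disjoint_translates_def)
  define OV1 where "OV1 = (\<Union>i<p. (T ^^ i) ` V1)"
  have oOV1: "openin (Euclidean_space m) OV1" unfolding OV1_def using iter_image_open[OF V1(1) V1W] by auto
  \<comment> \<open>The part of the earlier balls outside the translates of \<open>V1\<close>. It is
    compact and contains no zero of \<open>f1\<close>, so \<open>f1\<close> is bounded away from 0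
    there.\<close>
  define K where "K = (\<Union>(c, s)\<in>C. {x \<in> Esp m. supd m x c \<le> s}) - OV1"
  have KW: "K \<subseteq> W"
  proof
    fix x assume "x \<in> K"
    then obtain c s where "(c, s) \<in> C" "x \<in> Esp m" "supd m x c \<le> s" by (auto simp: K_def)
    then show "x \<in> W" using insert.prems(2)[of c s] by (auto simp: disjoint_translates_def)
  qed
  have "compact K"
  proof -
    obtain G where G: "open G" "OV1 = Esp m \<inter> G" 
    proof -
      have "openin (top_of_set (Esp m)) OV1" using oOV1 Euclidean_space_eq by metis
      then show ?thesis using that by (auto simp: openin_open)
    qed
    have "compact ((\<Union>(c, s)\<in>C. {x \<in> Esp m. supd m x c \<le> s}) - G)"
      using insert.hyps compact_supd_ball by (intro compact_diff compact_UN G) auto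
    moreover have "(\<Union>(c, s)\<in>C. {x \<in> Esp m. supd m x c \<le> s}) - G = K" using G by (auto simp: K_def)
    ultimately show ?thesis by simp
  qed
  have "\<exists>\<kappa>>0. \<forall>x\<in>K. \<kappa> \<le> supd m (f1 x) ?o"
  proof (cases "K = {}")
    case False
    have "continuous_on K (\<lambda>x. supd m (f1 x) ?o)"
      using f1(1) KW continuous_on_subset by (intro continuous_on_supd continuous_on_const) (auto simp: invariant_map_def)
    then obtain x0 where x0: "x0 \<in> K" "\<forall>x\<in>K. supd m (f1 x0) ?o \<le> supd m (f1 x) ?o"
      using continuous_attains_inf[OF \<open>compact K\<close> False] by blast
    obtain c0 s0 where "(c0, s0) \<in> C" "supd m x0 c0 \<le> s0" "x0 \<notin> OV1" using x0(1) by (auto simp: K_def)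
    then have "f1 x0 \<noteq> ?o" using z1[of x0 c0 s0] x0(1) KW OV1_def by blast
    moreover have "f1 x0 \<in> Esp m" using f1(1) x0(1) KW by (auto simp: invariant_map_def)
    ultimately have "supd m (f1 x0) ?o \<noteq> 0" using supd_eq_0[of "f1 x0" m ?o] by simp
    then have "supd m (f1 x0) ?o > 0" using supd_nonneg[of m "f1 x0" ?o] by linarith
    then show ?thesis using x0 by blast
  qed (auto intro: exI[of _ 1])
  then obtain \<kappa> where \<kappa>: "\<kappa> > 0" "\<And>x. x \<in> K \<Longrightarrow> \<kappa> \<le> supd m (f1 x) ?o" by blast
  \<comment> \<open>The bound by \<kappa> prevents new zeros on \<open>K\<close>;
    \<open>\<delta> / 2\<close> is what the earlier stage has left of the error.\<close>
  have \<kappa>': "min (\<delta> / 2) (\<kappa> / 2) > 0" using \<kappa> insert.prems by simp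
  obtain f2 where f2: "invariant_map f2" "\<And>x. x \<in> W \<Longrightarrow> supd m (f2 x) (f1 x) \<le> min (\<delta> / 2) (\<kappa> / 2)"
    "\<And>x. x \<in> W \<Longrightarrow> supd m x c = s \<Longrightarrow> f2 x \<noteq> ?o"
    by (rule perturb_on_ball[OF f1(1) s \<kappa>' B2]) (rule that)
  define I where "I = {x \<in> Esp m. supd m x c < s}"
  \<comment> \<open>No zero of \<^term>\<open>f2\<close> lies on the sphere bounding \<^term>\<open>I\<close>, so cutting \<^term>\<open>V1\<close> along the translates
    of the ball loses none.\<close>
  define V2 where "V2 = I \<union> (V1 - OB)"
  have IB: "I \<subseteq> B" by (auto simp: I_def B_def)
  have OB_iter: "(T ^^ j) x \<in> OB" if xOB: "x \<in> OB" for x j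
  proof -
    obtain i b where b: "b \<in> B" "x = (T ^^ i) b" using xOB by (auto simp: OB_def)
    have "(T ^^ j) x = (T ^^ ((j + i) mod p)) b"
      using b BW iter_mod[of b "j + i"] by (auto simp: funpow_add)
    then show ?thesis using b p_ge2 by (auto simp: OB_def)
  qed
  have B_OB: "B \<subseteq> OB" using p_ge2 by (auto simp: OB_def intro!: bexI[of _ 0])
  have "openin (Euclidean_space m) V2"
  proof -
    have "openin (top_of_set (Esp m)) (Esp m \<inter> (\<lambda>x. supd m x c) -` {..<s})"
      by (intro continuous_openin_preimage_gen continuous_on_supd continuous_on_id continuous_on_const) auto
    moreover have "Esp m \<inter> (\<lambda>x. supd m x c) -` {..<s} = I" by (auto simp: I_def)
    ultimately have "openin (Euclidean_space m) I" by (metis Euclidean_space_eq)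
    moreover have "closedin (Euclidean_space m) OB"
      using cOB OBE by (simp add: closedin_Euclidean_space_iff compact_imp_closed)
    ultimately show ?thesis unfolding V2_def using V1(1) by (intro openin_Un openin_diff)
  qed
  moreover have "disjoint_translates V2"
    unfolding disjoint_translates_def
  proof (intro conjI ballI allI impI)
    show "V2 \<subseteq> W" using V1W BW IB by (auto simp: V2_def)
    fix x i assume x: "x \<in> V2" and i: "0 < i \<and> i < p"
    show "(T ^^ i) x \<notin> V2"
    proof (cases "x \<in> I")
      case True
      then have "x \<in> {x \<in> Esp m. supd m x c \<le> 2 * s}" using s by (auto simp: I_def)
      then have "(T ^^ i) x \<notin> {x \<in> Esp m. supd m x c \<le> 2 * s}" using B2 i unfolding disjoint_translates_def by blast
      then have "(T ^^ i) x \<notin> I" using s by (auto simp: I_def)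
      moreover have "(T ^^ i) x \<in> OB" using OB_iter True IB B_OB by blast
      ultimately show ?thesis by (simp add: V2_def)
    next
      case False
      then have x': "x \<in> V1" "x \<notin> OB" using x by (auto simp: V2_def)
      then have "(T ^^ i) x \<notin> V1" using V1(2) i unfolding disjoint_translates_def by blast
      moreover have "(T ^^ i) x \<notin> I"
      proof
        assume "(T ^^ i) x \<in> I"
        then have "(T ^^ (p - i)) ((T ^^ i) x) \<in> OB" using OB_iter IB B_OB by blast
        then show False using iter_inverse(1)[of x i] x' V1W i by auto
      qed
      ultimately show ?thesis by (simp add: V2_def)
    qed
  qed
  moreover have "supd m (f2 x) (f x) \<le> \<delta>" if "x \<in> W" for x
    using supd_triangle[of m "f2 x" "f x" "f1 x"] f1(2)[OF that] f2(2)[OF that] by simp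
  moreover have "x \<in> (\<Union>i<p. (T ^^ i) ` V2)"
    if x: "x \<in> W" "(c', s') \<in> insert cs C" "supd m x c' \<le> s'" "f2 x = ?o" for x c' s'
  proof (cases "x \<in> OB")
    case True
    \<comment> \<open>By invariance the zero may be moved back along its orbit into the closed ball,
      where it misses the sphere and so lies in \<open>I\<close>.\<close>
    then obtain i b where b: "i < p" "b \<in> B" "x = (T ^^ i) b" by (auto simp: OB_def)
    have bW: "b \<in> W" using b BW by blast
    then have "f2 b = ?o" using invariant_map_iter[OF f2(1) bW, of i] b x by simp
    then have "supd m b c \<noteq> s" using f2(3)[OF bW] by blast
    then have "b \<in> I" using b(2) by (simp add: I_def B_def less_le)
    then show ?thesis using b by (auto simp: V2_def)
  next
    case False
    have "(c', s') \<in> C"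
    proof (rule ccontr)
      assume "(c', s') \<notin> C"
      then have "x \<in> B" using x cs W_sub by (auto simp: B_def)
      then show False using False B_OB by blast
    qed
    then have "x \<in> OV1"
    proof -
      have "x \<notin> K"
      proof
        assume "x \<in> K"
        then have "\<kappa> \<le> supd m (f1 x) ?o" by (rule \<kappa>)
        also have "\<dots> \<le> \<kappa> / 2" using f2(2)[OF x(1)] x(4) by (simp add: supd_commute)
        finally show False using \<kappa> by simp
      qed
      then show ?thesis using x W_sub \<open>(c', s') \<in> C\<close> by (auto simp: K_def)
    qed
    then obtain i y where y: "i < p" "y \<in> V1" "x = (T ^^ i) y" by (auto simp: OV1_def)
    then have "y \<notin> OB" using False OB_iter by blast
    then show ?thesis using y by (auto simp: V2_def)
  qed
  ultimately show ?case using f2(1) by (intro exI[of _ f2] exI[of _ V2]) blast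
qed

section \<open>Free orbits and the fixed origin\<close>

text \<open>If \<open>T ^^ i\<close> fixed \<open>x\<close>, then so would every iterate whose
  exponent is a combination of \<open>i\<close> and \<open>p\<close>; these are coprime, so
  \<open>T\<close> itself would fix \<open>x\<close>.\<close>

lemma iter_neq:
  assumes x: "x \<in> W" "T x \<noteq> x" and i: "0 < i" "i < p"
  shows "(T ^^ i) x \<noteq> x"
proof
  assume eq: "(T ^^ i) x = x"
  have "coprime i p" using prime_p i by (metis coprime_commute prime_nat_not_dvd nat_dvd_not_less prime_imp_coprime)
  then obtain a b where ab: "i * a = p * b + 1"
    using i bezout_nat[of i p] by (auto simp: coprime_iff_gcd_eq_1)
  have "(T ^^ (i * k)) x = x" for k
    by (induction k) (simp_all add: funpow_add eq)
  moreover have "(T ^^ (p * k)) x = x" for k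
    using T_p x by (induction k) (simp_all add: funpow_add)
  ultimately have "x = T x" using ab by (metis Suc_eq_plus1 comp_apply funpow.simps(2))
  then show False using x by simp
qed

text \<open>By primality no iterate with \<open>0 < i < p\<close> fixes \<open>x\<close>, so by
  continuity each moves a small ball off itself; the least of the finitely many radii serves for
  all.\<close>

lemma free_ball:
  assumes x: "x \<in> W" "T x \<noteq> x"
  obtains s where "s > 0" "disjoint_translates {y \<in> Esp m. supd m y x \<le> 2 * s}"
proof -
  have xE: "x \<in> Esp m" using x W_sub by blast
  have "\<exists>d>0. \<forall>y\<in>Esp m. supd m y x \<le> d \<longrightarrow> y \<in> W \<and> d < supd m ((T ^^ i) y) x" if i: "i \<in> {0<..<p}" for i
  proof -
    have ne: "(T ^^ i) x \<noteq> x" using iter_neq[OF x] i by auto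
    have iE: "(T ^^ i) x \<in> Esp m" using iter_in[OF x(1)] W_sub by blast
    define a where "a = supd m ((T ^^ i) x) x"
    have "a \<noteq> 0" unfolding a_def using supd_eq_0[OF iE xE] ne by simp
    then have a: "a > 0" using supd_nonneg[of m "(T ^^ i) x" x] unfolding a_def by linarith
    have "(T ^^ i) \<in> W \<rightarrow> Esp m" using iter_in W_sub by blast
    from continuous_on_supdE[OF open_W' iter_cont this x(1), of "a / 2"] a obtain d
      where d: "d > 0" "\<And>y. y \<in> Esp m \<Longrightarrow> supd m y x \<le> d \<Longrightarrow> y \<in> W \<and> supd m ((T ^^ i) y) ((T ^^ i) x) < a / 2"
      by auto
    \<comment> \<open>\<open>T ^^ i\<close> takes \<open>x\<close> to distance \<open>a\<close>, and
      takes \<open>y\<close> to within \<open>a / 2\<close> of that point. So the image of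
      \<open>y\<close> keeps a distance above \<open>a / 2\<close> from \<open>x\<close>, which
      exceeds \<open>a / 3\<close>.\<close>
    have "min d (a / 3) < supd m ((T ^^ i) y) x" if "y \<in> Esp m" "supd m y x \<le> d" for y
    proof -
      have "a / 3 < supd m ((T ^^ i) y) x"
        using supd_triangle[of m "(T ^^ i) x" x "(T ^^ i) y"] conjunct2[OF d(2)[OF that]] a
          supd_commute[of m "(T ^^ i) x" "(T ^^ i) y"]
        unfolding a_def by linarith
      then show ?thesis by (simp add: min_less_iff_disj)
    qed
    then show ?thesis using d a by (intro exI[of _ "min d (a / 3)"]) auto
  qed
  then obtain d where d: "\<And>i. i \<in> {0<..<p} \<Longrightarrow> d i > 0"
    "\<And>i y. i \<in> {0<..<p} \<Longrightarrow> y \<in> Esp m \<Longrightarrow> supd m y x \<le> d i \<Longrightarrow> y \<in> W \<and> d i < supd m ((T ^^ i) y) x"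
    by metis
  define D where "D = Min (d ` {0<..<p})"
  have ne: "1 \<in> {0<..<p}" using p_ge2 by auto
  then have ne': "{0<..<p} \<noteq> {}" by blast
  have D: "D > 0" "\<And>i. i \<in> {0<..<p} \<Longrightarrow> D \<le> d i"
    using d(1) ne' by (auto simp: D_def)
  have "disjoint_translates {y \<in> Esp m. supd m y x \<le> 2 * (D / 2)}"
    unfolding disjoint_translates_def
  proof (intro conjI ballI allI impI subsetI)
    fix y assume "y \<in> {y \<in> Esp m. supd m y x \<le> 2 * (D / 2)}"
    then show "y \<in> W" using d(2)[OF ne] D(2)[OF ne] by fastforce
  next
    fix y i assume "y \<in> {y \<in> Esp m. supd m y x \<le> 2 * (D / 2)}" and i: "0 < i \<and> i < p"
    then have "d i < supd m ((T ^^ i) y) x" using d(2)[of i y] D(2)[of i] by auto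
    then show "(T ^^ i) y \<notin> {y \<in> Esp m. supd m y x \<le> 2 * (D / 2)}" using D(2)[of i] i by auto
  qed
  then show ?thesis using that[of "D / 2"] D by simp
qed

text \<open>The bound \<open>3 * e < r\<close> is a budget: the averaged map is within
  \<open>e\<close> of the identity, its perturbation costs at most another \<open>e / 2\<close>, and
  the iterates move points by at most \<open>e\<close>.\<close>

lemma fixes_zero:
  assumes ball: "{x \<in> Esp m. supd m x (\<lambda>_. 0) \<le> r} \<subseteq> W"
    and disp: "\<And>i x. x \<in> W \<Longrightarrow> supd m ((T ^^ i) x) x \<le> e" and e: "e > 0" "3 * e < r"
  shows "T (\<lambda>_. 0) = (\<lambda>_. 0)"
proof (rule ccontr)
  let ?o = "\<lambda>_::nat. 0::real"
  assume ne: "T ?o \<noteq> ?o"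
  have oW: "?o \<in> W" using ball e by auto
  have ToE: "T ?o \<in> Esp m" using T_in oW W_sub by blast
  \<comment> \<open>In dimension 0 the space is a single point, so \<open>T\<close> could not move
    the origin.\<close>
  have m: "m > 0"
  proof (rule ccontr)
    assume "\<not> m > 0"
    then show False using ToE ne by (auto simp: mem_Esp)
  qed
  define f where "f x = (\<lambda>i. (\<Sum>j<p. (T ^^ j) x i) / real p)" for x
  have p0: "real p > 0" using p_ge2 by simp
  have fE: "f x \<in> Esp m" if "x \<in> W" for x
  proof -
    have "(T ^^ j) x \<in> Esp m" for j using iter_in[OF that] W_sub by blast
    then show ?thesis by (simp add: f_def mem_Esp)
  qed
  have f_inv: "invariant_map f"
    unfolding invariant_map_def
  proof (intro conjI ballI)
    show "continuous_on W f"
      unfolding f_def using p0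
      by (intro continuous_on_coordinatewise_then_product continuous_on_divide continuous_on_sum continuous_on_const
          continuous_on_coord[OF iter_cont]) auto
    show "f \<in> W \<rightarrow> Esp m" using fE by blast
    show "f (T x) = f x" if "x \<in> W" for x
      unfolding f_def using sum_iter_shift[OF that, of "\<lambda>y. y _"] by simp
  qed
  have near: "supd m (f x) x \<le> e" if x: "x \<in> W" for x
  proof -
    have "\<bar>f x i - x i\<bar> \<le> e" if "i < m" for i
    proof -
      have "f x i - x i = (\<Sum>j<p. (T ^^ j) x i - x i) / real p"
        using p0 by (simp add: f_def sum_subtractf field_simps)
      moreover have "\<bar>\<Sum>j<p. (T ^^ j) x i - x i\<bar> \<le> (\<Sum>j<p. e)"
        using supd_coord[OF that] disp[OF x] by (intro order_trans[OF sum_abs] sum_mono) (meson order_trans)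
      ultimately show ?thesis using p0 by (simp add: abs_divide pos_divide_le_eq mult.commute)
    qed
    then show ?thesis using e by (simp add: supd_le_iff)
  qed
  have f_fix: "f x = x" if "T x = x" for x
  proof -
    have "(T ^^ j) x = x" for j by (induction j) (simp_all add: that)
    then show ?thesis using p0 by (simp add: f_def)
  qed
  \<comment> \<open>There is no fixed point within \<eta> of the origin. As \<open>f\<close> is the
    identity on fixed points, \<open>T\<close> moves every point of \<open>W\<close> where
    \<open>f\<close> has size at most \<eta>.\<close>
  obtain \<eta> where \<eta>: "\<eta> > 0" "\<eta> \<le> e" "\<And>y. y \<in> Esp m \<Longrightarrow> supd m y ?o \<le> \<eta> \<Longrightarrow> T y \<noteq> y"
  proof -
    define a where "a = supd m (T ?o) ?o"
    have "a \<noteq> 0" unfolding a_def using supd_eq_0[OF ToE, of ?o] ne by simp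
    then have a: "a > 0" using supd_nonneg[of m "T ?o" ?o] unfolding a_def by linarith
    have "T \<in> W \<rightarrow> Esp m" using T_in W_sub by blast
    from continuous_on_supdE[OF open_W' cont_T this oW, of "a / 2"] a obtain d
      where d: "d > 0" "\<And>y. y \<in> Esp m \<Longrightarrow> supd m y ?o \<le> d \<Longrightarrow> y \<in> W \<and> supd m (T y) (T ?o) < a / 2"
      by auto
    have "T y \<noteq> y" if y: "y \<in> Esp m" "supd m y ?o \<le> min d (a / 3)" for y
    proof
      assume "T y = y"
      then have "supd m (T ?o) y < a / 2" using d(2)[of y] y by (simp add: supd_commute)
      then show False using supd_triangle[of m "T ?o" ?o y] y a by (simp add: a_def)
    qed
    then show ?thesis using that[of "min e (min d (a / 3))"] d a e by auto
  qed
  \<comment> \<open>A thickened zero set, so that it also contains the zeros of every map within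
    \<eta> of \<open>f\<close>. The radius \<open>2 * e\<close> loses nothing, since
    \<open>f\<close> moves points by at most \<open>e\<close> and
    \<open>\<eta> \<le> e\<close>.\<close>
  define Z where "Z = {x \<in> {x \<in> Esp m. supd m x ?o \<le> 2 * e}. supd m (f x) ?o \<le> \<eta>}"
  have QW: "{x \<in> Esp m. supd m x ?o \<le> 2 * e} \<subseteq> W" using ball e by auto
  have ZI: "x \<in> Z" if "x \<in> W" "supd m (f x) ?o \<le> \<eta>" for x
    using that near[of x] supd_triangle[of m x ?o "f x"] \<eta> W_sub supd_commute[of m x "f x"] by (auto simp: Z_def)
  have "compact Z"
  proof -
    let ?Q = "{x \<in> Esp m. supd m x ?o \<le> 2 * e}"
    have "continuous_on ?Q (\<lambda>x. supd m (f x) ?o)"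
      using f_inv continuous_on_subset[OF _ QW] by (intro continuous_on_supd continuous_on_const) (auto simp: invariant_map_def)
    then have "closed (?Q \<inter> (\<lambda>x. supd m (f x) ?o) -` {..\<eta>})"
      by (rule continuous_closed_preimage) (auto intro: compact_imp_closed compact_supd_ball)
    then have "compact (?Q \<inter> (?Q \<inter> (\<lambda>x. supd m (f x) ?o) -` {..\<eta>}))"
      by (rule compact_Int_closed[OF compact_supd_ball])
    moreover have "?Q \<inter> (?Q \<inter> (\<lambda>x. supd m (f x) ?o) -` {..\<eta>}) = Z" by (auto simp: Z_def)
    ultimately show ?thesis by simp
  qed
  have "\<exists>s>0. disjoint_translates {y \<in> Esp m. supd m y x \<le> 2 * s}" if x: "x \<in> Z" for x
  proof -
    have xW: "x \<in> W" using x QW by (auto simp: Z_def)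
    have "T x \<noteq> x"
    proof
      assume "T x = x"
      then show False using \<eta>(3)[of x] f_fix[of x] x by (auto simp: Z_def)
    qed
    then show ?thesis using free_ball[OF xW] by blast
  qed
  then obtain s where s: "\<And>x. x \<in> Z \<Longrightarrow> s x > 0"
    "\<And>x. x \<in> Z \<Longrightarrow> disjoint_translates {y \<in> Esp m. supd m y x \<le> 2 * s x}" by metis
  define N where "N x = {y \<in> Z. supd m y x < s x}" for x
  have N_open: "openin (top_of_set Z) (N x)" for x
  proof -
    have "openin (top_of_set Z) (Z \<inter> (\<lambda>y. supd m y x) -` {..<s x})"
      by (intro continuous_openin_preimage_gen continuous_on_supd continuous_on_id continuous_on_const) auto
    moreover have "Z \<inter> (\<lambda>y. supd m y x) -` {..<s x} = N x" by (auto simp: N_def)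
    ultimately show ?thesis by simp
  qed
  have N_cover: "Z \<subseteq> \<Union>(N ` Z)" using s(1) by (auto simp: N_def)
  obtain D where "D \<subseteq> N ` Z" "finite D" "Z \<subseteq> \<Union>D"
  proof -
    have "(\<forall>c\<in>N ` Z. openin (top_of_set Z) c) \<and> Z \<subseteq> \<Union>(N ` Z)" using N_open N_cover by blast
    with \<open>compact Z\<close> have "\<exists>D\<subseteq>N ` Z. finite D \<and> Z \<subseteq> \<Union>D"
      unfolding compact_eq_openin_cover by (elim allE impE)
    then show ?thesis using that by blast
  qed
  then obtain X where X: "X \<subseteq> Z" "finite X" "Z \<subseteq> \<Union>(N ` X)" by (metis finite_subset_image)
  have \<eta>2: "\<eta> / 2 > 0" using \<eta> by simp
  obtain f' V where f': "invariant_map f'" "\<And>x. x \<in> W \<Longrightarrow> supd m (f' x) (f x) \<le> \<eta> / 2"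
    and V: "openin (Euclidean_space m) V" "disjoint_translates V"
    and z: "\<And>x c t. x \<in> W \<Longrightarrow> (c, t) \<in> (\<lambda>x. (x, s x)) ` X \<Longrightarrow> supd m x c \<le> t \<Longrightarrow> f' x = ?o \<Longrightarrow> x \<in> (\<Union>i<p. (T ^^ i) ` V)"
  proof -
    have "\<exists>f' V. invariant_map f' \<and> (\<forall>x\<in>W. supd m (f' x) (f x) \<le> \<eta> / 2) \<and>
      openin (Euclidean_space m) V \<and> disjoint_translates V \<and>
      (\<forall>x\<in>W. \<forall>(c, t)\<in>(\<lambda>x. (x, s x)) ` X. supd m x c \<le> t \<longrightarrow> f' x = ?o \<longrightarrow> x \<in> (\<Union>i<p. (T ^^ i) ` V))"
      using X s by (intro perturb_zeros f_inv \<eta>2) auto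
    then obtain f' V where *: "invariant_map f'" "\<forall>x\<in>W. supd m (f' x) (f x) \<le> \<eta> / 2"
      "openin (Euclidean_space m) V" "disjoint_translates V"
      and z: "\<forall>x\<in>W. \<forall>(c, t)\<in>(\<lambda>x. (x, s x)) ` X. supd m x c \<le> t \<longrightarrow> f' x = ?o \<longrightarrow> x \<in> (\<Union>i<p. (T ^^ i) ` V)"
      by (elim exE conjE)
    show ?thesis
    proof (rule that[OF *(1) bspec[OF *(2)] *(3,4)])
      fix x c t assume "x \<in> W" "(c, t) \<in> (\<lambda>x. (x, s x)) ` X" "supd m x c \<le> t" "f' x = ?o"
      then show "x \<in> (\<Union>i<p. (T ^^ i) ` V)" using bspec[OF bspec[OF z]] by fastforce
    qed
  qed
  show False
  proof (rule invariant_near_id_contradiction[OF m ball disp])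
    show "continuous_on W f'" "f' \<in> W \<rightarrow> Esp m" "\<And>x. x \<in> W \<Longrightarrow> f' (T x) = f' x"
      using f'(1) by (auto simp: invariant_map_def)
    show "supd m (f' x) x \<le> e + \<eta> / 2" if "x \<in> W" for x
      using supd_triangle[of m "f' x" x "f x"] near[OF that] f'(2)[OF that] by simp
    show "e + \<eta> / 2 + e < r" "0 \<le> e" "0 \<le> e + \<eta> / 2" using e \<eta> by auto
    show "openin (Euclidean_space m) V" "disjoint_translates V" by (rule V)+
    fix x assume x: "x \<in> W" "f' x = ?o"
    have "supd m (f x) ?o \<le> \<eta> / 2" using f'(2)[OF x(1)] x(2) by (simp add: supd_commute)
    then have "x \<in> Z" using ZI[OF x(1)] \<eta> by simp
    then obtain c where "c \<in> X" "supd m x c < s c" using X(3) by (auto simp: N_def)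
    then show "x \<in> (\<Union>i<p. (T ^^ i) ` V)" using z[OF x(1), of c "s c"] x(2) by auto
  qed
qed

end

section \<open>Newman's theorem for compact manifolds\<close>


lemma supd_shift: "supd m (\<lambda>i. x i - b i) y = supd m x (\<lambda>i. y i + b i)"
  by (induction m) (simp_all add: algebra_simps)

text \<open>The threshold must be independent of \<open>g\<close> and of the point near
  \<open>x\<close>. A Lebesgue number converts smallness for \<open>d\<close> into smallness in the
  chart uniformly on a compact set, and the margins are chosen so that any \<open>y\<close> in
  \<open>N\<close> can play the role of the origin.\<close>

lemma (in Metric_space) newman_in_chart:
  assumes M: "topological_manifold m mtopology" and p: "prime p" and x: "x \<in> M"
  obtains \<epsilon> N where "\<epsilon> > 0" "openin mtopology N" "x \<in> N"
    "\<And>g y. continuous_map mtopology mtopology g \<Longrightarrow> (\<And>z. z \<in> M \<Longrightarrow> (g ^^ p) z = z) \<Longrightarrow>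
      (\<And>z i. z \<in> M \<Longrightarrow> d z ((g ^^ i) z) < \<epsilon>) \<Longrightarrow> y \<in> N \<Longrightarrow> g y = y"
proof -
  let ?E = "Euclidean_space m"
  obtain U V where U: "openin mtopology U" "x \<in> U" and V: "openin ?E V"
    and hs: "subtopology mtopology U homeomorphic_space subtopology ?E V"
    using M x unfolding topological_manifold_def topspace_mtopology by blast
  then obtain h k where hk: "homeomorphic_maps (subtopology mtopology U) (subtopology ?E V) h k"
    by (auto simp: homeomorphic_space_def)
  have UM: "U \<subseteq> M" using openin_subset[OF U(1)] by simp
  have VE: "V \<subseteq> Esp m" using V by (rule openin_subset)
  have top: "topspace (subtopology mtopology U) = U" "topspace (subtopology ?E V) = V"
    using UM VE by auto
  have h: "continuous_map (subtopology mtopology U) (subtopology ?E V) h"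
    and k: "continuous_map (subtopology ?E V) (subtopology mtopology U) k"
    and kh: "\<And>z. z \<in> U \<Longrightarrow> k (h z) = z" and hkv: "\<And>v. v \<in> V \<Longrightarrow> h (k v) = v"
    using hk unfolding homeomorphic_maps_def top by auto
  have hV: "h z \<in> V" if "z \<in> U" for z using continuous_map_image_subset_topspace[OF h] that unfolding top by blast
  have kU: "k v \<in> U" if "v \<in> V" for v using continuous_map_image_subset_topspace[OF k] that unfolding top by blast
  define a where "a = h x"
  have aV: "a \<in> V" using hV[OF U(2)] by (simp add: a_def)
  have "openin (top_of_set (Esp m)) V" using V Euclidean_space_eq by metis
  then obtain r0 where r0: "r0 > 0" "\<And>v. v \<in> Esp m \<Longrightarrow> supd m v a \<le> r0 \<Longrightarrow> v \<in> V"
    using aV unfolding openin_Esp_iff by blast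
  \<comment> \<open>The factor 4 leaves room: \<open>y\<close> lies within \<open>r\<close> of the
    centre, the ball of radius \<open>r\<close> about it within \<open>2 * r\<close>, and orbits
    displaced by less than \<open>r / 5\<close> remain inside \<open>4 * r\<close>.\<close>
  define r where "r = r0 / 4"
  have r: "r > 0" "\<And>v. v \<in> Esp m \<Longrightarrow> supd m v a \<le> 4 * r \<Longrightarrow> v \<in> V" using r0 by (auto simp: r_def)
  have open_pre: "openin mtopology {z \<in> U. supd m (h z) v < t}" for v t
  proof -
    have "openin (top_of_set (Esp m)) (Esp m \<inter> (\<lambda>x. supd m x v) -` {..<t})"
      by (intro continuous_openin_preimage_gen continuous_on_supd continuous_on_id continuous_on_const) auto
    then have "openin ?E (Esp m \<inter> (\<lambda>x. supd m x v) -` {..<t})" by (metis Euclidean_space_eq)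
    then have "openin (subtopology ?E V) (V \<inter> (Esp m \<inter> (\<lambda>x. supd m x v) -` {..<t}))"
      by (rule openin_subtopology_Int2)
    from openin_continuous_map_preimage[OF h this]
    have "openin (subtopology mtopology U) {z \<in> U. h z \<in> V \<inter> (Esp m \<inter> (\<lambda>x. supd m x v) -` {..<t})}"
      unfolding top .
    moreover have "{z \<in> U. h z \<in> V \<inter> (Esp m \<inter> (\<lambda>x. supd m x v) -` {..<t})} = {z \<in> U. supd m (h z) v < t}"
      using hV VE by auto
    ultimately show ?thesis using U(1) by (metis openin_trans_full)
  qed
  define C where "C = {z \<in> U. supd m (h z) a \<le> 4 * r}"
  have "compactin mtopology C"
  proof -
    let ?Q = "{v \<in> Esp m. supd m v a \<le> 4 * r}"
    have QV: "?Q \<subseteq> V" using r by blast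
    have "compactin (top_of_set (Esp m)) ?Q"
      using compact_supd_ball by (subst compactin_subtopology) auto
    then have "compactin ?E ?Q" by (metis Euclidean_space_eq)
    then have "compactin (subtopology ?E V) ?Q" using QV by (simp add: compactin_subtopology)
    then have "compactin (subtopology mtopology U) (k ` ?Q)" using k by (rule image_compactin)
    moreover have "k ` ?Q = C"
    proof (intro subset_antisym subsetI)
      fix z assume "z \<in> k ` ?Q"
      then show "z \<in> C" using QV kU hkv by (auto simp: C_def)
    next
      fix z assume "z \<in> C"
      then have hz: "z = k (h z)" "h z \<in> ?Q" using hV VE kh by (auto simp: C_def)
      show "z \<in> k ` ?Q" using hz by (intro image_eqI[of z k "h z"])
    qed
    ultimately show ?thesis by (simp add: compactin_subtopology)
  qed
  \<comment> \<open>Two points in one member of this cover are less than \<open>r / 5\<close> apart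
    in the chart, which meets the requirement \<open>3 * (r / 5) < r\<close> for a fixed
    origin.\<close>
  moreover have "C \<subseteq> \<Union>((\<lambda>v. {z \<in> U. supd m (h z) v < r / 10}) ` UNIV)"
  proof
    fix z assume "z \<in> C"
    then have "z \<in> {z' \<in> U. supd m (h z') (h z) < r / 10}" using r(1) by (simp add: C_def)
    then show "z \<in> \<Union>((\<lambda>v. {z \<in> U. supd m (h z) v < r / 10}) ` UNIV)" by blast
  qed
  moreover have "\<And>G. G \<in> (\<lambda>v. {z \<in> U. supd m (h z) v < r / 10}) ` UNIV \<Longrightarrow> openin mtopology G"
    by (elim imageE) (simp only: open_pre)
  ultimately have "\<exists>\<epsilon>>0. \<forall>z\<in>C. \<exists>G\<in>(\<lambda>v. {z \<in> U. supd m (h z) v < r / 10}) ` UNIV. mball z \<epsilon> \<subseteq> G"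
    by (rule lebesgue_number)
  then obtain \<epsilon> where \<epsilon>: "\<epsilon> > 0"
    "\<And>z. z \<in> C \<Longrightarrow> \<exists>G\<in>(\<lambda>v. {z \<in> U. supd m (h z) v < r / 10}) ` UNIV. mball z \<epsilon> \<subseteq> G"
    by (elim exE conjE) (rule that, assumption, elim ballE, assumption, simp)
  have close: "z' \<in> U \<and> supd m (h z') (h z) < r / 5" if z: "z \<in> C" "z' \<in> M" "d z z' < \<epsilon>" for z z'
  proof -
    obtain v where v: "mball z \<epsilon> \<subseteq> {z \<in> U. supd m (h z) v < r / 10}" using \<epsilon>(2)[OF z(1)] by auto
    have "z \<in> mball z \<epsilon>" "z' \<in> mball z \<epsilon>" using z \<epsilon>(1) UM by (auto simp: C_def in_mball)
    then have "z' \<in> U" "supd m (h z) v < r / 10" "supd m (h z') v < r / 10" using subsetD[OF v] by auto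
    then show ?thesis using supd_triangle[of m "h z'" "h z" v] by (simp add: supd_commute)
  qed
  define N where "N = {z \<in> U. supd m (h z) a < r}"
  show ?thesis
  proof (rule that[OF \<epsilon>(1)])
    show "openin mtopology N" unfolding N_def by (rule open_pre)
    show "x \<in> N" using U r by (simp add: N_def a_def)
    fix g y
    assume g: "continuous_map mtopology mtopology g" and gp: "\<And>z. z \<in> M \<Longrightarrow> (g ^^ p) z = z"
      and small: "\<And>z i. z \<in> M \<Longrightarrow> d z ((g ^^ i) z) < \<epsilon>" and y: "y \<in> N"
    have gM: "(g ^^ i) z \<in> M" if "z \<in> M" for i z
      using that continuous_map_image_subset_topspace[OF g] by (induction i) auto
    have gc: "continuous_map mtopology mtopology (g ^^ i)" for i
    proof (induction i)
      case (Suc i)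
      show ?case using continuous_map_compose[OF Suc g] by (simp add: o_def)
    qed (simp add: id_def[symmetric])
    define b where "b = h y"
    have yU: "y \<in> U" and yb: "supd m b a < r" using y by (auto simp: N_def b_def)
    have bE: "b \<in> Esp m" using hV[OF yU] VE by (auto simp: b_def)
    define O4 where "O4 = {z \<in> U. supd m (h z) a < 4 * r}"
    have O4C: "O4 \<subseteq> C" by (auto simp: O4_def C_def)
    \<comment> \<open>Asking the whole orbit to stay in the chart makes \<open>S\<close> invariant,
      so \<open>g\<close> can be transported to Euclidean coordinates.\<close>
    define S where "S = {z \<in> M. \<forall>i. (g ^^ i) z \<in> O4}"
    \<comment> \<open>By periodicity only \<open>p\<close> iterates matter, and a finite
      intersection of open sets is open.\<close>
    have S_alt: "S = (\<Inter>i\<in>{..<p}. {z \<in> topspace mtopology. (g ^^ i) z \<in> O4})"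
    proof (intro subset_antisym subsetI)
      fix z assume "z \<in> S"
      then show "z \<in> (\<Inter>i\<in>{..<p}. {z \<in> topspace mtopology. (g ^^ i) z \<in> O4})" by (auto simp: S_def)
    next
      fix z assume z: "z \<in> (\<Inter>i\<in>{..<p}. {z \<in> topspace mtopology. (g ^^ i) z \<in> O4})"
      have p0: "0 < p" using p prime_gt_0_nat by blast
      then have zM: "z \<in> M" using z by auto
      have "(g ^^ i) z = (g ^^ (i mod p)) z" for i
      proof (induction i rule: less_induct)
        case (less i)
        show ?case
        proof (cases "i < p")
          case False
          then have "(g ^^ i) z = (g ^^ (i - p + p)) z" by simp
          also have "\<dots> = (g ^^ (i - p)) z" unfolding funpow_add using zM gp by simp
          also have "\<dots> = (g ^^ ((i - p) mod p)) z" using less False p0 by simp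
          finally show ?thesis using False by (simp add: le_mod_geq)
        qed simp
      qed
      moreover have "(g ^^ (i mod p)) z \<in> O4" for i using z p0 by simp
      ultimately show "z \<in> S" using zM by (simp add: S_def)
    qed
    have S_open: "openin mtopology S"
      unfolding S_alt
    proof (rule openin_INT2)
      show "{..<p} \<noteq> {}" using p prime_gt_0_nat[of p] by auto
      show "openin mtopology {z \<in> topspace mtopology. (g ^^ i) z \<in> O4}" for i
        using openin_continuous_map_preimage[OF gc] open_pre O4_def by blast
    qed simp
    have SO: "S \<subseteq> O4" by (auto simp: S_def dest: spec[of _ 0])
    have SU: "S \<subseteq> U" using SO by (auto simp: O4_def)
    have gS: "g z \<in> S" if "z \<in> S" for z
    proof -
      have "(g ^^ i) (g z) = (g ^^ Suc i) z" for i by (simp only: funpow_Suc_right comp_apply)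
      moreover have "g z \<in> M" using that gM[of z 1] by (simp add: S_def)
      ultimately show ?thesis using that by (simp add: S_def del: funpow.simps)
    qed
    have giS: "(g ^^ i) z \<in> S" if "z \<in> S" for z i using that gS by (induction i) auto
    \<comment> \<open>The chart is recentred at the image of \<^term>\<open>y\<close>.\<close>
    define sh where "sh v = (\<lambda>i. v i + b i)" for v
    define W where "W = {v \<in> Esp m. sh v \<in> h ` S}"
    define T where "T v = (\<lambda>i. h (g (k (sh v))) i - b i)" for v
    have shE: "sh v \<in> Esp m" if "v \<in> Esp m" for v using that bE by (simp add: sh_def mem_Esp)
    have WI: "sh v \<in> V \<and> k (sh v) \<in> S \<and> h (k (sh v)) = sh v" if "v \<in> W" for v
      using that hV kh SU hkv by (auto simp: W_def)
    have sh_diff: "sh (\<lambda>i. w i - b i) = w" for w by (simp add: sh_def)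
    have T_iter: "(T ^^ i) v = (\<lambda>j. h ((g ^^ i) (k (sh v))) j - b j)" if v: "v \<in> W" for v i
    proof (induction i)
      case 0
      show ?case using WI[OF v] by (simp add: sh_def)
    next
      case (Suc i)
      have "(g ^^ i) (k (sh v)) \<in> U" using giS WI[OF v] SU by blast
      then show ?case using Suc kh by (simp add: T_def sh_diff)
    qed
    have WM: "w \<in> W" if "z \<in> S" "w = (\<lambda>j. h z j - b j)" for z w
    proof -
      have "h z \<in> Esp m" using that(1) hV SU VE by blast
      then have "w \<in> Esp m" using bE that(2) by (simp add: mem_Esp)
      then show ?thesis using that by (simp add: W_def sh_diff)
    qed
    have supd_disp: "supd m (h ((g ^^ i) z)) (h z) < r / 5 \<and> (g ^^ i) z \<in> U" if "z \<in> C" for z i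
      using close[OF that gM] small that UM by (auto simp: C_def)
    interpret cyclic_transformation m W T p
    proof
      show "prime p" by (rule p)
      have hS: "openin ?E (h ` S)"
      proof -
        have "openin (subtopology mtopology U) S" using S_open SU by (simp add: openin_subset_topspace_eq openin_subtopology) (metis Int_absorb2)
        then have "openin (subtopology ?E V) {v \<in> V. k v \<in> S}"
          using openin_continuous_map_preimage[OF k] unfolding top by blast
        moreover have "{v \<in> V. k v \<in> S} = h ` S"
        proof (intro subset_antisym subsetI)
          fix v assume "v \<in> {v \<in> V. k v \<in> S}"
          then show "v \<in> h ` S" using hkv by (metis (mono_tags, lifting) imageI mem_Collect_eq)
        qed (use hV kh SU in auto)
        ultimately show ?thesis using V by (metis openin_trans_full)
      qed
      have sh_c: "continuous_map ?E ?E sh"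
        unfolding continuous_map_Euclidean_iff sh_def
      proof (intro conjI allI)
        show "continuous_map ?E euclideanreal (\<lambda>x. x i + b i)" for i
          using continuous_map_Euclidean_iff[of ?E m id] by (intro continuous_map_add) auto
      qed (use bE in \<open>auto simp: mem_Esp\<close>)
      show W_open: "openin ?E W"
        unfolding W_def by (rule openin_continuous_map_preimage[OF sh_c hS])
      have W_E: "W \<subseteq> Esp m" using W_def by blast
      have "continuous_map (subtopology ?E W) (subtopology ?E V) sh"
        using sh_c WI W_E by (auto simp: continuous_map_in_subtopology continuous_map_from_subtopology)
      from continuous_map_compose[OF this k] have "continuous_map (subtopology ?E W) (subtopology mtopology U) (k \<circ> sh)" .
      then have "continuous_map (subtopology ?E W) mtopology (k \<circ> sh)" by (simp add: continuous_map_in_subtopology)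
      from continuous_map_compose[OF this g]
      have "continuous_map (subtopology ?E W) (subtopology mtopology U) (g \<circ> (k \<circ> sh))"
        using WI gS SU W_E by (auto simp: continuous_map_in_subtopology)
      from continuous_map_compose[OF this h]
      have "continuous_map (subtopology ?E W) ?E (h \<circ> (g \<circ> (k \<circ> sh)))" by (simp add: continuous_map_in_subtopology)
      then have "continuous_map (subtopology ?E W) (subtopology ?E (Esp m)) (h \<circ> (g \<circ> (k \<circ> sh)))" by simp
      then have "continuous_on W (h \<circ> (g \<circ> (k \<circ> sh)))"
        unfolding continuous_map_sub_Euclidean_iff[OF W_E subset_refl] by simp
      then have hc: "continuous_on W (\<lambda>v. h (g (k (sh v))))" by (simp add: o_def)
      have "continuous_on W (\<lambda>v. h (g (k (sh v))) i - b i)" for i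
        by (intro continuous_on_diff continuous_on_coord[OF hc] continuous_on_const)
      then show "continuous_on W T"
        unfolding T_def by (rule continuous_on_coordinatewise_then_product)
      show "T \<in> W \<rightarrow> W"
      proof
        fix v assume "v \<in> W"
        then show "T v \<in> W" using WM[OF gS] WI by (simp add: T_def)
      qed
      show "(T ^^ p) v = v" if v: "v \<in> W" for v
      proof -
        have "k (sh v) \<in> M" using WI[OF v] by (auto simp: S_def)
        then show ?thesis using T_iter[OF v] gp WI[OF v] by (simp add: sh_def)
      qed
    qed
    have "T (\<lambda>_. 0) = (\<lambda>_. 0)"
    proof (rule fixes_zero)
      show "{v \<in> Esp m. supd m v (\<lambda>_. 0) \<le> r} \<subseteq> W"
      proof clarify
        fix v assume v: "v \<in> Esp m" "supd m v (\<lambda>_. 0) \<le> r"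
        have "supd m (sh v) b = supd m v (\<lambda>_. 0)"
          using supd_shift[of m "sh v" b "\<lambda>_. 0"] by (simp add: sh_def)
        then have va: "supd m (sh v) a < 2 * r" using v supd_triangle[of m "sh v" a b] yb by simp
        then have shV: "sh v \<in> V" using r shE[OF v(1)] by simp
        define z where "z = k (sh v)"
        have z: "z \<in> U" "h z = sh v" using kU hkv shV by (auto simp: z_def)
        have zC: "z \<in> C" using z va r by (simp add: C_def)
        have "(g ^^ i) z \<in> O4" for i
          using supd_disp[OF zC, of i] supd_triangle[of m "h ((g ^^ i) z)" a "h z"] va z r by (simp add: O4_def)
        then have "z \<in> S" using z UM by (auto simp: S_def)
        then have "sh v \<in> h ` S" using z(2) by (intro image_eqI[of "sh v" h z]) simp_all
        then show "v \<in> W" using v by (simp add: W_def)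
      qed
      show "supd m ((T ^^ i) v) v \<le> r / 5" if v: "v \<in> W" for i v
      proof -
        have "k (sh v) \<in> C" using WI[OF v] SO O4C by blast
        then have "supd m (h ((g ^^ i) (k (sh v)))) (sh v) \<le> r / 5" using supd_disp WI[OF v] by (metis less_imp_le)
        then show ?thesis unfolding T_iter[OF v] supd_shift by (simp add: sh_def)
      qed
      show "r / 5 > 0" "3 * (r / 5) < r" using r by auto
    qed
    then have "h (g (k (sh (\<lambda>_. 0)))) i - b i = 0" for i unfolding T_def by metis
    moreover have "k (sh (\<lambda>_. 0)) = y" using kh[OF yU] by (simp add: sh_def b_def)
    ultimately have "h (g y) = h y" by (auto simp: b_def)
    moreover have "g y \<in> U"
    proof -
      have "y \<in> C" using yU yb r by (simp add: C_def b_def)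
      then show ?thesis using supd_disp[of y 1] by simp
    qed
    ultimately show "g y = y" using kh yU by metis
  qed
qed

text \<open>Finitely many of the neighbourhoods \<open>N x\<close> cover the manifold, and the least
  of their thresholds works at every point.\<close>

theorem (in Metric_space) newman:
  assumes M: "topological_manifold m mtopology" "compact_space mtopology" and p: "prime p"
  obtains \<epsilon> where "\<epsilon> > 0"
    "\<And>g y. continuous_map mtopology mtopology g \<Longrightarrow> (\<And>z. z \<in> M \<Longrightarrow> (g ^^ p) z = z) \<Longrightarrow>
      (\<And>z i. z \<in> M \<Longrightarrow> d z ((g ^^ i) z) < \<epsilon>) \<Longrightarrow> y \<in> M \<Longrightarrow> g y = y"
proof -
  define good where "good \<epsilon> N \<longleftrightarrow> (\<forall>g y. continuous_map mtopology mtopology g \<longrightarrow> (\<forall>z\<in>M. (g ^^ p) z = z) \<longrightarrow>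
      (\<forall>z\<in>M. \<forall>i. d z ((g ^^ i) z) < \<epsilon>) \<longrightarrow> y \<in> N \<longrightarrow> g y = y)" for \<epsilon> N
  have "\<exists>\<epsilon> N. \<epsilon> > 0 \<and> openin mtopology N \<and> x \<in> N \<and> good \<epsilon> N" if "x \<in> M" for x
  proof (rule newman_in_chart[OF M(1) p that])
    fix \<epsilon> N assume *: "\<epsilon> > 0" "openin mtopology N" "x \<in> N" and fixed:
      "\<And>g y. continuous_map mtopology mtopology g \<Longrightarrow> (\<And>z. z \<in> M \<Longrightarrow> (g ^^ p) z = z) \<Longrightarrow>
        (\<And>z i. z \<in> M \<Longrightarrow> d z ((g ^^ i) z) < \<epsilon>) \<Longrightarrow> y \<in> N \<Longrightarrow> g y = y"
    have "good \<epsilon> N" unfolding good_def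
    proof (intro allI impI)
      fix g y assume "continuous_map mtopology mtopology g" "\<forall>z\<in>M. (g ^^ p) z = z"
        "\<forall>z\<in>M. \<forall>i. d z ((g ^^ i) z) < \<epsilon>" "y \<in> N"
      then show "g y = y" using fixed[of g y] by simp
    qed
    with * show ?thesis by blast
  qed
  then obtain \<epsilon> N where \<epsilon>N: "\<And>x. x \<in> M \<Longrightarrow> \<epsilon> x > (0::real)" "\<And>x. x \<in> M \<Longrightarrow> openin mtopology (N x)"
    "\<And>x. x \<in> M \<Longrightarrow> x \<in> N x" "\<And>x. x \<in> M \<Longrightarrow> good (\<epsilon> x) (N x)" by metis
  have "\<exists>F. finite F \<and> F \<subseteq> N ` M \<and> topspace mtopology \<subseteq> \<Union>F"
    using M(2) \<epsilon>N(2,3) unfolding compact_space_alt by (elim allE[of _ "N ` M"]) auto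
  then obtain X where X: "finite X" "X \<subseteq> M" "M \<subseteq> \<Union>(N ` X)"
    by (auto simp: ex_finite_subset_image)
  \<comment> \<open>The 1 keeps the minimum defined for an empty cover.\<close>
  define e where "e = Min (insert 1 (\<epsilon> ` X))"
  have e: "e > 0" "\<And>x. x \<in> X \<Longrightarrow> e \<le> \<epsilon> x" using X \<epsilon>N(1) by (auto simp: e_def)
  show ?thesis
  proof (rule that[OF e(1)])
    fix g y
    assume g: "continuous_map mtopology mtopology g" "\<And>z. z \<in> M \<Longrightarrow> (g ^^ p) z = z"
      "\<And>z i. z \<in> M \<Longrightarrow> d z ((g ^^ i) z) < e" and y: "y \<in> M"
    obtain x where x: "x \<in> X" "y \<in> N x" using X(3) y by blast
    have "\<forall>z\<in>M. \<forall>i. d z ((g ^^ i) z) < \<epsilon> x" using g(3) e(2)[OF x(1)] by (meson less_le_trans)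
    moreover have "good (\<epsilon> x) (N x)" using \<epsilon>N(4) x(1) X(2) by blast
    ultimately show "g y = y" using g x(2) unfolding good_def by blast
  qed
qed

section \<open>Cluster points of sequences of actions and the Pruefer group\<close>


text \<open>A compact space need not be sequentially compact, so a cluster point replaces the limit
  of a subsequence. Without one, finitely many open sets, each eventually avoided by the sequence,
  would cover the space.\<close>

lemma sequence_cluster_point:
  assumes X: "compact_space X" and s: "\<And>n::nat. s n \<in> topspace X"
  obtains l where "l \<in> topspace X" "\<And>G N. openin X G \<Longrightarrow> l \<in> G \<Longrightarrow> \<exists>n\<ge>N. s n \<in> G"
proof -
  have "\<exists>l\<in>topspace X. \<forall>G. openin X G \<longrightarrow> l \<in> G \<longrightarrow> (\<forall>N. \<exists>n\<ge>N. s n \<in> G)"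
  proof (rule ccontr)
    assume "\<not> ?thesis"
    then have "\<forall>l\<in>topspace X. \<exists>G N. openin X G \<and> l \<in> G \<and> (\<forall>n\<ge>N. s n \<notin> G)" by meson
    then obtain G N where G: "\<And>l. l \<in> topspace X \<Longrightarrow> openin X (G l)" "\<And>l. l \<in> topspace X \<Longrightarrow> l \<in> G l"
      "\<And>l n. l \<in> topspace X \<Longrightarrow> n \<ge> N l \<Longrightarrow> s n \<notin> G l" by metis
    have "\<exists>F. finite F \<and> F \<subseteq> G ` topspace X \<and> topspace X \<subseteq> \<Union>F"
      using X G(1,2) unfolding compact_space_alt by (elim allE[of _ "G ` topspace X"]) auto
    then obtain L where L: "finite L" "L \<subseteq> topspace X" "topspace X \<subseteq> \<Union>(G ` L)"
      by (auto simp: ex_finite_subset_image)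
    define n where "n = Max (insert 0 (N ` L))"
    obtain l where l: "l \<in> L" "s n \<in> G l" using s[of n] L(3) by blast
    have "N l \<le> n" using L(1) l(1) by (simp add: n_def)
    then show False using G(3)[of l n] l L(2) by blast
  qed
  then show ?thesis using that by blast
qed

context Metric_space begin

text \<open>Tychonoff's theorem on the product over all pairs \<open>(q, x)\<close>. Its open sets
  control finitely many coordinates, so approximation is available on finite sets of pairs, at
  arbitrarily late \<open>n\<close>.\<close>

lemma pointwise_cluster_point:
  assumes X: "compact_space mtopology" and s: "\<And>n q x. x \<in> M \<Longrightarrow> s n q x \<in> M"
  obtains \<Phi> where "\<And>q x. x \<in> M \<Longrightarrow> \<Phi> q x \<in> M"
    "\<And>F \<epsilon> N. finite F \<Longrightarrow> F \<subseteq> UNIV \<times> M \<Longrightarrow> \<epsilon> > 0 \<Longrightarrow>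
       \<exists>n\<ge>N::nat. \<forall>(q, x)\<in>F. d (s n q x) (\<Phi> q x) < \<epsilon>"
proof -
  define Y where "Y = product_topology (\<lambda>_. mtopology) (UNIV \<times> M :: ('b \<times> 'a) set)"
  have cY: "compact_space Y" unfolding Y_def using X by (simp add: compact_space_product_topology)
  have sY: "(\<lambda>(q, x)\<in>UNIV \<times> M. s n q x) \<in> topspace Y" for n
    using s by (auto simp: Y_def)
  obtain l where l: "l \<in> topspace Y"
    "\<And>G N. openin Y G \<Longrightarrow> l \<in> G \<Longrightarrow> \<exists>n\<ge>N. (\<lambda>(q, x)\<in>UNIV \<times> M. s n q x) \<in> G"
    by (rule sequence_cluster_point[OF cY sY]) (rule that)
  have lM: "l (q, x) \<in> M" if "x \<in> M" for q x using l(1) that by (auto simp: Y_def PiE_iff)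
  show ?thesis
  proof (rule that[of "\<lambda>q x. l (q, x)"])
    show "l (q, x) \<in> M" if "x \<in> M" for q x using lM that .
    fix F :: "('b \<times> 'a) set" and \<epsilon> :: real and N :: nat
    assume F: "finite F" "F \<subseteq> UNIV \<times> M" and \<epsilon>: "\<epsilon> > 0"
    \<comment> \<open>Intersecting with \<open>topspace Y\<close> covers the case of an empty
      \<open>F\<close>.\<close>
    define G where "G = topspace Y \<inter> (\<Inter>i\<in>F. {f \<in> topspace Y. f i \<in> mball (l i) \<epsilon>})"
    have "openin Y {f \<in> topspace Y. f i \<in> mball (l i) \<epsilon>}" if "i \<in> F" for i
    proof (rule openin_continuous_map_preimage)
      show "continuous_map Y mtopology (\<lambda>f. f i)"
        unfolding Y_def using that F(2) by (intro continuous_map_product_projection) auto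
    qed simp
    then have "openin Y G" unfolding G_def using F(1)
      by (cases "F = {}") (auto intro!: openin_Int openin_INT2)
    moreover have "l \<in> G" using l(1) F(2) \<epsilon> lM by (fastforce simp: G_def)
    ultimately obtain n where n: "n \<ge> N" "(\<lambda>(q, x)\<in>UNIV \<times> M. s n q x) \<in> G" using l(2) by blast
    have "d (s n q x) (l (q, x)) < \<epsilon>" if "(q, x) \<in> F" for q x
    proof -
      have "(\<lambda>(q, x)\<in>UNIV \<times> M. s n q x) (q, x) \<in> mball (l (q, x)) \<epsilon>"
        using n(2) that unfolding G_def by blast
      moreover have "x \<in> M" using that F(2) by blast
      ultimately show ?thesis by (simp add: commute)
    qed
    then show "\<exists>n\<ge>N. \<forall>(q, x)\<in>F. d (s n q x) (l (q, x)) < \<epsilon>" using n(1) by blast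
  qed
qed

end

section \<open>Arithmetic in Z[1/p] and its cosets modulo Z\<close>

lemma carrier_Z_inv_group: "carrier (Z_inv_group p) = {of_int a / of_nat p ^ k | (a::int) (k::nat). True}"
  by (simp add: Z_inv_group_def)

lemma mult_Z_inv_group [simp]: "x \<otimes>\<^bsub>Z_inv_group p\<^esub> y = x + y"
  and one_Z_inv_group [simp]: "\<one>\<^bsub>Z_inv_group p\<^esub> = 0"
  by (simp_all add: Z_inv_group_def)

text \<open>Each element is represented in Z/p^n, as \<open>q * p ^ n\<close>, from some stage
  on.\<close>

lemma Z_inv_group_eventually_integral:
  assumes "p > 0" "q \<in> carrier (Z_inv_group p)"
  obtains N where "\<And>n. n \<ge> N \<Longrightarrow> q * of_nat p ^ n \<in> \<int>"
proof -
  obtain a k where q: "q = of_int a / of_nat p ^ k" using assms(2) by (auto simp: carrier_Z_inv_group)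
  have "q * of_nat p ^ n \<in> \<int>" if "n \<ge> k" for n
  proof -
    have "of_nat p ^ n = (of_nat p ^ k * of_nat p ^ (n - k) :: rat)" using that by (simp flip: power_add)
    then have "q * of_nat p ^ n = of_int a * of_nat p ^ (n - k)" using assms(1) by (simp add: q)
    then show ?thesis by simp
  qed
  then show ?thesis by (rule that)
qed

lemma Z_inv_group_add:
  "p > 0 \<Longrightarrow> q \<in> carrier (Z_inv_group p) \<Longrightarrow> r \<in> carrier (Z_inv_group p) \<Longrightarrow> q + r \<in> carrier (Z_inv_group p)"
  using group.is_monoid[OF comm_group.axioms(2)[OF comm_group_Z_inv_group]] monoid.m_closed[of "Z_inv_group p" q r]
  by simp

lemma Z_inv_groupI: "of_int a / of_nat p ^ k \<in> carrier (Z_inv_group p)"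
  unfolding carrier_Z_inv_group by blast

lemma Ints_subset_Z_inv_group: "\<int> \<subseteq> carrier (Z_inv_group p)"
proof
  fix x :: rat assume "x \<in> \<int>"
  then obtain a where "x = of_int a" by (auto elim: Ints_cases)
  then show "x \<in> carrier (Z_inv_group p)" using Z_inv_groupI[of a p 0] by simp
qed

lemma Z_inv_group_mult_int:
  assumes "q \<in> carrier (Z_inv_group p)" shows "of_int c * q \<in> carrier (Z_inv_group p)"
proof -
  obtain a k where "q = of_int a / of_nat p ^ k" using assms by (auto simp: carrier_Z_inv_group)
  then have "of_int c * q = of_int (c * a) / of_nat p ^ k" by simp
  then show ?thesis using Z_inv_groupI by metis
qed

text \<open>Every nontrivial subgroup of the Pruefer group contains the class of 1/p, so
  effectiveness has to be checked on that class only. At the least \<open>j\<close> with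
  \<open>q * p ^ j\<close> integral, this integer is prime to \<open>p\<close>; Bezout's identity
  inverts it modulo \<open>p\<close> one level below.\<close>

lemma Z_inv_group_multiple_one_over_p:
  assumes p: "prime p" and q: "q \<in> carrier (Z_inv_group p)" "q \<notin> \<int>"
  obtains c :: nat and w :: int where "of_nat c * q = 1 / of_nat p + of_int w"
proof -
  have p0: "p > 0" using p by (rule prime_gt_0_nat)
  let ?P = "\<lambda>j. q * of_nat p ^ j \<in> \<int>"
  obtain N where "?P N" using Z_inv_group_eventually_integral[OF p0 q(1)] by (metis order_refl)
  define j where "j = (LEAST j. ?P j)"
  have j: "?P j" unfolding j_def using \<open>?P N\<close> by (rule LeastI)
  have "j \<noteq> 0" using j q(2) by (intro notI) simp
  then obtain i where i: "j = Suc i" by (cases j) auto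
  have ni: "\<not> ?P i" unfolding i[symmetric] using not_less_Least[of i ?P] by (simp add: j_def[symmetric] i)
  obtain b where b: "q * of_nat p ^ j = of_int b" using j by (auto elim: Ints_cases)
  have qi: "q * of_nat p ^ i = of_int b / of_nat p" using b p0 by (simp add: i field_simps)
  have "\<not> int p dvd b"
  proof
    assume "int p dvd b"
    then obtain b' where "b = int p * b'" by (rule dvdE)
    then have "q * of_nat p ^ i = of_int b'" using qi p0 by simp
    then show False using ni by simp
  qed
  then have "coprime b (int p)" using p by (metis coprime_commute prime_imp_coprime prime_nat_int_transfer)
  then obtain u v where uv: "u * b + v * int p = 1"
    using bezout_int[of b "int p"] by (auto simp: coprime_iff_gcd_eq_1)
  \<comment> \<open>Reduction modulo \<open>p\<close> makes the Bezout coefficient a natural number;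
    the change is absorbed in the integer part.\<close>
  define c where "c = nat (u mod int p)"
  have "int c = u - int p * (u div int p)" using p0 by (simp add: c_def minus_mult_div_eq_mod)
  then have "(int c + int p * (u div int p)) * b + v * int p = 1" using uv by simp
  then have w: "b * int c = 1 + int p * (- v - b * (u div int p))" by (simp add: algebra_simps)
  let ?w = "- v - b * (u div int p)"
  have "of_nat (c * p ^ i) * q = of_nat c * (q * of_nat p ^ i)" by (simp add: mult_ac)
  also have "\<dots> = of_int (b * int c) / of_nat p" by (simp add: qi mult_ac)
  also have "\<dots> = (1 + of_nat p * of_int ?w) / of_nat p" unfolding w by simp
  also have "\<dots> = 1 / of_nat p + of_int ?w" using p0 by (simp add: add_divide_distrib del: of_int_diff of_int_minus of_int_mult)
  finally show ?thesis by (rule that)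
qed

lemma pruefer_groupD:
  assumes p: "p > 0" and C: "C \<in> carrier (pruefer_group p)"
  shows "C \<noteq> {}" "C \<subseteq> carrier (Z_inv_group p)" "\<And>q r. q \<in> C \<Longrightarrow> r \<in> C \<Longrightarrow> q - r \<in> \<int>"
    "\<And>q. q \<in> C \<Longrightarrow> q \<in> \<int> \<Longrightarrow> C = \<int>"
proof -
  obtain a where a: "a \<in> carrier (Z_inv_group p)" "C = (\<lambda>h. h + a) ` \<int>"
    using C by (auto simp: pruefer_group_def carrier_FactGroup r_coset_def)
  show "C \<noteq> {}" using a by auto
  show "C \<subseteq> carrier (Z_inv_group p)"
    using a Z_inv_group_add[OF p] Ints_subset_Z_inv_group by blast
  show "q - r \<in> \<int>" if "q \<in> C" "r \<in> C" for q r using that a by auto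
  show "C = \<int>" if "q \<in> C" "q \<in> \<int>" for q
  proof -
    have "q \<in> (\<lambda>h. h + a) ` \<int>" using that(1) a(2) by simp
    then obtain h where h: "h \<in> \<int>" "q = h + a" by blast
    then have aZ: "a \<in> \<int>" using that(2) by (metis Ints_diff add_diff_cancel_left')
    show ?thesis
    proof (intro subset_antisym subsetI)
      fix x assume "x \<in> (\<int> :: rat set)"
      then have "x = (x - a) + a" "x - a \<in> \<int>" using aZ by simp_all
      then show "x \<in> C" unfolding a(2) by (metis imageI)
    qed (use a aZ in auto)
  qed
qed


section \<open>The limit action\<close>

lemma (in Metric_space) lipschitz_imp_continuous_map:
  assumes "\<And>x. x \<in> M \<Longrightarrow> g x \<in> M" "\<And>x y. x \<in> M \<Longrightarrow> y \<in> M \<Longrightarrow> d (g x) (g y) \<le> K * d x y" and K: "K > 0"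
  shows "continuous_map mtopology mtopology g"
  unfolding continuous_map_to_metric
proof (intro ballI allI impI)
  fix x and \<epsilon> :: real assume x: "x \<in> topspace mtopology" and \<epsilon>: "\<epsilon> > 0"
  have "g y \<in> mball (g x) \<epsilon>" if "y \<in> mball x (\<epsilon> / K)" for y
  proof -
    have "y \<in> M" "d x y < \<epsilon> / K" using that by auto
    then have "K * d x y < \<epsilon>" using K by (simp add: pos_less_divide_eq mult.commute)
    then show ?thesis using assms(1)[of x] assms(1)[of y] assms(2)[of x y] x \<open>y \<in> M\<close> by auto
  qed
  then show "\<exists>U. openin mtopology U \<and> x \<in> U \<and> (\<forall>y\<in>U. g y \<in> mball (g x) \<epsilon>)"
    using x \<epsilon> K by (intro exI[of _ "mball x (\<epsilon> / K)"]) auto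
qed

theorem corollary22:
  fixes M :: "'a set" and d :: "'a \<Rightarrow> 'a \<Rightarrow> real" and K :: real and p :: nat
  assumes "Metric_space M d"
    and "\<exists>m. topological_manifold m (Metric_space.mtopology M d)"
    and "compact_space (Metric_space.mtopology M d)"
    and "connected_space (Metric_space.mtopology M d)"
    and "K > 0"
    and "prime p"
    and "\<And>n::nat. \<exists>\<phi>. group_action (integer_mod_group (p ^ n)) M \<phi>
            \<and> effective_on d (integer_mod_group (p ^ n)) M \<phi>
            \<and> lipschitz_action_on K d (integer_mod_group (p ^ n)) M \<phi>"
  shows "\<exists>\<phi>. group_action (pruefer_group p) M \<phi>
            \<and> effective_on d (pruefer_group p) M \<phi>
            \<and> lipschitz_action_on K d (pruefer_group p) M \<phi>"
proof -
  interpret Metric_space M d by fact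
  note cpt = assms(3) and K = assms(5) and p = assms(6)
  have p0: "p > 0" using p by (rule prime_gt_0_nat)
  obtain \<phi> where \<phi>: "\<And>n. group_action (integer_mod_group (p ^ n)) M (\<phi> n)"
    and \<phi>_eff: "\<And>n. effective_on d (integer_mod_group (p ^ n)) M (\<phi> n)"
    and \<phi>_lip: "\<And>n. lipschitz_action_on K d (integer_mod_group (p ^ n)) M (\<phi> n)"
    using assms(7) by metis
  let ?D = "carrier (Z_inv_group p)"
  let ?P = "\<lambda>n. of_nat p ^ n :: rat"
  \<comment> \<open>This identifies the generator of Z/p^n with \<open>1 / p ^ n\<close>. The floor
    only gives a value when \<open>q * p ^ n\<close> is not integral, which for \<open>q\<close> in
    Z[1/p] happens at finitely many stages.\<close>
  define s where "s n q x = \<phi> n (\<lfloor>q * ?P n\<rfloor> mod int (p ^ n)) x" for n q x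
  have car: "k mod int (p ^ n) \<in> carrier (integer_mod_group (p ^ n))" for k n
    using p0 by (simp add: carrier_integer_mod_group)
  have s_in: "s n q x \<in> M" if "x \<in> M" for n q x
    unfolding s_def using group_action.element_image[OF \<phi> car that refl] .
  have s_lip: "d (s n q x) (s n q y) \<le> K * d x y" if "x \<in> M" "y \<in> M" for n q x y
    unfolding s_def using \<phi>_lip[of n] car that unfolding lipschitz_action_on_def by blast
  have s_add: "s n (q + r) x = s n q (s n r x)"
    if x: "x \<in> M" and q: "q * ?P n \<in> \<int>" and r: "r * ?P n \<in> \<int>" for n q r x
  proof -
    obtain a b where ab: "q * ?P n = of_int a" "r * ?P n = of_int b" using q r by (auto elim!: Ints_cases)
    then have "(q + r) * ?P n = of_int (a + b)" by (simp add: distrib_right)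
    then have "s n (q + r) x = \<phi> n ((a + b) mod int (p ^ n)) x" unfolding s_def by (simp only: floor_of_int)
    also have "(a + b) mod int (p ^ n) = a mod int (p ^ n) \<otimes>\<^bsub>integer_mod_group (p ^ n)\<^esub> (b mod int (p ^ n))"
      by (simp add: mod_add_eq)
    also have "\<phi> n (\<dots>) x = \<phi> n (a mod int (p ^ n)) (\<phi> n (b mod int (p ^ n)) x)"
      by (rule group_action.composition_rule[OF \<phi> x car car])
    also have "\<dots> = s n q (s n r x)" by (simp add: s_def ab)
    finally show ?thesis .
  qed
  have s_int: "s n q x = x" if x: "x \<in> M" and q: "q \<in> \<int>" for n q x
  proof -
    obtain a where "q = of_int a" using q by (auto elim: Ints_cases)
    then have "q * ?P n = of_int (a * int (p ^ n))" by simp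
    then have "s n q x = \<phi> n 0 x" unfolding s_def by (simp only: floor_of_int mod_mult_self2_is_0)
    also have "\<dots> = (\<lambda>x\<in>M. x) x" using group_action.id_eq_one[OF \<phi>[of n]] by simp
    finally show ?thesis using x by simp
  qed
  obtain \<Phi> where \<Phi>_in: "\<And>q x. x \<in> M \<Longrightarrow> \<Phi> q x \<in> M"
    and \<Phi>: "\<And>F \<epsilon> N. finite F \<Longrightarrow> F \<subseteq> UNIV \<times> M \<Longrightarrow> \<epsilon> > 0 \<Longrightarrow> \<exists>n\<ge>N. \<forall>(q, x)\<in>F. d (s n q x) (\<Phi> q x) < \<epsilon>"
    by (rule pointwise_cluster_point[of s, OF cpt s_in], assumption) (rule that)
  have \<Phi>_lip: "d (\<Phi> q x) (\<Phi> q y) \<le> K * d x y" if xy: "x \<in> M" "y \<in> M" for q x y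
  proof (rule field_le_epsilon)
    fix e :: real assume "e > 0"
    then obtain n where n: "d (s n q x) (\<Phi> q x) < e / 2" "d (s n q y) (\<Phi> q y) < e / 2"
      using \<Phi>[of "{(q, x), (q, y)}" "e / 2" 0] xy by auto
    have "d (\<Phi> q x) (\<Phi> q y) \<le> d (\<Phi> q x) (s n q x) + d (s n q x) (\<Phi> q y)"
      using xy \<Phi>_in s_in by (intro triangle) auto
    also have "d (s n q x) (\<Phi> q y) \<le> d (s n q x) (s n q y) + d (s n q y) (\<Phi> q y)"
      using xy \<Phi>_in s_in by (intro triangle) auto
    finally show "d (\<Phi> q x) (\<Phi> q y) \<le> K * d x y + e"
      using n s_lip[OF xy, of n q] commute[of "\<Phi> q x" "s n q x"] by linarith
  qed
  have eq_if_close: "x = y" if "x \<in> M" "y \<in> M" "\<And>e. e > 0 \<Longrightarrow> d x y \<le> C * e" for x y C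
  proof -
    have "d x y \<le> 0"
    proof (rule field_le_epsilon)
      fix e :: real assume e: "e > 0"
      have "d x y \<le> C * (e / (\<bar>C\<bar> + 1))" using that(3)[of "e / (\<bar>C\<bar> + 1)"] e by simp
      also have "\<dots> \<le> (\<bar>C\<bar> + 1) * (e / (\<bar>C\<bar> + 1))" using e by (intro mult_right_mono) auto
      also have "\<dots> = e" by simp
      finally show "d x y \<le> 0 + e" by simp
    qed
    then show ?thesis using that(1,2) nonneg[of x y] zero[of x y] by simp
  qed
  have \<Phi>_add: "\<Phi> (q + r) x = \<Phi> q (\<Phi> r x)" if x: "x \<in> M" and q: "q \<in> ?D" and r: "r \<in> ?D" for q r x
  proof (rule eq_if_close[of _ _ "K + 2"])
    show M1: "\<Phi> (q + r) x \<in> M" "\<Phi> q (\<Phi> r x) \<in> M" using x \<Phi>_in by auto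
    fix e :: real assume e: "e > 0"
    obtain N1 where N1: "\<And>n. n \<ge> N1 \<Longrightarrow> q * ?P n \<in> \<int>" by (rule Z_inv_group_eventually_integral[OF p0 q]) (rule that)
    obtain N2 where N2: "\<And>n. n \<ge> N2 \<Longrightarrow> r * ?P n \<in> \<int>" by (rule Z_inv_group_eventually_integral[OF p0 r]) (rule that)
    \<comment> \<open>Three pairs suffice, including one based at the limit point
      \<open>\<Phi> r x\<close>. Replacing \<open>s n r x\<close> by it inside \<open>s n q\<close>
      costs a factor \<open>K\<close>.\<close>
    obtain n where n: "n \<ge> max N1 N2" "d (s n (q + r) x) (\<Phi> (q + r) x) < e" "d (s n r x) (\<Phi> r x) < e"
      "d (s n q (\<Phi> r x)) (\<Phi> q (\<Phi> r x)) < e"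
      using \<Phi>[of "{(q + r, x), (r, x), (q, \<Phi> r x)}" e "max N1 N2"] x \<Phi>_in e by auto
    have sq: "s n (q + r) x = s n q (s n r x)" using s_add[OF x N1 N2] n(1) by simp
    have "d (\<Phi> (q + r) x) (\<Phi> q (\<Phi> r x)) \<le> d (\<Phi> (q + r) x) (s n (q + r) x) + d (s n (q + r) x) (\<Phi> q (\<Phi> r x))"
      using M1 s_in x by (intro triangle) auto
    also have "d (s n (q + r) x) (\<Phi> q (\<Phi> r x)) \<le> d (s n (q + r) x) (s n q (\<Phi> r x)) + d (s n q (\<Phi> r x)) (\<Phi> q (\<Phi> r x))"
      using M1 s_in \<Phi>_in x by (intro triangle) auto
    also have "d (s n (q + r) x) (s n q (\<Phi> r x)) \<le> K * d (s n r x) (\<Phi> r x)"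
      unfolding sq using s_in \<Phi>_in x by (intro s_lip) auto
    also have "\<dots> \<le> K * e" using n(3) K by simp
    finally show "d (\<Phi> (q + r) x) (\<Phi> q (\<Phi> r x)) \<le> (K + 2) * e"
      using n(2,4) commute[of "\<Phi> (q + r) x" "s n (q + r) x"] by (simp add: algebra_simps)
  qed
  have \<Phi>_int: "\<Phi> q x = x" if x: "x \<in> M" and q: "q \<in> \<int>" for q x
  proof (rule eq_if_close[of _ _ 1])
    show "\<Phi> q x \<in> M" "x \<in> M" using x \<Phi>_in by auto
    fix e :: real assume "e > 0"
    then obtain n where "d (s n q x) (\<Phi> q x) < e" using \<Phi>[of "{(q, x)}" e 0] x by auto
    then show "d (\<Phi> q x) x \<le> 1 * e" using s_int[OF x q] commute by simp
  qed
  have \<Phi>_mult: "\<Phi> (of_nat c * q) x = x" if q: "q \<in> ?D" and id: "\<And>x. x \<in> M \<Longrightarrow> \<Phi> q x = x" and x: "x \<in> M" for c q x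
  proof (induction c)
    case (Suc c)
    have "of_nat c * q \<in> ?D" using Z_inv_group_mult_int[OF q, of "int c"] by simp
    then have "\<Phi> (of_nat c * q + q) x = \<Phi> (of_nat c * q) (\<Phi> q x)" using \<Phi>_add[OF x _ q] by blast
    then show ?case using Suc id[OF x] by (simp add: algebra_simps)
  qed (use \<Phi>_int x in simp)
  let ?u = "1 / of_nat p :: rat"
  have uD: "?u \<in> ?D" using Z_inv_groupI[of 1 p 1] by simp
  \<comment> \<open>If 1/p acted trivially in the limit, so would all its multiples. At a suitable
    finite stage the element of order \<open>p\<close> would then have small orbits on a finite net,
    hence everywhere by the Lipschitz bound, against Newman's theorem and effectiveness
    there.\<close>
  have \<Phi>_u: "\<exists>x\<in>M. \<Phi> ?u x \<noteq> x"
  proof (rule ccontr)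
    assume "\<not> ?thesis"
    then have id: "\<And>x. x \<in> M \<Longrightarrow> \<Phi> ?u x = x" by blast
    obtain m where m: "topological_manifold m mtopology" using assms(2) by blast
    show False
    proof (rule newman[OF m cpt p])
      fix \<epsilon> :: real
      assume \<epsilon>: "\<epsilon> > 0" and rigid: "\<And>g y. continuous_map mtopology mtopology g \<Longrightarrow> (\<And>z. z \<in> M \<Longrightarrow> (g ^^ p) z = z) \<Longrightarrow>
        (\<And>z i. z \<in> M \<Longrightarrow> d z ((g ^^ i) z) < \<epsilon>) \<Longrightarrow> y \<in> M \<Longrightarrow> g y = y"
      \<comment> \<open>Passing from \<open>z\<close> to a net point and back costs
        \<open>\<eta> + K * \<eta> = \<epsilon> / 4\<close>, and approximation at the net point
        another \<open>\<epsilon> / 4\<close>.\<close>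
      define \<eta> where "\<eta> = \<epsilon> / 4 / (1 + K)"
      have \<eta>: "\<eta> > 0" using \<epsilon> K by (simp add: \<eta>_def)
      have "\<eta> + K * \<eta> = (1 + K) * \<eta>" by (simp add: algebra_simps)
      also have "\<dots> = \<epsilon> / 4" unfolding \<eta>_def using K
        by (metis add_pos_pos less_irrefl nonzero_mult_div_cancel_left times_divide_eq_right zero_less_one)
      finally have \<eta>K: "\<eta> + K * \<eta> = \<epsilon> / 4" .
      have "mtotally_bounded M" using cpt compactin_imp_mtotally_bounded by (simp add: compact_space_def)
      then have "\<exists>Y. finite Y \<and> Y \<subseteq> M \<and> M \<subseteq> (\<Union>x\<in>Y. mball x \<eta>)"
        unfolding mtotally_bounded_def using \<eta> by simp
      then obtain Y where Y: "finite Y" "Y \<subseteq> M" "M \<subseteq> (\<Union>x\<in>Y. mball x \<eta>)"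
        by (elim exE conjE)
      let ?F = "(\<lambda>(i, y). (of_nat i * ?u, y)) ` ({..<p} \<times> Y)"
      \<comment> \<open>From \<open>n = 1\<close> on, 1/p is represented in Z/p^n.\<close>
      have "\<exists>n\<ge>1. \<forall>(q, x)\<in>?F. d (s n q x) (\<Phi> q x) < \<epsilon> / 4"
        using Y \<epsilon> by (intro \<Phi>) auto
      then obtain n where n: "n \<ge> 1" "\<And>i y. i < p \<Longrightarrow> y \<in> Y \<Longrightarrow> d (s n (of_nat i * ?u) y) (\<Phi> (of_nat i * ?u) y) < \<epsilon> / 4"
        by force
      have uZ: "of_nat i * ?u * ?P n \<in> \<int>" for i
      proof -
        have "?P n = of_nat p * ?P (n - 1)" using n(1) by (metis Suc_diff_1 less_le_trans less_numeral_extra(1) power_Suc)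
        then have "of_nat i * ?u * ?P n = of_nat (i * p ^ (n - 1))" using p0 by simp
        then show ?thesis by (metis Ints_of_nat)
      qed
      define g where "g = s n ?u"
      have g_iter: "(g ^^ i) z = s n (of_nat i * ?u) z" if "z \<in> M" for i z
      proof (induction i)
        case 0
        show ?case using s_int[OF that] by simp
      next
        case (Suc i)
        have "of_nat (Suc i) * ?u = ?u + of_nat i * ?u" by (simp add: add_divide_distrib)
        then show ?case using Suc s_add[OF that, of ?u n "of_nat i * ?u"] uZ[of 1] uZ[of i] by (simp add: g_def)
      qed
      have gp: "(g ^^ p) z = z" if "z \<in> M" for z
        using g_iter[OF that] s_int[OF that] p0 by simp
      have small: "d z (s n (of_nat i * ?u) z) < \<epsilon>" if i: "i < p" and z: "z \<in> M" for i z
      proof -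
        obtain y where y: "y \<in> Y" "d y z < \<eta>" "y \<in> M" using Y z by fastforce
        let ?q = "of_nat i * ?u"
        have 1: "d y (s n ?q y) < \<epsilon> / 4"
          using n(2)[OF i y(1)] \<Phi>_mult[OF uD id y(3), of i] commute by simp
        have "d z (s n ?q z) \<le> d z y + d y (s n ?q z)" using z y s_in by (intro triangle) auto
        also have "d y (s n ?q z) \<le> d y (s n ?q y) + d (s n ?q y) (s n ?q z)" using z y s_in by (intro triangle) auto
        also have "d (s n ?q y) (s n ?q z) \<le> K * d y z" using z y by (intro s_lip) auto
        also have "\<dots> \<le> K * \<eta>" using y K by simp
        finally show ?thesis using 1 y(2) \<eta>K \<epsilon> commute[of z y] by linarith
      qed
      have iter_mod: "(g ^^ i) z = (g ^^ (i mod p)) z" if z: "z \<in> M" for i z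
      proof -
        have "s n (of_nat i * ?u) z = s n (of_nat (i mod p) * ?u) (s n (of_nat (i div p)) z)"
        proof -
          have "of_nat i * ?u = of_nat (i mod p) * ?u + of_nat (i div p)"
          proof -
            have "(of_nat i :: rat) = of_nat (i mod p + p * (i div p))" by simp
            then show ?thesis using p0 by (simp only: of_nat_add of_nat_mult) (simp add: field_simps)
          qed
          moreover have "of_nat (i div p) * ?P n \<in> \<int>" by (intro Ints_mult Ints_power) auto
          ultimately show ?thesis using s_add[OF z uZ] by simp
        qed
        then show ?thesis using g_iter[OF z] s_int[OF z] by simp
      qed
      have "g y = y" if "y \<in> M" for y
      proof (rule rigid)
        show "continuous_map mtopology mtopology g"
          unfolding g_def using s_in s_lip K by (intro lipschitz_imp_continuous_map[where K = K]) auto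
        show "(g ^^ p) z = z" if "z \<in> M" for z by (rule gp[OF that])
        show "d z ((g ^^ i) z) < \<epsilon>" if "z \<in> M" for z i
          unfolding iter_mod[OF that, of i] unfolding g_iter[OF that] using p0 that by (intro small) auto
        show "y \<in> M" by (rule that)
      qed
      \<comment> \<open>\<open>g\<close> is the action of \<open>p ^ (n - 1)\<close>, which is a
        nontrivial element of Z/p^n.\<close>
      moreover have "\<exists>x\<in>M. d x (g x) > 0"
      proof -
        have Pn: "?P n = of_nat p * ?P (n - 1)" using n(1) by (metis Suc_diff_1 less_le_trans less_numeral_extra(1) power_Suc)
        then have "?u * ?P n = of_int (int (p ^ (n - 1)))" using p0 by simp
        then have g_eq: "g = \<phi> n (int (p ^ (n - 1)) mod int (p ^ n))"
          unfolding g_def s_def by (simp only: floor_of_int)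
        have "p ^ (n - 1) < p ^ n" using n(1) prime_gt_1_nat[OF p] by (intro power_strict_increasing) auto
        then have mod: "int (p ^ (n - 1)) mod int (p ^ n) = int (p ^ (n - 1))"
          by (metis mod_less of_nat_mod)
        have "int (p ^ (n - 1)) \<in> carrier (integer_mod_group (p ^ n)) - {\<one>\<^bsub>integer_mod_group (p ^ n)\<^esub>}"
          using car[of "int (p ^ (n - 1))" n] mod p0 by simp
        then show ?thesis using \<phi>_eff[of n] unfolding effective_on_def g_eq mod by blast
      qed
      ultimately show False by (metis less_irrefl zero)
    qed
  qed
  \<comment> \<open>The chosen representative does not matter, since integers act trivially under
    \<Phi>. The restriction to \<open>M\<close> is there because elements of
    \<open>BijGroup M\<close> are extensional.\<close>
  define \<psi> where "\<psi> C = (\<lambda>x\<in>M. \<Phi> (SOME q. q \<in> C) x)" for C :: "rat set"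
  let ?G = "pruefer_group p"
  have D: "C \<subseteq> ?D" if "C \<in> carrier ?G" for C by (rule pruefer_groupD(2)[OF p0 that])
  have \<psi>_eq: "\<psi> C = (\<lambda>x\<in>M. \<Phi> q x)" if C: "C \<in> carrier ?G" and q: "q \<in> C" for C q
  proof -
    define r where "r = (SOME q. q \<in> C)"
    have r: "r \<in> C" unfolding r_def using q by (rule someI)
    have rq: "r - q \<in> \<int>" using pruefer_groupD(3)[OF p0 C r q] .
    have "\<Phi> r x = \<Phi> q x" if x: "x \<in> M" for x
    proof -
      have "\<Phi> (q + (r - q)) x = \<Phi> q (\<Phi> (r - q) x)"
        by (intro \<Phi>_add x subsetD[OF D[OF C] q] subsetD[OF Ints_subset_Z_inv_group rq])
      then show ?thesis using \<Phi>_int[OF x rq] by simp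
    qed
    then show ?thesis unfolding \<psi>_def r_def[symmetric] by (intro restrict_ext) simp
  qed
  have bij: "(\<lambda>x\<in>M. \<Phi> q x) \<in> Bij M" if q: "q \<in> ?D" for q
  proof -
    have nq: "- q \<in> ?D" using Z_inv_group_mult_int[OF q, of "-1"] by simp
    have "\<Phi> (- q) (\<Phi> q x) = x" "\<Phi> q (\<Phi> (- q) x) = x" if "x \<in> M" for x
      using \<Phi>_add[OF that q nq] \<Phi>_add[OF that nq q] \<Phi>_int[OF that, of 0] by simp_all
    then have "bij_betw (\<Phi> q) M M"
      using \<Phi>_in by (intro bij_betw_byWitness[of M "\<Phi> (- q)"]) auto
    then show ?thesis by (simp add: Bij_def)
  qed
  have grp: "group ?G" using comm_group_pruefer_group[OF p0] by (rule comm_group.axioms(2))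
  have "\<psi> \<in> hom ?G (BijGroup M)"
  proof (rule homI)
    show \<psi>_Bij: "\<psi> C \<in> carrier (BijGroup M)" if C: "C \<in> carrier ?G" for C
    proof -
      obtain q where "q \<in> C" using pruefer_groupD(1)[OF p0 C] by blast
      then show ?thesis using \<psi>_eq[OF C] bij D[OF C] by (auto simp: BijGroup_def)
    qed
    fix A B assume A: "A \<in> carrier ?G" and B: "B \<in> carrier ?G"
    obtain q r where q: "q \<in> A" and r: "r \<in> B" using pruefer_groupD(1)[OF p0] A B by blast
    have AB: "A \<otimes>\<^bsub>?G\<^esub> B \<in> carrier ?G" using grp A B by (simp add: group.is_monoid monoid.m_closed)
    have qr: "q + r \<in> A \<otimes>\<^bsub>?G\<^esub> B" using q r by (auto simp: pruefer_group_def set_mult_def)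
    have qD: "q \<in> ?D" and rD: "r \<in> ?D" using q r D[OF A] D[OF B] by auto
    have "\<psi> (A \<otimes>\<^bsub>?G\<^esub> B) = (\<lambda>x\<in>M. \<Phi> q (\<Phi> r x))"
      unfolding \<psi>_eq[OF AB qr] using \<Phi>_add[OF _ qD rD] by (intro restrict_ext) simp
    also have "\<dots> = compose M (\<lambda>x\<in>M. \<Phi> q x) (\<lambda>x\<in>M. \<Phi> r x)"
      unfolding compose_def using \<Phi>_in by (intro restrict_ext) simp
    also have "\<dots> = \<psi> A \<otimes>\<^bsub>BijGroup M\<^esub> \<psi> B"
      using bij[OF qD] bij[OF rD] by (simp add: BijGroup_def \<psi>_eq[OF A q] \<psi>_eq[OF B r])
    finally show "\<psi> (A \<otimes>\<^bsub>?G\<^esub> B) = \<psi> A \<otimes>\<^bsub>BijGroup M\<^esub> \<psi> B" .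
  qed
  then have "group_action ?G M \<psi>"
    using grp group_BijGroup by (simp add: group_action_def group_hom_def group_hom_axioms_def)
  moreover have "effective_on d ?G M \<psi>"
    unfolding effective_on_def
  proof
    fix C assume "C \<in> carrier ?G - {\<one>\<^bsub>?G\<^esub>}"
    then have C: "C \<in> carrier ?G" "C \<noteq> \<int>" by (auto simp: pruefer_group_def)
    obtain q where q: "q \<in> C" using pruefer_groupD(1)[OF p0 C(1)] by blast
    have qZ: "q \<notin> \<int>" using pruefer_groupD(4)[OF p0 C(1) q] C(2) by blast
    have qD: "q \<in> ?D" using q D[OF C(1)] by blast
    obtain c w where cw: "of_nat c * q = ?u + of_int w"
      by (rule Z_inv_group_multiple_one_over_p[OF p qD qZ]) (rule that)
    \<comment> \<open>If \<open>q\<close> acted trivially, so would its multiple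
      \<open>1 / p + w\<close>, and hence 1/p.\<close>
    have "\<exists>x\<in>M. \<Phi> q x \<noteq> x"
    proof (rule ccontr)
      assume "\<not> ?thesis"
      then have id: "\<And>x. x \<in> M \<Longrightarrow> \<Phi> q x = x" by blast
      have "\<Phi> ?u x = x" if x: "x \<in> M" for x
      proof -
        have "\<Phi> (?u + of_int w) x = \<Phi> ?u (\<Phi> (of_int w) x)"
          by (intro \<Phi>_add x uD subsetD[OF Ints_subset_Z_inv_group]) simp
        then show ?thesis using \<Phi>_mult[OF qD id x, of c] \<Phi>_int[OF x, of "of_int w"] cw by simp
      qed
      then show False using \<Phi>_u by blast
    qed
    then obtain x where x: "x \<in> M" "\<Phi> q x \<noteq> x" by blast
    then have "d x (\<psi> C x) \<noteq> 0" using \<psi>_eq[OF C(1) q] \<Phi>_in by auto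
    then have "d x (\<psi> C x) > 0" using nonneg[of x "\<psi> C x"] by linarith
    then show "\<exists>x\<in>M. d x (\<psi> C x) > 0" using x by blast
  qed
  moreover have "lipschitz_action_on K d ?G M \<psi>"
    unfolding lipschitz_action_on_def
  proof (intro ballI)
    fix C x y assume C: "C \<in> carrier ?G" and xy: "x \<in> M" "y \<in> M"
    show "d (\<psi> C x) (\<psi> C y) \<le> K * d x y"
      using \<Phi>_lip[OF xy] xy by (simp add: \<psi>_def)
  qed
  ultimately show ?thesis by blast
qed

end
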